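(* Let $B\subset\mathbb{R}^2$ be a solid body with fluid domain $\Omega=\mathbb{R}^2\setminus B$. Assume $B$ is not contained in a horizontal line. Assume $B$ has two protruding corners that are the lowest and the highest point of $B$, i.e. one attains the minimum and the other attains the maximum of the coordinate $y$ over $B$. Then there is no nontrivial uniformly subsonic flow around $B$, and there is no nontrivial incompressible flow around $B$ with bounded velocity $\mathbf v$.
   Context: Body and fluid domain. The solid body $B\subset\mathbb{R}^2$ is a bounded closed set whose boundary $\partial B$ is a continuous curve composed of finitely many infinitely differentiable segments (a slit-like body such as a line segment is allowed). The fluid domain $\Omega=\mathbb{R}^2\setminus B$ is a connected open set. A point $\mathbf x_0\in\partial B$ is a protruding corner if there is a circular sector $S$ centered at $\mathbf x_0$, with some radius $\epsilon>0$ and some opening angle $\delta>\pi$ (at most $2\pi$), whose interior is contained in $\Omega$. Compressible flow. Fix an isentropic coefficient $\gamma>1$ and a Bernoulli constant $K>0$. The pressure law is $P=\varrho^\gamma$; the enthalpy per mass is $\hat p(\varrho)=\frac{\gamma}{\gamma-1}\varrho^{\gamma-1}$ and the sound speed is $c=\sqrt{\gamma\varrho^{\gamma-1}}$. A (steady, irrotational, inviscid) uniformly subsonic flow around $B$ is given by a stream function $\psi:\Omega\to\mathbb{R}$, velocity $\mathbf v=(v^x,v^y)$ and density $\varrho>0$ on $\Omega$ such that: $\psi$ is infinitely differentiable in $\Omega$ and up to (each side of) the smooth points of $\partial B$; $\nabla\psi$ is bounded on $\Omega$; $\varrho\mathbf v=(\psi_y,-\psi_x)$; the Bernoulli relation $\frac12|\mathbf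 v|^2+\hat p(\varrho)=K$ holds; $\partial_xv^y-\partial_yv^x=0$; the slip condition $\psi=0$ holds on $\partial B$ ($\psi$ extended continuously to $\partial B$); and the Mach number $M=|\mathbf v|/c$ satisfies $M\le 1-\delta$ on $\Omega$ for some constant $\delta>0$. Incompressible flow. An incompressible (irrotational) flow around $B$ is given by a harmonic $\psi:\Omega\to\mathbb{R}$, smooth up to (each side of) the smooth points of $\partial B$, with $\psi=0$ on $\partial B$ and velocity $\mathbf v=(\psi_y,-\psi_x)$. Conventions. The velocity has a limit $\mathbf v_\infty$ as $|\mathbf x|\to\infty$, and the coordinates are such that $\mathbf v_\infty=(v^x_\infty,0)$ with $v^x_\infty\ge0$. A flow is trivial if $\mathbf v\equiv0$, and nontrivial otherwise. *)

theory Defs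
  imports "HOL-Analysis.Analysis"
begin

section \<open>Smooth curves, bodies and corners\<close>

text \<open>One-sided derivatives are used at the endpoints that belong to \<open>S\<close>.\<close>

definition C_infinity_on :: "real set \<Rightarrow> (real \<Rightarrow> 'a::real_normed_vector) \<Rightarrow> bool" where
  "C_infinity_on S f \<longleftrightarrow>
     (\<exists>D :: nat \<Rightarrow> real \<Rightarrow> 'a.
        (\<forall>t\<in>S. D 0 t = f t) \<and>
        (\<forall>k. \<forall>t\<in>S. (D k has_vector_derivative D (Suc k) t) (at t within S)))"

definition smooth_segment :: "(real \<Rightarrow> real \<times> real) \<Rightarrow> bool" where
  "smooth_segment c \<longleftrightarrow>
     C_infinity_on {0..1} c \<and> (\<forall>t\<in>{0..1}. vector_derivative c (at t within {0..1}) \<noteq> 0)"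

text \<open>
  The boundary curve is the concatenation of the segments \<open>c 0, \<dots>, c (n - 1)\<close>. It is not
  required to be simple, so that a slit may be traversed once or back and forth.
\<close>

definition solid_body :: "(real \<times> real) set \<Rightarrow> bool" where
  "solid_body B \<longleftrightarrow>
     bounded B \<and> closed B \<and> connected (- B) \<and>
     (\<exists>(n::nat) (c :: nat \<Rightarrow> real \<Rightarrow> real \<times> real).
        0 < n \<and>
        (\<forall>i<n. smooth_segment (c i)) \<and>
        (\<forall>i. Suc i < n \<longrightarrow> pathfinish (c i) = pathstart (c (Suc i))) \<and>
        frontier B = (\<Union>i<n. path_image (c i)))"

text \<open>
  For \<open>\<delta> < 2 * pi\<close> this is the interior of the closed circular sector. For \<open>\<delta> = 2 * pi\<close> it is
  the open disk minus one radius; the closed sector would then be a full disk, with its centre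
  in the interior.
\<close>

definition open_sector :: "real \<times> real \<Rightarrow> real \<Rightarrow> real \<Rightarrow> real \<Rightarrow> (real \<times> real) set" where
  "open_sector p \<epsilon> \<alpha> \<delta> =
     {p + r *\<^sub>R (cos \<theta>, sin \<theta>) | r \<theta>. 0 < r \<and> r < \<epsilon> \<and> \<alpha> < \<theta> \<and> \<theta> < \<alpha> + \<delta>}"

definition protruding_corner :: "(real \<times> real) set \<Rightarrow> real \<times> real \<Rightarrow> bool" where
  "protruding_corner B p \<longleftrightarrow>
     p \<in> frontier B \<and>
     (\<exists>\<epsilon> \<alpha> \<delta>. 0 < \<epsilon> \<and> pi < \<delta> \<and> \<delta> \<le> 2 * pi \<and> open_sector p \<epsilon> \<alpha> \<delta> \<subseteq> - B)"

section \<open>Smoothness up to each side of the boundary\<close>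

definition partial_x :: "(real \<times> real \<Rightarrow> real) \<Rightarrow> real \<times> real \<Rightarrow> real" where
  "partial_x f p = deriv (\<lambda>x. f (x, snd p)) (fst p)"

definition partial_y :: "(real \<times> real \<Rightarrow> real) \<Rightarrow> real \<times> real \<Rightarrow> real" where
  "partial_y f p = deriv (\<lambda>y. f (fst p, y)) (snd p)"

definition partial_xy :: "nat \<Rightarrow> nat \<Rightarrow> (real \<times> real \<Rightarrow> real) \<Rightarrow> real \<times> real \<Rightarrow> real" where
  "partial_xy i j f = (partial_x ^^ i) ((partial_y ^^ j) f)"

text \<open>
  On an open set this is infinite differentiability: total differentiability of every iterated
  partial derivative implies its continuity, and that mixed partial derivatives commute.
\<close>

definition smooth_in :: "(real \<times> real) set \<Rightarrow> (real \<times> real \<Rightarrow> real) \<Rightarrow> bool" where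
  "smooth_in U f \<longleftrightarrow> (\<forall>i j. partial_xy i j f differentiable_on U)"

definition local_frame :: "real \<times> real \<Rightarrow> real \<Rightarrow> real \<times> real \<Rightarrow> real \<times> real" where
  "local_frame p \<alpha> = (\<lambda>(s, t). p + s *\<^sub>R (cos \<alpha>, sin \<alpha>) + t *\<^sub>R (- sin \<alpha>, cos \<alpha>))"

text \<open>
  \<open>p\<close> is a smooth point of \<open>frontier B\<close> if in some rotated coordinates centred at \<open>p\<close> the frontier
  is locally the graph of a smooth function \<open>h\<close>; \<open>V\<close> is then the part of the coordinate square
  above the graph. The part below the graph is covered as well, by rotating by \<open>pi\<close>.
  \<open>V\<close> is connected and disjoint from \<open>frontier B\<close>, hence contained in either \<open>- B\<close> or
  \<open>interior B\<close>; at a point of a slit both sides are contained in \<open>- B\<close>.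
\<close>

definition smooth_boundary_side ::
    "(real \<times> real) set \<Rightarrow> real \<times> real \<Rightarrow> (real \<times> real) set \<Rightarrow> bool" where
  "smooth_boundary_side B p V \<longleftrightarrow>
     (\<exists>\<alpha> \<epsilon> (h :: real \<Rightarrow> real).
        0 < \<epsilon> \<and> C_infinity_on {-\<epsilon><..<\<epsilon>} h \<and> h 0 = 0 \<and> h ` {-\<epsilon><..<\<epsilon>} \<subseteq> {-\<epsilon><..<\<epsilon>} \<and>
        frontier B \<inter> local_frame p \<alpha> ` ({-\<epsilon><..<\<epsilon>} \<times> {-\<epsilon><..<\<epsilon>})
          = (\<lambda>s. local_frame p \<alpha> (s, h s)) ` {-\<epsilon><..<\<epsilon>} \<and>
        V = local_frame p \<alpha> ` {(s, t). -\<epsilon> < s \<and> s < \<epsilon> \<and> h s < t \<and> t < \<epsilon>})"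

text \<open>
  The smooth points form a relatively open subset of the frontier, so the existence of the
  one-sided limits at all of them says that every derivative extends continuously to that side.
\<close>

definition smooth_up_to_boundary :: "(real \<times> real) set \<Rightarrow> (real \<times> real \<Rightarrow> real) \<Rightarrow> bool" where
  "smooth_up_to_boundary B f \<longleftrightarrow>
     smooth_in (- B) f \<and>
     (\<forall>p V. smooth_boundary_side B p V \<and> V \<subseteq> - B \<longrightarrow>
        (\<forall>i j. \<exists>l. (partial_xy i j f \<longlongrightarrow> l) (at p within V)))"

section \<open>Flows\<close>

text \<open>
  All fields are total functions, but only their values on the fluid domain \<open>- B\<close> matter.
\<close>

definition slip_condition :: "(real \<times> real) set \<Rightarrow> (real \<times> real \<Rightarrow> real) \<Rightarrow> bool" where
  "slip_condition B \<psi> \<longleftrightarrow> (\<forall>p\<in>frontier B. (\<psi> \<longlongrightarrow> 0) (at p within - B))"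

definition horizontal_at_infinity :: "(real \<times> real \<Rightarrow> real \<times> real) \<Rightarrow> bool" where
  "horizontal_at_infinity v \<longleftrightarrow> (\<exists>u\<ge>0. (v \<longlongrightarrow> (u, 0)) at_infinity)"

definition nontrivial_flow ::
    "(real \<times> real) set \<Rightarrow> (real \<times> real \<Rightarrow> real \<times> real) \<Rightarrow> bool" where
  "nontrivial_flow B v \<longleftrightarrow> (\<exists>p\<in>- B. v p \<noteq> 0)"

definition enthalpy :: "real \<Rightarrow> real \<Rightarrow> real" where
  "enthalpy \<gamma> \<rho> = \<gamma> / (\<gamma> - 1) * \<rho> powr (\<gamma> - 1)"

definition sound_speed :: "real \<Rightarrow> real \<Rightarrow> real" where
  "sound_speed \<gamma> \<rho> = sqrt (\<gamma> * \<rho> powr (\<gamma> - 1))"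

definition uniformly_subsonic_flow ::
    "real \<Rightarrow> real \<Rightarrow> (real \<times> real) set \<Rightarrow> (real \<times> real \<Rightarrow> real) \<Rightarrow>
     (real \<times> real \<Rightarrow> real \<times> real) \<Rightarrow> (real \<times> real \<Rightarrow> real) \<Rightarrow> bool" where
  "uniformly_subsonic_flow \<gamma> K B \<psi> v \<rho> \<longleftrightarrow>
     smooth_up_to_boundary B \<psi> \<and>
     bounded ((\<lambda>p. (partial_x \<psi> p, partial_y \<psi> p)) ` (- B)) \<and>
     (\<forall>p\<in>- B. 0 < \<rho> p) \<and>
     (\<forall>p\<in>- B. \<rho> p *\<^sub>R v p = (partial_y \<psi> p, - partial_x \<psi> p)) \<and>
     (\<forall>p\<in>- B. (norm (v p))\<^sup>2 / 2 + enthalpy \<gamma> (\<rho> p) = K) \<and>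
     v differentiable_on (- B) \<and>
     (\<forall>p\<in>- B. partial_x (\<lambda>q. snd (v q)) p - partial_y (\<lambda>q. fst (v q)) p = 0) \<and>
     slip_condition B \<psi> \<and>
     (\<exists>\<delta>>0. \<forall>p\<in>- B. norm (v p) / sound_speed \<gamma> (\<rho> p) \<le> 1 - \<delta>)"

definition harmonic_in :: "(real \<times> real) set \<Rightarrow> (real \<times> real \<Rightarrow> real) \<Rightarrow> bool" where
  "harmonic_in U f \<longleftrightarrow>
     smooth_in U f \<and> (\<forall>p\<in>U. partial_x (partial_x f) p + partial_y (partial_y f) p = 0)"

definition incompressible_flow ::
    "(real \<times> real) set \<Rightarrow> (real \<times> real \<Rightarrow> real) \<Rightarrow> (real \<times> real \<Rightarrow> real \<times> real) \<Rightarrow> bool" where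
  "incompressible_flow B \<psi> v \<longleftrightarrow>
     harmonic_in (- B) \<psi> \<and>
     smooth_up_to_boundary B \<psi> \<and>
     slip_condition B \<psi> \<and>
     (\<forall>p\<in>- B. v p = (partial_y \<psi> p, - partial_x \<psi> p))"

end

theory Submission
  imports Defs
begin

text \<open>
  Write \<open>m\<close> for the limit of \<open>\<psi>\<^sub>y\<close> at infinity, and \<open>y\<^sub>l\<close>, \<open>y\<^sub>h\<close> for the heights of the two
  corners. In both kinds of flow the stream function solves a linear equation
  \<open>a \<psi>\<^sub>x\<^sub>x + 2 b \<psi>\<^sub>x\<^sub>y + c \<psi>\<^sub>y\<^sub>y = 0\<close> which is uniformly elliptic: for a compressible flow the coefficient
  matrix is the identity minus \<open>v v\<^sup>T\<close> over the squared sound speed, and the Mach number stays away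
  from 1; for an incompressible flow it is the identity. Affine functions
  solve every such equation, so the maximum principle applies to
  \<open>w\<^sub>h = \<psi> - m (y - y\<^sub>h)\<close> and \<open>w\<^sub>l = \<psi> - m (y - y\<^sub>l)\<close>. On the boundary \<open>\<psi> = 0\<close>, hence \<open>w\<^sub>h \<ge> 0\<close> there with
  equality at the highest corner, and \<open>w\<^sub>l \<le> 0\<close> with equality at the lowest corner.

  At a protruding corner, a nonnegative solution that vanishes at the corner vanishes identically if
  its gradient is bounded (\<open>nonneg_solution_at_corner_vanishes\<close>): otherwise it is positive by the
  strong minimum principle, and a barrier forces it to grow at least like \<open>r\<close> to a power below 1
  in a sector wider than a half plane.

  So it suffices that \<open>w\<^sub>h \<ge> 0\<close> or \<open>w\<^sub>l \<le> 0\<close> in the whole fluid, and by the minimum principle this only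
  has to be known near infinity. There it follows once \<open>W = \<psi> - m y\<close> has a limit, finite or
  infinite: the limit is at least \<open>- m y\<^sub>h\<close> or at most \<open>- m y\<^sub>l\<close>, because \<open>y\<^sub>l \<le> y\<^sub>h\<close>. Instead of the limit
  it is enough that the oscillation of \<open>W\<close> over large circles tends to 0, by the maximum principle
  on annuli (\<open>one_sided_at_infinity\<close>).

  The oscillation is controlled as follows (\<open>oscillation_on_circles\<close>). After a linear change of
  coordinates the equation becomes \<open>\<Delta>W = h\<close> with \<open>|h|\<close> at most a constant times \<open>|\<nabla>W| |D\<^sup>2W|\<close>. In
  particular the complex conjugate of \<open>\<nabla>W\<close> is quasiregular near infinity and tends to 0. The
  isoperimetric inequality makes the Dirichlet integral of \<open>\<nabla>W\<close> outside a circle decay like a power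
  of the radius, and with a maximum principle for the components of \<open>\<nabla>W\<close> it follows that \<open>|\<nabla>W|\<close>
  is at most a constant times \<open>r\<close> to the power \<open>-4/5\<close> (\<open>gradient_decay\<close>). Thus \<open>h\<close> is small,
  and with \<open>t = ln r\<close> the function \<open>A(t)\<close>, the integral of \<open>W\<^sub>\<theta>\<^sup>2\<close> over the circle, satisfies a convexity inequality
  \<open>A'' \<ge> k\<^sup>2 A - (small)\<close>. As \<open>A\<close> grows more slowly than \<open>exp (k t)\<close>, it must tend to 0.

  If \<open>w\<^sub>h\<close> or \<open>w\<^sub>l\<close> vanishes identically, then \<open>\<psi> = 0\<close> on the boundary confines the body to a
  horizontal line, unless \<open>m = 0\<close>; in that case \<open>\<psi> = 0\<close> and the flow is trivial.
\<close>

section \<open>Partial derivatives\<close>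

text \<open>A single notion of total differentiability with named partial derivatives serves for the flow, for
barriers, and for functions of logarithmic polar coordinates.\<close>

definition has_partials ::
    "(real \<times> real) set \<Rightarrow> (real \<times> real \<Rightarrow> real) \<Rightarrow> (real \<times> real \<Rightarrow> real) \<Rightarrow> (real \<times> real \<Rightarrow> real) \<Rightarrow> bool" where
  "has_partials U f fx fy \<longleftrightarrow>
     (\<forall>p\<in>U. (f has_derivative (\<lambda>h. fx p * fst h + fy p * snd h)) (at p))"

lemma has_partialsD:
  "has_partials U f fx fy \<Longrightarrow> p \<in> U \<Longrightarrow> (f has_derivative (\<lambda>h. fx p * fst h + fy p * snd h)) (at p)"
  by (simp add: has_partials_def)

lemma has_partials_continuous_on: "has_partials U f fx fy \<Longrightarrow> continuous_on U f"
  unfolding has_partials_def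
  by (metis continuous_at_imp_continuous_on has_derivative_continuous)

lemma has_partials_subset: "has_partials U f fx fy \<Longrightarrow> V \<subseteq> U \<Longrightarrow> has_partials V f fx fy"
  by (auto simp: has_partials_def)

lemma has_partials_rhs:
  "has_partials U f fx fy \<Longrightarrow> (\<And>p. p \<in> U \<Longrightarrow> fx p = gx p) \<Longrightarrow> (\<And>p. p \<in> U \<Longrightarrow> fy p = gy p)
    \<Longrightarrow> has_partials U f gx gy"
  by (auto simp: has_partials_def)

lemma has_partials_const: "has_partials U (\<lambda>p. c) (\<lambda>p. 0) (\<lambda>p. 0)"
  by (auto simp: has_partials_def)

lemma has_partials_fst: "has_partials U fst (\<lambda>p. 1) (\<lambda>p. 0)"
  by (auto simp: has_partials_def intro!: derivative_eq_intros)

lemma has_partials_snd: "has_partials U snd (\<lambda>p. 0) (\<lambda>p. 1)"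
  by (auto simp: has_partials_def intro!: derivative_eq_intros)

lemma has_partials_add:
  "has_partials U f fx fy \<Longrightarrow> has_partials U g gx gy \<Longrightarrow>
    has_partials U (\<lambda>p. f p + g p) (\<lambda>p. fx p + gx p) (\<lambda>p. fy p + gy p)"
  unfolding has_partials_def
  by (auto intro!: derivative_eq_intros simp: algebra_simps)

lemma has_partials_diff:
  "has_partials U f fx fy \<Longrightarrow> has_partials U g gx gy \<Longrightarrow>
    has_partials U (\<lambda>p. f p - g p) (\<lambda>p. fx p - gx p) (\<lambda>p. fy p - gy p)"
  unfolding has_partials_def
  by (auto intro!: derivative_eq_intros simp: algebra_simps)

lemma has_partials_minus:
  "has_partials U f fx fy \<Longrightarrow> has_partials U (\<lambda>p. - f p) (\<lambda>p. - fx p) (\<lambda>p. - fy p)"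
  unfolding has_partials_def
  by (auto intro!: derivative_eq_intros simp: algebra_simps)

lemma has_partials_mult:
  "has_partials U f fx fy \<Longrightarrow> has_partials U g gx gy \<Longrightarrow>
    has_partials U (\<lambda>p. f p * g p) (\<lambda>p. fx p * g p + f p * gx p) (\<lambda>p. fy p * g p + f p * gy p)"
  unfolding has_partials_def
  by (auto intro!: derivative_eq_intros simp: algebra_simps)

lemma has_partials_cmult:
  "has_partials U f fx fy \<Longrightarrow> has_partials U (\<lambda>p. c * f p) (\<lambda>p. c * fx p) (\<lambda>p. c * fy p)"
  unfolding has_partials_def
  by (auto intro!: derivative_eq_intros simp: algebra_simps)

lemma has_partials_chain:
  assumes "has_partials U f fx fy"
    and "\<And>p. p \<in> U \<Longrightarrow> (g has_real_derivative g' p) (at (f p))"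
  shows "has_partials U (\<lambda>p. g (f p)) (\<lambda>p. g' p * fx p) (\<lambda>p. g' p * fy p)"
  unfolding has_partials_def
proof
  fix p assume p: "p \<in> U"
  have "(f has_derivative (\<lambda>h. fx p * fst h + fy p * snd h)) (at p)"
    using assms(1) p by (simp add: has_partials_def)
  from has_derivative_compose[OF this assms(2)[OF p, unfolded has_field_derivative_def]]
  show "((\<lambda>p. g (f p)) has_derivative (\<lambda>h. g' p * fx p * fst h + g' p * fy p * snd h)) (at p)"
    by (simp add: algebra_simps)
qed

lemma has_partials_compose:
  assumes F: "has_partials V F Fx Fy"
    and a: "has_partials U a ax ay" and b: "has_partials U b bx by'"
    and sub: "\<And>p. p \<in> U \<Longrightarrow> (a p, b p) \<in> V"
  shows "has_partials U (\<lambda>p. F (a p, b p))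
    (\<lambda>p. Fx (a p, b p) * ax p + Fy (a p, b p) * bx p)
    (\<lambda>p. Fx (a p, b p) * ay p + Fy (a p, b p) * by' p)"
  unfolding has_partials_def
proof
  fix p assume p: "p \<in> U"
  have 1: "((\<lambda>p. (a p, b p)) has_derivative
      (\<lambda>h. (ax p * fst h + ay p * snd h, bx p * fst h + by' p * snd h))) (at p)"
    by (intro has_derivative_Pair has_partialsD[OF a p] has_partialsD[OF b p])
  from has_derivative_compose[OF 1 has_partialsD[OF F sub[OF p]]]
  show "((\<lambda>p. F (a p, b p)) has_derivative (\<lambda>h. (Fx (a p, b p) * ax p + Fy (a p, b p) * bx p) * fst h +
      (Fx (a p, b p) * ay p + Fy (a p, b p) * by' p) * snd h)) (at p)"
    by (simp add: algebra_simps)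
qed

lemma has_partials_line:
  assumes F: "has_partials U F Fx Fy" and p: "p + s *\<^sub>R d \<in> U"
  shows "((\<lambda>s. F (p + s *\<^sub>R d)) has_real_derivative
           (Fx (p + s *\<^sub>R d) * fst d + Fy (p + s *\<^sub>R d) * snd d)) (at s within X)"
proof -
  have 1: "((\<lambda>s. p + s *\<^sub>R d) has_derivative (\<lambda>h. h *\<^sub>R d)) (at s within X)"
    by (auto intro!: derivative_eq_intros)
  from has_derivative_compose[OF 1 has_partialsD[OF F p]]
  show ?thesis unfolding has_field_derivative_def
    by (rule has_derivative_eq_rhs) (auto simp: algebra_simps)
qed

lemma has_partials_slice_fst:
  assumes F: "has_partials U F Fx Fy" and p: "(x, y) \<in> U"
  shows "((\<lambda>x. F (x, y)) has_real_derivative Fx (x, y)) (at x within X)"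
  using has_partials_line[OF F, of "(0, y)" x "(1, 0)" X] p by simp

lemma has_partials_slice_snd:
  assumes F: "has_partials U F Fx Fy" and p: "(x, y) \<in> U"
  shows "((\<lambda>y. F (x, y)) has_real_derivative Fy (x, y)) (at y within X)"
  using has_partials_line[OF F, of "(x, 0)" y "(0, 1)" X] p by simp

lemma has_partials_swap:
  assumes F: "has_partials U F Fx Fy"
  shows "has_partials (prod.swap ` U) (\<lambda>p. F (snd p, fst p)) (\<lambda>p. Fy (snd p, fst p)) (\<lambda>p. Fx (snd p, fst p))"
  by (rule has_partials_rhs[OF has_partials_compose[OF F has_partials_snd has_partials_fst]])
     (auto simp: prod.swap_def)

text \<open>The mean value theorem in the first variable turns the second difference into a difference of
\<open>Gx\<close>, and the differentiability of \<open>Gx\<close> at \<open>p\<close> evaluates that to first order (Young).\<close>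

lemma second_difference_quotient:
  assumes U: "open U" "p \<in> U"
    and G: "has_partials U G Gx Gy" and Gx: "has_partials U Gx a b" and e: "e > 0"
  shows "eventually (\<lambda>h. \<bar>G (fst p + h, snd p + h) - G (fst p + h, snd p) - G (fst p, snd p + h) + G p - h\<^sup>2 * b p\<bar>
      \<le> e * h\<^sup>2) (at_right 0)"
proof -
  obtain x y where pxy: "p = (x, y)" by force
  have e4: "e / 4 > 0" using e by simp
  obtain d1 where d1: "d1 > 0" and 1: "\<And>q. norm (q - p) < d1 \<Longrightarrow>
      norm (Gx q - Gx p - (a p * fst (q - p) + b p * snd (q - p))) \<le> e/4 * norm (q - p)"
    using has_partialsD[OF Gx U(2)] e4 unfolding has_derivative_at_alt by blast
  obtain d2 where d2: "d2 > 0" and 2: "ball p d2 \<subseteq> U" using U open_contains_ball by blast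
  have nrm: "norm ((u, v) :: real \<times> real) \<le> 2 * h" if "\<bar>u\<bar> \<le> h" "\<bar>v\<bar> \<le> h" for u v h
    using norm_Pair_le[of u v] that by simp
  define d where "d = min d1 d2 / 3"
  have d: "d > 0" "3 * d \<le> d1" "3 * d \<le> d2" using d1 d2 by (auto simp: d_def)
  have "\<bar>G (x + h, y + h) - G (x + h, y) - G (x, y + h) + G (x, y) - h\<^sup>2 * b p\<bar> \<le> e * h\<^sup>2"
    if h: "0 < h" "h < d" for h
  proof -
    have inU: "(s, t) \<in> U" if "\<bar>s - x\<bar> \<le> h" "\<bar>t - y\<bar> \<le> h" for s t
    proof -
      have "dist p (s, t) = norm (s - x, t - y)" by (simp add: pxy dist_norm norm_minus_commute norm_Pair power2_commute)
      also have "\<dots> < d2" using nrm[OF that] h d by linarith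
      finally show ?thesis using 2 by auto
    qed
    have "\<exists>z>x. z < x + h \<and> (G (x + h, y + h) - G (x + h, y)) - (G (x, y + h) - G (x, y))
       = (x + h - x) * (Gx (z, y + h) - Gx (z, y))"
      by (rule MVT2[where f="\<lambda>s. G (s, y + h) - G (s, y)"])
         (use h in \<open>auto intro!: DERIV_diff has_partials_slice_fst[OF G] inU\<close>)
    then obtain z where z: "x < z" "z < x + h"
      and eq: "G (x + h, y + h) - G (x + h, y) - G (x, y + h) + G (x, y) = h * (Gx (z, y + h) - Gx (z, y))"
      by auto
    have n1: "norm ((z, y + h) - p) \<le> 2 * h" "norm ((z, y) - p) \<le> 2 * h"
      using z h by (auto simp: pxy intro!: nrm)
    have A: "\<bar>Gx (z, y + h) - Gx p - (a p * (z - x) + b p * h)\<bar> \<le> e/4 * (2 * h)"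
      using order_trans[OF 1[of "(z, y+h)"] mult_left_mono[OF n1(1), of "e/4"]] n1(1) h d e
      by (simp add: pxy)
    have B: "\<bar>Gx (z, y) - Gx p - (a p * (z - x))\<bar> \<le> e/4 * (2 * h)"
      using order_trans[OF 1[of "(z, y)"] mult_left_mono[OF n1(2), of "e/4"]] n1(2) h d e
      by (simp add: pxy)
    have "\<bar>Gx (z, y + h) - Gx (z, y) - b p * h\<bar> \<le> e * h"
    proof -
      have "e/4 * (2 * h) = e * h / 2" by simp
      with A B show ?thesis by linarith
    qed
    then have "h * \<bar>Gx (z, y + h) - Gx (z, y) - b p * h\<bar> \<le> h * (e * h)"
      using h by (intro mult_left_mono) auto
    moreover have "h * \<bar>Gx (z, y + h) - Gx (z, y) - b p * h\<bar> = \<bar>h * (Gx (z, y + h) - Gx (z, y)) - h\<^sup>2 * b p\<bar>"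
    proof -
      have "h * \<bar>Gx (z, y + h) - Gx (z, y) - b p * h\<bar> = \<bar>h * (Gx (z, y + h) - Gx (z, y) - b p * h)\<bar>"
        using h by (simp add: abs_mult)
      then show ?thesis by (simp add: algebra_simps power2_eq_square)
    qed
    ultimately show ?thesis unfolding eq by (simp add: power2_eq_square algebra_simps)
  qed
  with d(1) show ?thesis
    unfolding eventually_at_right[OF zero_less_one] pxy fst_conv snd_conv by blast
qed

text \<open>The second difference is symmetric in the two variables, so its quotient tends to both mixed
derivatives.\<close>

lemma mixed_partials_commute:
  assumes U: "open U" "p \<in> U"
    and G: "has_partials U G Gx Gy" and Gx: "has_partials U Gx a b" and Gy: "has_partials U Gy c d"
  shows "b p = c p"
proof (rule ccontr)
  assume ne: "b p \<noteq> c p"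
  define e where "e = \<bar>b p - c p\<bar> / 4"
  have e: "e > 0" using ne by (simp add: e_def)
  have ev1: "eventually (\<lambda>h. \<bar>G (fst p + h, snd p + h) - G (fst p + h, snd p) - G (fst p, snd p + h) + G p - h\<^sup>2 * b p\<bar>
      \<le> e * h\<^sup>2) (at_right 0)"
    by (rule second_difference_quotient[OF U G Gx e])
  have oS: "open (prod.swap ` U)"
  proof -
    have "q \<in> prod.swap ` U \<longleftrightarrow> q \<in> prod.swap -` U" for q
      by (cases q) (force simp: image_iff)
    then have "prod.swap ` U = prod.swap -` U" by blast
    then show ?thesis using U(1) by (auto intro!: open_vimage continuous_intros simp: prod.swap_def)
  qed
  have ev2: "eventually (\<lambda>h. \<bar>G (fst p + h, snd p + h) - G (fst p, snd p + h) - G (fst p + h, snd p) + G p - h\<^sup>2 * c p\<bar>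
      \<le> e * h\<^sup>2) (at_right 0)"
    using second_difference_quotient[OF oS _ has_partials_swap[OF G] has_partials_swap[OF Gy] e, of "prod.swap p"] U(2)
    by (simp add: prod.swap_def)
  have "eventually (\<lambda>h::real. False) (at_right 0)"
    using ev1 ev2 eventually_at_right_less[of 0]
  proof eventually_elim
    case (elim h)
    then have "\<bar>h\<^sup>2 * b p - h\<^sup>2 * c p\<bar> \<le> 2 * e * h\<^sup>2" by linarith
    moreover have "\<bar>h\<^sup>2 * b p - h\<^sup>2 * c p\<bar> = h\<^sup>2 * \<bar>b p - c p\<bar>"
      unfolding right_diff_distrib[symmetric] abs_mult by simp
    ultimately have "h\<^sup>2 * \<bar>b p - c p\<bar> \<le> h\<^sup>2 * (2 * e)" by (simp add: mult.commute)
    then have "\<bar>b p - c p\<bar> \<le> 2 * e" using elim(3) by simp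
    then show ?case using e by (simp add: e_def)
  qed
  then show False by simp
qed

lemma differentiable_has_partials:
  assumes U: "open U" and f: "f differentiable_on U"
  shows "has_partials U f (partial_x f) (partial_y f)"
  unfolding has_partials_def
proof
  fix p assume p: "p \<in> U"
  then have "f differentiable (at p)" using f U by (simp add: differentiable_on_eq_differentiable_at)
  then obtain f' where f': "(f has_derivative f') (at p)" by (auto simp: differentiable_def)
  interpret bounded_linear f' using f' by (rule has_derivative_bounded_linear)
  have lin: "f' h = f' (1, 0) * fst h + f' (0, 1) * snd h" for h
  proof -
    have "f' h = f' (fst h *\<^sub>R (1, 0) + snd h *\<^sub>R (0, 1))" by simp
    also have "\<dots> = f' (1, 0) * fst h + f' (0, 1) * snd h" unfolding add scaleR by simp
    finally show ?thesis .
  qed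
  have hp: "has_partials {p} f (\<lambda>_. f' (1, 0)) (\<lambda>_. f' (0, 1))"
    unfolding has_partials_def using has_derivative_eq_rhs[OF f' ext[OF lin]] by simp
  have "partial_x f p = f' (1, 0)" unfolding partial_x_def
    using has_partials_slice_fst[OF hp, of "fst p" "snd p" UNIV] by (simp add: DERIV_imp_deriv)
  moreover have "partial_y f p = f' (0, 1)" unfolding partial_y_def
    using has_partials_slice_snd[OF hp, of "fst p" "snd p" UNIV] by (simp add: DERIV_imp_deriv)
  ultimately show "(f has_derivative (\<lambda>h. partial_x f p * fst h + partial_y f p * snd h)) (at p)"
    using has_derivative_eq_rhs[OF f' ext[OF lin]] by simp
qed

lemma has_partials_unique:
  assumes f: "has_partials U f fx fy" and p: "p \<in> U"
  shows "partial_x f p = fx p" "partial_y f p = fy p"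
  using has_partials_slice_fst[OF f, of "fst p" "snd p" UNIV]
    has_partials_slice_snd[OF f, of "fst p" "snd p" UNIV] p
  by (auto simp: partial_x_def partial_y_def DERIV_imp_deriv)

lemma has_partials_cong:
  assumes U: "open U" and f: "has_partials U f fx fy" and eq: "\<And>p. p \<in> U \<Longrightarrow> f p = g p"
  shows "has_partials U g fx fy"
  unfolding has_partials_def
proof
  fix p assume p: "p \<in> U"
  show "(g has_derivative (\<lambda>h. fx p * fst h + fy p * snd h)) (at p)"
    by (rule has_derivative_transform_within_open[OF has_partialsD[OF f p] U p]) (use eq in auto)
qed

lemma partial_y_partial_xy:
  assumes U: "open U" and f: "smooth_in U f"
  shows "p \<in> U \<Longrightarrow> partial_y (partial_xy i j f) p = partial_xy i (Suc j) f p"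
proof (induction i arbitrary: p)
  case 0
  then show ?case by (simp add: partial_xy_def)
next
  case (Suc i)
  have D: "has_partials U (partial_xy i j f) (partial_x (partial_xy i j f)) (partial_y (partial_xy i j f))" for i j
    using f by (intro differentiable_has_partials U) (auto simp: smooth_in_def)
  have S: "partial_x (partial_xy i j f) = partial_xy (Suc i) j f" for i j
    by (simp add: partial_xy_def)
  have G: "has_partials U (partial_xy i j f) (partial_xy (Suc i) j f) (partial_xy i (Suc j) f)"
    by (rule has_partials_rhs[OF D]) (auto simp: S Suc.IH)
  from mixed_partials_commute[OF U Suc.prems G D D]
  show ?case by (simp add: S)
qed

text \<open>The iterated partial derivatives in \<open>smooth_in\<close> are ordered, with the derivatives in \<open>y\<close> taken first;
commuting the derivatives makes both indices increase freely.\<close>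

lemma smooth_in_has_partials:
  assumes U: "open U" and f: "smooth_in U f"
  shows "has_partials U (partial_xy i j f) (partial_xy (Suc i) j f) (partial_xy i (Suc j) f)"
proof -
  have "has_partials U (partial_xy i j f) (partial_x (partial_xy i j f)) (partial_y (partial_xy i j f))"
    using f by (intro differentiable_has_partials U) (auto simp: smooth_in_def)
  then show ?thesis
    by (rule has_partials_rhs) (auto simp: partial_y_partial_xy[OF U f], simp add: partial_xy_def)
qed

section \<open>Maximum principles for elliptic operators\<close>

definition has_hessian where
  "has_hessian U u ux uy uxx uxy uyy \<longleftrightarrow>
     has_partials U u ux uy \<and> has_partials U ux uxx uxy \<and> has_partials U uy uxy uyy"

lemma has_hessian_subset:
  "has_hessian U u ux uy uxx uxy uyy \<Longrightarrow> V \<subseteq> U \<Longrightarrow> has_hessian V u ux uy uxx uxy uyy"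
  by (auto simp: has_hessian_def intro: has_partials_subset)

lemma has_hessian_continuous_on: "has_hessian U u ux uy uxx uxy uyy \<Longrightarrow> continuous_on U u"
  by (auto simp: has_hessian_def intro: has_partials_continuous_on)

lemma has_hessian_add:
  "has_hessian U u ux uy uxx uxy uyy \<Longrightarrow> has_hessian U v vx vy vxx vxy vyy \<Longrightarrow>
   has_hessian U (\<lambda>p. u p + v p) (\<lambda>p. ux p + vx p) (\<lambda>p. uy p + vy p)
     (\<lambda>p. uxx p + vxx p) (\<lambda>p. uxy p + vxy p) (\<lambda>p. uyy p + vyy p)"
  by (auto simp: has_hessian_def intro: has_partials_add)

lemma has_hessian_cmult:
  "has_hessian U u ux uy uxx uxy uyy \<Longrightarrow>
   has_hessian U (\<lambda>p. c * u p) (\<lambda>p. c * ux p) (\<lambda>p. c * uy p)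
     (\<lambda>p. c * uxx p) (\<lambda>p. c * uxy p) (\<lambda>p. c * uyy p)"
  by (auto simp: has_hessian_def intro: has_partials_cmult)

lemma has_hessian_affine:
  "has_hessian U (\<lambda>p. a * fst p + b * snd p + c) (\<lambda>p. a) (\<lambda>p. b) (\<lambda>p. 0) (\<lambda>p. 0) (\<lambda>p. 0)"
  unfolding has_hessian_def
  by (intro conjI has_partials_const)
     (rule has_partials_rhs[OF has_partials_add[OF has_partials_add[OF has_partials_cmult[OF has_partials_fst]
        has_partials_cmult[OF has_partials_snd]] has_partials_const]], auto)

lemma norm_sq_coords: "(norm (p :: real \<times> real))\<^sup>2 = (fst p)\<^sup>2 + (snd p)\<^sup>2"
  by (simp add: norm_prod_def)

lemma second_derivative_at_min:
  fixes f f' :: "real \<Rightarrow> real"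
  assumes d: "d > 0" and f: "\<And>s. \<bar>s\<bar> < d \<Longrightarrow> (f has_real_derivative f' s) (at s)"
    and f': "(f' has_real_derivative D) (at 0)" and min: "\<And>s. \<bar>s\<bar> < d \<Longrightarrow> f 0 \<le> f s"
  shows "f' 0 = 0" "D \<ge> 0"
proof -
  show 0: "f' 0 = 0"
    by (rule DERIV_local_min[OF f[of 0] d]) (use d min in auto)
  show "D \<ge> 0"
  proof (rule ccontr)
    assume "\<not> D \<ge> 0"
    then obtain e where e: "e > 0" "\<And>h. 0 < h \<Longrightarrow> h < e \<Longrightarrow> f' (0 + h) < f' 0"
      using DERIV_neg_dec_right[OF f'] by auto
    define h where "h = min d e / 2"
    have h: "0 < h" "h < d" "h < e" using d e(1) by (auto simp: h_def)
    have "\<exists>z>0. z < h \<and> f h - f 0 = (h - 0) * f' z"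
      by (rule MVT2) (use h in \<open>auto intro!: f\<close>)
    then obtain z where z: "0 < z" "z < h" "f h - f 0 = h * f' z" by auto
    have "f' z < 0" using e(2)[of z] z h 0 by simp
    then have "f h < f 0" using z h by (simp add: mult_pos_neg algebra_simps)
    with min[of h] h show False by simp
  qed
qed

lemma hessian_at_min:
  assumes U: "open U" "p \<in> U" and H: "has_hessian U u ux uy uxx uxy uyy"
    and min: "\<And>q. q \<in> U \<Longrightarrow> u p \<le> u q"
  shows "ux p = 0" "uy p = 0" "uxx p * a\<^sup>2 + 2 * uxy p * a * b + uyy p * b\<^sup>2 \<ge> 0"
proof -
  have main: "ux p * a + uy p * b = 0 \<and> uxx p * a\<^sup>2 + 2 * uxy p * a * b + uyy p * b\<^sup>2 \<ge> 0" for a b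
  proof -
    obtain r where r: "r > 0" "ball p r \<subseteq> U" using U open_contains_ball by blast
    define n where "n = norm (a, b) + 1"
    have n: "n > 0" by (simp add: n_def add_nonneg_pos)
    have inU: "p + s *\<^sub>R (a, b) \<in> U" if "\<bar>s\<bar> < r / n" for s
    proof -
      have "norm (s *\<^sub>R (a, b)) \<le> \<bar>s\<bar> * n"
        unfolding norm_scaleR by (intro mult_left_mono) (auto simp: n_def)
      also have "\<dots> < r" using that n by (simp add: field_simps)
      finally have "norm (s *\<^sub>R (a, b)) < r" .
      moreover have "dist p (p + s *\<^sub>R (a, b)) = norm (s *\<^sub>R (a, b))"
        by (metis add_diff_cancel_left' dist_commute dist_norm)
      ultimately have "p + s *\<^sub>R (a, b) \<in> ball p r" unfolding mem_ball by (simp only:)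
      then show ?thesis using r by auto
    qed
    let ?q = "\<lambda>s. p + s *\<^sub>R (a, b)"
    have rn: "r / n > 0" using r n by simp
    have H': "has_partials U u ux uy" "has_partials U ux uxx uxy" "has_partials U uy uxy uyy"
      using H by (auto simp: has_hessian_def)
    have d1: "((\<lambda>s. u (?q s)) has_real_derivative (ux (?q s) * a + uy (?q s) * b)) (at s)" if "\<bar>s\<bar> < r / n" for s
      using has_partials_line[OF H'(1) inU[OF that]] by simp
    have p0: "p + 0 *\<^sub>R (a, b) \<in> U" using U by (simp flip: zero_prod_def)
    have d2: "((\<lambda>s. ux (?q s) * a + uy (?q s) * b) has_real_derivative
       uxx p * a\<^sup>2 + 2 * uxy p * a * b + uyy p * b\<^sup>2) (at 0)"
      using DERIV_add[OF DERIV_cmult_right[OF has_partials_line[OF H'(2) p0, where X=UNIV], of a]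
          DERIV_cmult_right[OF has_partials_line[OF H'(3) p0, where X=UNIV], of b]]
      by (simp add: algebra_simps power2_eq_square flip: zero_prod_def)
    from second_derivative_at_min[OF rn d1 d2] min inU
    show ?thesis by (simp flip: zero_prod_def)
  qed
  show "ux p = 0" using main[of 1 0] by simp
  show "uy p = 0" using main[of 0 1] by simp
  show "uxx p * a\<^sup>2 + 2 * uxy p * a * b + uyy p * b\<^sup>2 \<ge> 0" using main by blast
qed

text \<open>The trace of the product of two positive semidefinite matrices is nonnegative: split the first one
into a multiple of \<open>(a, b) (a, b)\<^sup>T\<close> and a nonnegative diagonal remainder.\<close>

lemma trace_product_nonneg:
  fixes a b c h k l :: real
  assumes A: "\<And>s t. a * s\<^sup>2 + 2 * b * s * t + c * t\<^sup>2 \<ge> 0" and a: "a > 0"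
    and H: "\<And>s t. h * s\<^sup>2 + 2 * k * s * t + l * t\<^sup>2 \<ge> 0"
  shows "a * h + 2 * b * k + c * l \<ge> 0"
proof -
  have l: "l \<ge> 0" using H[of 0 1] by simp
  have "a * (a * c - b\<^sup>2) \<ge> 0" using A[of "-b" a] by (simp add: algebra_simps power2_eq_square)
  then have det: "a * c - b\<^sup>2 \<ge> 0" using a by (simp add: zero_le_mult_iff)
  have "a * (a * h + 2 * b * k + c * l) = (h * a\<^sup>2 + 2 * k * a * b + l * b\<^sup>2) + (a * c - b\<^sup>2) * l"
    by (simp add: algebra_simps power2_eq_square)
  also have "\<dots> \<ge> 0" using H[of a b] l det by simp
  finally show ?thesis using a by (simp add: zero_le_mult_iff)
qed

text \<open>The upper bound 1 on the eigenvalues is a normalisation. The coefficients depend on the flow, whose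
velocity may be discontinuous at the corners, so all estimates use the two bounds alone.\<close>

locale elliptic_operator =
  fixes \<Omega> :: "(real \<times> real) set" and lam :: real and a b c :: "real \<times> real \<Rightarrow> real"
  assumes open_domain: "open \<Omega>" and lam_pos: "0 < lam"
    and lower: "\<And>p s t. p \<in> \<Omega> \<Longrightarrow> lam * (s\<^sup>2 + t\<^sup>2) \<le> a p * s\<^sup>2 + 2 * b p * s * t + c p * t\<^sup>2"
    and upper: "\<And>p s t. p \<in> \<Omega> \<Longrightarrow> a p * s\<^sup>2 + 2 * b p * s * t + c p * t\<^sup>2 \<le> s\<^sup>2 + t\<^sup>2"
begin

lemma diagonal_bounds:
  assumes "p \<in> \<Omega>"
  shows "lam \<le> a p" "a p \<le> 1" "lam \<le> c p" "c p \<le> 1"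
  using lower[OF assms, of 1 0] lower[OF assms, of 0 1] upper[OF assms, of 1 0] upper[OF assms, of 0 1]
  by auto

lemma quadratic_form_nonneg:
  assumes "p \<in> \<Omega>" shows "0 \<le> a p * s\<^sup>2 + 2 * b p * s * t + c p * t\<^sup>2"
proof -
  have "0 \<le> lam * (s\<^sup>2 + t\<^sup>2)" using lam_pos by simp
  also note lower[OF assms]
  finally show ?thesis .
qed

lemma strict_minimum_principle:
  assumes S: "compact S" "interior S \<subseteq> \<Omega>" and u: "continuous_on S u"
    and H: "has_hessian (interior S) u ux uy uxx uxy uyy"
    and L: "\<And>p. p \<in> interior S \<Longrightarrow> a p * uxx p + 2 * b p * uxy p + c p * uyy p < 0"
    and bd: "\<And>p. p \<in> frontier S \<Longrightarrow> 0 \<le> u p" and q: "q \<in> S"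
  shows "0 \<le> u q"
proof -
  obtain p where p: "p \<in> S" "\<And>x. x \<in> S \<Longrightarrow> u p \<le> u x"
    using continuous_attains_inf[OF S(1) _ u] q by blast
  have "0 \<le> u p"
  proof (cases "p \<in> interior S")
    case True
    then have min: "u p \<le> u x" if "x \<in> interior S" for x using p(2) that interior_subset by blast
    have pU: "p \<in> \<Omega>" using True S by auto
    have "a p * uxx p + 2 * b p * uxy p + c p * uyy p \<ge> 0"
    proof (rule trace_product_nonneg)
      show "0 < a p" using diagonal_bounds(1)[OF pU] lam_pos by linarith
      show "0 \<le> a p * s\<^sup>2 + 2 * b p * s * t + c p * t\<^sup>2" for s t by (rule quadratic_form_nonneg[OF pU])
      show "0 \<le> uxx p * s\<^sup>2 + 2 * uxy p * s * t + uyy p * t\<^sup>2" for s t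
        by (rule hessian_at_min(3)[OF open_interior True H min])
    qed
    with L[OF True] show ?thesis by simp
  next
    case False
    then have "p \<in> frontier S" using p(1) closure_subset by (auto simp: frontier_def)
    then show ?thesis by (rule bd)
  qed
  with p(2)[OF q] show ?thesis by linarith
qed

text \<open>Adding a small multiple of the supersolution \<open>R\<^sup>2 - |x|\<^sup>2\<close> makes the inequality strict.\<close>

lemma minimum_principle:
  assumes S: "compact S" "interior S \<subseteq> \<Omega>" and u: "continuous_on S u"
    and H: "has_hessian (interior S) u ux uy uxx uxy uyy"
    and L: "\<And>p. p \<in> interior S \<Longrightarrow> a p * uxx p + 2 * b p * uxy p + c p * uyy p \<le> 0"
    and bd: "\<And>p. p \<in> frontier S \<Longrightarrow> 0 \<le> u p" and q: "q \<in> S"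
  shows "0 \<le> u q"
proof -
  obtain R where R: "R > 0" "\<And>x. x \<in> S \<Longrightarrow> norm x \<le> R"
    using compact_imp_bounded[OF S(1)] bounded_pos by blast
  have R2: "(fst x)\<^sup>2 + (snd x)\<^sup>2 \<le> R\<^sup>2" if "x \<in> S" for x
    using power_mono[OF R(2)[OF that], of 2] by (simp add: norm_sq_coords)
  have "0 \<le> u q + e" if e: "e > 0" for e
  proof -
    define k where "k = e / R\<^sup>2"
    have k: "k > 0" using e R by (simp add: k_def)
    define g :: "real \<times> real \<Rightarrow> real" where "g = (\<lambda>p. - k * (fst p * fst p + snd p * snd p) + k * R\<^sup>2)"
    have Hg: "has_hessian X g (\<lambda>p. - 2 * k * fst p) (\<lambda>p. - 2 * k * snd p) (\<lambda>p. - 2 * k) (\<lambda>p. 0) (\<lambda>p. - 2 * k)" for X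
      unfolding has_hessian_def g_def
      by (intro conjI; rule has_partials_rhs[OF has_partials_add[OF has_partials_cmult[OF has_partials_add[OF
             has_partials_mult[OF has_partials_fst has_partials_fst] has_partials_mult[OF has_partials_snd has_partials_snd]]] has_partials_const]]
           has_partials_rhs[OF has_partials_cmult[OF has_partials_fst]] has_partials_rhs[OF has_partials_cmult[OF has_partials_snd]]; simp)
    have gpos: "0 \<le> g x" if "x \<in> S" for x
      using mult_left_mono[OF R2[OF that], of k] k by (simp add: g_def power2_eq_square)
    have "0 \<le> u q + g q"
    proof (rule strict_minimum_principle[OF S _ has_hessian_add[OF H Hg] _ _ q])
      show "continuous_on S (\<lambda>p. u p + g p)"
        by (intro continuous_intros u) (auto simp: g_def intro!: continuous_intros)
      show "0 \<le> u p + g p" if "p \<in> frontier S" for p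
      proof -
        have "p \<in> S" using that S(1) compact_imp_closed frontier_subset_closed by blast
        then show ?thesis using bd[OF that] gpos[of p] by linarith
      qed
      fix p assume p: "p \<in> interior S"
      then have "lam \<le> a p" "lam \<le> c p" using diagonal_bounds S by blast+
      then have "0 < a p + c p" using lam_pos by linarith
      then have "0 < k * (a p + c p)" using k by simp
      then show "a p * (uxx p + - 2 * k) + 2 * b p * (uxy p + 0) + c p * (uyy p + - 2 * k) < 0"
        using L[OF p] by (simp add: algebra_simps)
    qed
    moreover have "g q \<le> e"
    proof -
      have "0 \<le> k * (fst q * fst q + snd q * snd q)" using k by simp
      then show ?thesis using R by (simp add: g_def k_def)
    qed
    ultimately show ?thesis by linarith
  qed
  then show ?thesis by (rule field_le_epsilon)
qed

text \<open>The sublevel set \<open>u \<le> - e\<close> is compact, because it stays away from the boundary and from infinity,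
and \<open>u = - e\<close> on its frontier.\<close>

lemma exterior_minimum_principle:
  assumes H: "has_hessian \<Omega> u ux uy uxx uxy uyy"
    and L: "\<And>p. p \<in> \<Omega> \<Longrightarrow> a p * uxx p + 2 * b p * uxy p + c p * uyy p = 0"
    and bd: "\<And>q e. q \<in> frontier \<Omega> \<Longrightarrow> e > 0 \<Longrightarrow> eventually (\<lambda>p. - e < u p) (at q within \<Omega>)"
    and inf: "\<And>e. e > 0 \<Longrightarrow> \<exists>R. \<forall>p\<in>\<Omega>. norm p > R \<longrightarrow> - e < u p"
    and q: "q \<in> \<Omega>"
  shows "0 \<le> u q"
proof -
  have cont: "continuous_on \<Omega> u" using H by (rule has_hessian_continuous_on)
  have "0 \<le> u q + e" if e: "e > 0" for e
  proof (rule ccontr)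
    assume neg: "\<not> 0 \<le> u q + e"
    define S where "S = {p \<in> \<Omega>. u p \<le> - e}"
    obtain R where R: "\<And>p. p \<in> \<Omega> \<Longrightarrow> norm p > R \<Longrightarrow> - e < u p" using inf[OF e] by blast
    have "bounded S"
      unfolding bounded_iff by (rule exI[of _ R]) (use R in \<open>force simp: S_def\<close>)
    moreover have "closed S"
      unfolding closed_sequential_limits
    proof (intro allI impI, elim conjE)
      fix x l assume x: "\<forall>n. x n \<in> S" and l: "x \<longlonglongrightarrow> l"
      show "l \<in> S"
      proof (cases "l \<in> \<Omega>")
        case True
        have "isCont u l" using cont True open_domain continuous_on_eq_continuous_at by blast
        then have "(\<lambda>n. u (x n)) \<longlonglongrightarrow> u l" using l by (rule isCont_tendsto_compose)
        then have "u l \<le> - e" by (rule LIMSEQ_le_const2) (use x in \<open>auto simp: S_def\<close>)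
        with True show ?thesis by (simp add: S_def)
      next
        case False
        have "l \<in> closure \<Omega>" unfolding closure_sequential
          by (rule exI[of _ x]) (use x l in \<open>simp add: S_def\<close>)
        then have "l \<in> frontier \<Omega>" using False open_domain by (simp add: frontier_def interior_open)
        then have ev: "eventually (\<lambda>p. - e < u p) (at l within \<Omega>)" using bd e by blast
        have "filterlim x (at l within \<Omega>) sequentially"
          unfolding filterlim_at
        proof
          have "x n \<in> \<Omega> \<and> x n \<noteq> l" for n using x False by (auto simp: S_def)
          then show "eventually (\<lambda>n. x n \<in> \<Omega> \<and> x n \<noteq> l) sequentially" by simp
        qed (rule l)
        then have "eventually (\<lambda>n. - e < u (x n)) sequentially" using ev
          unfolding filterlim_iff by blast
        moreover have "\<not> - e < u (x n)" for n using x by (auto simp: S_def not_less)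
        ultimately show ?thesis by simp
      qed
    qed
    ultimately have cS: "compact S" by (simp add: compact_eq_bounded_closed)
    have SU: "S \<subseteq> \<Omega>" by (auto simp: S_def)
    have iS: "interior S \<subseteq> \<Omega>" using SU interior_subset by blast
    have "0 \<le> u q + e"
    proof (rule minimum_principle[OF cS iS])
      show "continuous_on S (\<lambda>p. u p + e)" using continuous_on_subset[OF cont SU] by (intro continuous_intros)
      show "has_hessian (interior S) (\<lambda>p. u p + e) ux uy uxx uxy uyy"
        using has_hessian_add[OF has_hessian_subset[OF H iS] has_hessian_affine[of _ 0 0 e]] by simp
      show "a p * uxx p + 2 * b p * uxy p + c p * uyy p \<le> 0" if "p \<in> interior S" for p
        using L[of p] that iS by auto
      show "0 \<le> u p + e" if "p \<in> frontier S" for p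
      proof (rule ccontr)
        assume *: "\<not> 0 \<le> u p + e"
        have pS: "p \<in> S" using that cS compact_imp_closed frontier_subset_closed by blast
        have "open {x \<in> \<Omega>. u x < - e}"
        proof -
          have "{x \<in> \<Omega>. u x < - e} = \<Omega> \<inter> u -` {..<- e}" by auto
          then show ?thesis using continuous_open_preimage[OF cont open_domain, of "{..<-e}"] by simp
        qed
        moreover have "{x \<in> \<Omega>. u x < - e} \<subseteq> S" by (auto simp: S_def)
        moreover have "p \<in> {x \<in> \<Omega>. u x < - e}" using * pS by (auto simp: S_def)
        ultimately have "p \<in> interior S" by (meson interiorI)
        with that show False by (simp add: frontier_def)
      qed
      show "q \<in> S" using neg q by (simp add: S_def)
    qed
    with neg show False by simp
  qed
  then show ?thesis by (rule field_le_epsilon)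
qed

end

text \<open>The radial function \<open>g\<close> centred at \<open>y\<close> is Hopf's barrier.\<close>

lemma has_hessian_gauss:
  fixes \<alpha> k :: real and y :: "real \<times> real"
  defines "g \<equiv> \<lambda>p. exp (- \<alpha> * ((fst p - fst y)\<^sup>2 + (snd p - snd y)\<^sup>2))"
  shows "has_hessian U (\<lambda>p. g p - k) (\<lambda>p. - 2 * \<alpha> * (fst p - fst y) * g p) (\<lambda>p. - 2 * \<alpha> * (snd p - snd y) * g p)
    (\<lambda>p. (4 * \<alpha>\<^sup>2 * (fst p - fst y)\<^sup>2 - 2 * \<alpha>) * g p)
    (\<lambda>p. 4 * \<alpha>\<^sup>2 * (fst p - fst y) * (snd p - snd y) * g p)
    (\<lambda>p. (4 * \<alpha>\<^sup>2 * (snd p - snd y)\<^sup>2 - 2 * \<alpha>) * g p)"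
proof -
  have 1: "has_partials U (\<lambda>p. fst p - fst y) (\<lambda>p. 1) (\<lambda>p. 0)"
    by (rule has_partials_rhs[OF has_partials_diff[OF has_partials_fst has_partials_const]]) auto
  have 2: "has_partials U (\<lambda>p. snd p - snd y) (\<lambda>p. 0) (\<lambda>p. 1)"
    by (rule has_partials_rhs[OF has_partials_diff[OF has_partials_snd has_partials_const]]) auto
  have s: "has_partials U (\<lambda>p. - \<alpha> * ((fst p - fst y)\<^sup>2 + (snd p - snd y)\<^sup>2))
    (\<lambda>p. - 2 * \<alpha> * (fst p - fst y)) (\<lambda>p. - 2 * \<alpha> * (snd p - snd y))"
    unfolding power2_eq_square
    by (rule has_partials_rhs[OF has_partials_cmult[OF has_partials_add[OF has_partials_mult[OF 1 1] has_partials_mult[OF 2 2]]]]) auto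
  have g: "has_partials U g (\<lambda>p. - 2 * \<alpha> * (fst p - fst y) * g p) (\<lambda>p. - 2 * \<alpha> * (snd p - snd y) * g p)"
    unfolding g_def
    by (rule has_partials_rhs[OF has_partials_chain[OF s DERIV_exp]]) (auto simp: mult_ac)
  have "has_partials U (\<lambda>p. - 2 * \<alpha> * (fst p - fst y) * g p)
    (\<lambda>p. (4 * \<alpha>\<^sup>2 * (fst p - fst y)\<^sup>2 - 2 * \<alpha>) * g p) (\<lambda>p. 4 * \<alpha>\<^sup>2 * (fst p - fst y) * (snd p - snd y) * g p)"
    by (rule has_partials_rhs[OF has_partials_mult[OF has_partials_cmult[OF 1] g]]) (auto simp: algebra_simps power2_eq_square)
  moreover have "has_partials U (\<lambda>p. - 2 * \<alpha> * (snd p - snd y) * g p)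
    (\<lambda>p. 4 * \<alpha>\<^sup>2 * (fst p - fst y) * (snd p - snd y) * g p) (\<lambda>p. (4 * \<alpha>\<^sup>2 * (snd p - snd y)\<^sup>2 - 2 * \<alpha>) * g p)"
    by (rule has_partials_rhs[OF has_partials_mult[OF has_partials_cmult[OF 2] g]]) (auto simp: algebra_simps power2_eq_square)
  moreover have "has_partials U (\<lambda>p. g p - k) (\<lambda>p. - 2 * \<alpha> * (fst p - fst y) * g p) (\<lambda>p. - 2 * \<alpha> * (snd p - snd y) * g p)"
    by (rule has_partials_rhs[OF has_partials_diff[OF g has_partials_const]]) auto
  ultimately show ?thesis by (simp add: has_hessian_def)
qed

context elliptic_operator
begin

text \<open>Hopf's boundary point argument: on an annulus inside the ball a multiple of the barrier lies below
\<open>u\<close>, so \<open>u\<close> would have a nonzero slope at its interior minimum \<open>z\<close>. The rate \<open>\<alpha>\<close> is chosen so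
that the barrier is a subsolution where \<open>|x - y| \<ge> d/2\<close>.\<close>

lemma hopf:
  assumes H: "has_hessian \<Omega> u ux uy uxx uxy uyy"
    and L: "\<And>p. p \<in> \<Omega> \<Longrightarrow> a p * uxx p + 2 * b p * uxy p + c p * uyy p = 0"
    and pos: "\<And>p. p \<in> ball y d \<Longrightarrow> 0 < u p" and d: "d > 0" and sub: "cball y d \<subseteq> \<Omega>"
    and nonneg: "\<And>p. p \<in> \<Omega> \<Longrightarrow> 0 \<le> u p"
    and z: "dist y z = d" and uz: "u z = 0"
  shows False
proof -
  have zU: "z \<in> \<Omega>" using sub z by auto
  define \<alpha> where "\<alpha> = 8 / (lam * d\<^sup>2)"
  have \<alpha>: "\<alpha> > 0" "\<alpha> * lam * d\<^sup>2 = 8" using d lam_pos by (auto simp: \<alpha>_def)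
  define g where "g = (\<lambda>p. exp (- \<alpha> * ((fst p - fst y)\<^sup>2 + (snd p - snd y)\<^sup>2)))"
  have gd: "g p = exp (- \<alpha> * (dist y p)\<^sup>2)" for p
    using norm_sq_coords[of "p - y"] by (simp add: g_def dist_norm norm_minus_commute)
  define G where "G = (\<lambda>p. g p - exp (- \<alpha> * d\<^sup>2))"
  have HG: "has_hessian X G (\<lambda>p. - 2 * \<alpha> * (fst p - fst y) * g p) (\<lambda>p. - 2 * \<alpha> * (snd p - snd y) * g p)
    (\<lambda>p. (4 * \<alpha>\<^sup>2 * (fst p - fst y)\<^sup>2 - 2 * \<alpha>) * g p)
    (\<lambda>p. 4 * \<alpha>\<^sup>2 * (fst p - fst y) * (snd p - snd y) * g p)
    (\<lambda>p. (4 * \<alpha>\<^sup>2 * (snd p - snd y)\<^sup>2 - 2 * \<alpha>) * g p)" for X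
    unfolding G_def g_def by (rule has_hessian_gauss)
  have uc: "continuous_on \<Omega> u" using H by (rule has_hessian_continuous_on)
  define S where "S = cball y d - ball y (d/2)"
  have cS: "compact S" unfolding S_def by (intro compact_diff) auto
  have SU: "S \<subseteq> \<Omega>" using sub by (auto simp: S_def)
  have iS: "interior S \<subseteq> \<Omega>" using SU interior_subset by blast
  have csph: "compact (sphere y (d/2))" "sphere y (d/2) \<noteq> {}" using d by (auto intro: compact_sphere)
  have "continuous_on (sphere y (d/2)) u" using uc by (rule continuous_on_subset) (use sub d in auto)
  from continuous_attains_inf[OF csph this]
  obtain x0 where x0: "x0 \<in> sphere y (d/2)" "\<And>x. x \<in> sphere y (d/2) \<Longrightarrow> u x0 \<le> u x" by blast
  define k where "k = u x0"
  have k: "k > 0" using pos[of x0] x0(1) d by (auto simp: k_def)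
  have frS: "dist y p = d \<or> dist y p = d/2" if "p \<in> frontier S" for p
  proof (rule ccontr)
    assume ne: "\<not> ?thesis"
    have pS: "p \<in> S" using that cS compact_imp_closed frontier_subset_closed by blast
    then have "p \<in> ball y d - cball y (d/2)" using ne by (auto simp: S_def)
    moreover have "open (ball y d - cball y (d/2))" by (intro open_Diff) auto
    moreover have "ball y d - cball y (d/2) \<subseteq> S" by (auto simp: S_def)
    ultimately have "p \<in> interior S" by (meson interiorI)
    with that show False by (simp add: frontier_def)
  qed
  have bar: "0 \<le> u q + (- k) * G q" if q: "q \<in> S" for q
  proof (rule strict_minimum_principle[OF cS iS _ has_hessian_add[OF has_hessian_subset[OF H iS] has_hessian_cmult[OF HG]] _ _ q])
    show "continuous_on S (\<lambda>p. u p + - k * G p)"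
      by (intro continuous_intros continuous_on_subset[OF uc SU] has_hessian_continuous_on[OF HG])
    show "0 \<le> u p + - k * G p" if "p \<in> frontier S" for p
    proof -
      from frS[OF that] show ?thesis
      proof
        assume *: "dist y p = d"
        then have "p \<in> \<Omega>" using sub by auto
        with * nonneg show ?thesis by (simp add: G_def gd)
      next
        assume *: "dist y p = d/2"
        then have "k \<le> u p" using x0(2)[of p] by (simp add: k_def)
        moreover have "G p \<le> 1" using \<alpha> by (simp add: G_def gd) (smt (verit) exp_ge_zero exp_le_one_iff mult_nonneg_nonneg zero_le_power2 divide_nonneg_pos)
        moreover have "k * G p \<le> k * 1" using k \<open>G p \<le> 1\<close> by (intro mult_left_mono) auto
        ultimately show ?thesis by simp
      qed
    qed
    fix p assume p: "p \<in> interior S"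
    then have pU: "p \<in> \<Omega>" and pS: "p \<in> S" using iS interior_subset by auto
    let ?s = "fst p - fst y" and ?t = "snd p - snd y"
    have "d/2 \<le> dist y p" using pS by (auto simp: S_def)
    then have "(d/2)\<^sup>2 \<le> (dist y p)\<^sup>2" using d by (intro power_mono) auto
    also have "(dist y p)\<^sup>2 = ?s\<^sup>2 + ?t\<^sup>2"
      using norm_sq_coords[of "p - y"] by (simp add: dist_norm norm_minus_commute)
    finally have "\<alpha> * lam * (d/2)\<^sup>2 \<le> \<alpha> * lam * (?s\<^sup>2 + ?t\<^sup>2)" using \<alpha> lam_pos by (intro mult_left_mono) auto
    also have "\<dots> \<le> \<alpha> * (a p * ?s\<^sup>2 + 2 * b p * ?s * ?t + c p * ?t\<^sup>2)"
      using lower[OF pU, of ?s ?t] \<alpha> by simp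
    finally have 2: "2 \<le> \<alpha> * (a p * ?s\<^sup>2 + 2 * b p * ?s * ?t + c p * ?t\<^sup>2)"
      using \<alpha> by (simp add: power_divide)
    have "a p \<le> 1" "c p \<le> 1" using diagonal_bounds[OF pU] by auto
    then have p1: "0 < \<alpha> * (4 * (\<alpha> * (a p * ?s\<^sup>2 + 2 * b p * ?s * ?t + c p * ?t\<^sup>2)) - 2 * (a p + c p))"
      using 2 \<alpha> by (intro mult_pos_pos) auto
    have "0 < g p" by (simp add: g_def)
    from mult_pos_pos[OF k mult_pos_pos[OF p1 this]] have "0 < k * (\<alpha> * (4 * (\<alpha> * (a p * ?s\<^sup>2 + 2 * b p * ?s * ?t + c p * ?t\<^sup>2)) - 2 * (a p + c p)) * g p)"
      .
    moreover have "a p * (uxx p + - k * ((4 * \<alpha>\<^sup>2 * ?s\<^sup>2 - 2 * \<alpha>) * g p)) +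
         2 * b p * (uxy p + - k * (4 * \<alpha>\<^sup>2 * ?s * ?t * g p)) +
         c p * (uyy p + - k * ((4 * \<alpha>\<^sup>2 * ?t\<^sup>2 - 2 * \<alpha>) * g p))
       = (a p * uxx p + 2 * b p * uxy p + c p * uyy p) - k * (\<alpha> * (4 * (\<alpha> * (a p * ?s\<^sup>2 + 2 * b p * ?s * ?t + c p * ?t\<^sup>2)) - 2 * (a p + c p)) * g p)"
      by (simp add: algebra_simps power2_eq_square)
    ultimately show "a p * (uxx p + - k * ((4 * \<alpha>\<^sup>2 * ?s\<^sup>2 - 2 * \<alpha>) * g p)) +
         2 * b p * (uxy p + - k * (4 * \<alpha>\<^sup>2 * ?s * ?t * g p)) +
         c p * (uyy p + - k * ((4 * \<alpha>\<^sup>2 * ?t\<^sup>2 - 2 * \<alpha>) * g p)) < 0"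
      using L[OF pU] by simp
  qed
  \<comment> \<open>an interior minimum has vanishing gradient, but the barrier grows linearly inward\<close>
  have ux: "ux z = 0" "uy z = 0"
    using hessian_at_min(1,2)[OF open_domain zU H] nonneg uz by auto
  define w where "w = y - z"
  have nw: "norm w = d" using z by (simp add: w_def dist_norm)
  have H': "has_partials UNIV G (\<lambda>p. - 2 * \<alpha> * (fst p - fst y) * g p) (\<lambda>p. - 2 * \<alpha> * (snd p - snd y) * g p)"
    using HG[of UNIV] by (simp add: has_hessian_def)
  have u': "has_partials \<Omega> u ux uy" using H by (simp add: has_hessian_def)
  have D1: "((\<lambda>s. u (z + s *\<^sub>R w)) has_real_derivative 0) (at 0)"
    using has_partials_line[OF u', of z 0 w UNIV] zU ux by simp
  have sq: "(fst w)\<^sup>2 + (snd w)\<^sup>2 = d\<^sup>2" using norm_sq_coords[of w] nw by simp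
  have D2: "((\<lambda>s. G (z + s *\<^sub>R w)) has_real_derivative 2 * \<alpha> * d\<^sup>2 * g z) (at 0)"
    using has_partials_line[OF H', of z 0 w UNIV] unfolding sq[symmetric]
    by (simp add: w_def algebra_simps power2_eq_square)
  have D: "((\<lambda>s. u (z + s *\<^sub>R w) - k * G (z + s *\<^sub>R w)) has_real_derivative 0 - k * (2 * \<alpha> * d\<^sup>2 * g z)) (at 0)"
    by (intro DERIV_diff DERIV_cmult D1 D2)
  have "0 - k * (2 * \<alpha> * d\<^sup>2 * g z) < 0" using k \<alpha> d by (simp add: g_def)
  from DERIV_neg_dec_right[OF D this]
  obtain e where e: "e > 0" "\<And>h. 0 < h \<Longrightarrow> h < e \<Longrightarrow> u (z + h *\<^sub>R w) - k * G (z + h *\<^sub>R w) < u z - k * G z"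
    by auto
  define h where "h = min (e/2) (1/2)"
  have h: "0 < h" "h < e" "h \<le> 1/2" using e(1) by (auto simp: h_def)
  have "y - (z + h *\<^sub>R w) = (1 - h) *\<^sub>R w" by (simp add: w_def algebra_simps)
  then have "dist y (z + h *\<^sub>R w) = (1 - h) * d" using h nw by (simp add: dist_norm)
  moreover have "(1 - h) * d \<le> 1 * d" "1/2 * d \<le> (1 - h) * d" using h d by (auto intro!: mult_right_mono)
  ultimately have "z + h *\<^sub>R w \<in> S" by (simp add: S_def)
  from bar[OF this] e(2)[OF h(1,2)] show False using uz z by (simp add: G_def gd)
qed

text \<open>The zero set is closed in the domain. It is also open: near a zero, a ball around a point of
positivity that is enlarged until it touches the zero set would contradict Hopf's lemma.\<close>

lemma strong_minimum_principle:
  assumes H: "has_hessian \<Omega> u ux uy uxx uxy uyy" and con: "connected \<Omega>"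
    and L: "\<And>p. p \<in> \<Omega> \<Longrightarrow> a p * uxx p + 2 * b p * uxy p + c p * uyy p = 0"
    and nonneg: "\<And>p. p \<in> \<Omega> \<Longrightarrow> 0 \<le> u p"
    and p: "p \<in> \<Omega>" "0 < u p" and q: "q \<in> \<Omega>"
  shows "0 < u q"
proof (rule ccontr)
  assume "\<not> 0 < u q"
  then have q0: "u q = 0" using nonneg[OF q] by simp
  have uc: "continuous_on \<Omega> u" using H by (rule has_hessian_continuous_on)
  define Z where "Z = {x \<in> \<Omega>. u x = 0}"
  have clZ: "closedin (top_of_set \<Omega>) Z"
    unfolding Z_def by (rule continuous_closedin_preimage_constant[OF uc])
  have "openin (top_of_set \<Omega>) Z"
    unfolding openin_contains_ball
  proof (intro conjI ballI)
    show "Z \<subseteq> \<Omega>" by (auto simp: Z_def)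
    fix x assume x: "x \<in> Z"
    then obtain r where r: "r > 0" "ball x (2 * r) \<subseteq> \<Omega>"
      using open_domain open_contains_ball[of \<Omega>] unfolding Z_def
      by (metis (no_types, lifting) mem_Collect_eq mult.commute nonzero_mult_div_cancel_right times_divide_eq_left zero_less_divide_iff zero_less_numeral zero_neq_numeral)
    have "ball x (r/2) \<subseteq> Z"
    proof (rule ccontr)
      assume "\<not> ball x (r/2) \<subseteq> Z"
      then obtain y where "y \<in> ball x (r/2)" "y \<notin> Z" by blast
      then have y: "dist x y < r/2" "y \<notin> Z" by simp_all
      have yU: "y \<in> \<Omega>" using y r by auto
      define K where "K = Z \<inter> cball x r"
      have "cball x r \<subseteq> \<Omega>" using r by force
      then have K': "K = {z \<in> cball x r. u z = 0}" by (auto simp: K_def Z_def)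
      have "closed K" unfolding K'
        by (rule continuous_closed_preimage_constant)
           (use continuous_on_subset[OF uc \<open>cball x r \<subseteq> \<Omega>\<close>] in auto)
      moreover have xK: "x \<in> K" using x r by (simp add: K_def)
      ultimately obtain z where z: "z \<in> K" "\<And>w. w \<in> K \<Longrightarrow> dist y z \<le> dist y w"
        using distance_attains_inf[of K y] by blast
      have dyz: "dist y z < r/2" using z(2)[OF xK] y(1) by (simp add: dist_commute)
      have far: "w \<in> cball x r" if "dist y w \<le> dist y z" for w
        using that dyz y(1) dist_triangle[of x w y] by simp
      show False
      proof (rule hopf[OF H L _ _ _ nonneg refl])
        show "0 < u w" if "w \<in> ball y (dist y z)" for w
        proof -
          have "w \<in> cball x r" using far that by simp
          moreover have "w \<notin> K" using z(2)[of w] that by auto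
          ultimately show ?thesis using nonneg[of w] \<open>cball x r \<subseteq> \<Omega>\<close> K' by force
        qed
        show "0 < dist y z" using y(2) z(1) by (auto simp: K_def)
        show "cball y (dist y z) \<subseteq> \<Omega>" using far \<open>cball x r \<subseteq> \<Omega>\<close> by auto
        show "u z = 0" using z K' by simp
      qed auto
    qed
    then show "\<exists>e>0. ball x e \<inter> \<Omega> \<subseteq> Z" using r(1) by (intro exI[of _ "r/2"]) auto
  qed
  with clZ have "Z = {} \<or> Z = \<Omega>" using con by (simp add: connected_clopen)
  moreover have "q \<in> Z" "p \<notin> Z" using q q0 p by (auto simp: Z_def)
  ultimately show False using p by blast
qed

end

section \<open>Solutions at a protruding corner\<close>

text \<open>With \<open>e\<close> the direction of the bisector, a direction belongs to the sector iff its cosine with \<open>e\<close>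
exceeds the cosine of half the opening angle; this bound \<open>- \<kappa>\<close> is negative because the angle
exceeds \<open>\<pi>\<close>.\<close>

lemma protruding_corner_cone:
  assumes "protruding_corner B p"
  obtains e \<kappa> r where "(fst e)\<^sup>2 + (snd e)\<^sup>2 = 1" "0 < \<kappa>" "0 < r"
    "\<And>z. z \<noteq> 0 \<Longrightarrow> norm z < r \<Longrightarrow> - \<kappa> * norm z < fst e * fst z + snd e * snd z \<Longrightarrow> p + z \<in> - B"
proof -
  obtain \<epsilon> \<alpha> \<delta> where d: "0 < \<epsilon>" "pi < \<delta>" "\<delta> \<le> 2 * pi" and sub: "open_sector p \<epsilon> \<alpha> \<delta> \<subseteq> - B"
    using assms by (auto simp: protruding_corner_def)
  define \<omega> where "\<omega> = \<alpha> + \<delta> / 2"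
  define e where "e = (cos \<omega>, sin \<omega>)"
  define \<kappa> where "\<kappa> = - cos (\<delta> / 2)"
  have "cos (\<delta> / 2) < cos (pi / 2)" by (rule cos_monotone_0_pi) (use d in auto)
  then have \<kappa>: "0 < \<kappa>" by (simp add: \<kappa>_def)
  have "p + z \<in> - B" if z: "z \<noteq> 0" "norm z < \<epsilon>" "- \<kappa> * norm z < fst e * fst z + snd e * snd z" for z
  proof -
    define n where "n = norm z"
    have n: "n > 0" using z by (simp add: n_def)
    have nsq: "n\<^sup>2 = (fst z)\<^sup>2 + (snd z)\<^sup>2" by (simp add: n_def norm_sq_coords)
    define c s where "c = (cos \<omega> * fst z + sin \<omega> * snd z) / n" and "s = (cos \<omega> * snd z - sin \<omega> * fst z) / n"
    have nc: "n * c = cos \<omega> * fst z + sin \<omega> * snd z" and ns: "n * s = cos \<omega> * snd z - sin \<omega> * fst z"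
      using n by (simp_all add: c_def s_def)
    have "n\<^sup>2 * (c\<^sup>2 + s\<^sup>2) = (n * c)\<^sup>2 + (n * s)\<^sup>2" by (simp add: algebra_simps)
    also have "\<dots> = ((cos \<omega>)\<^sup>2 + (sin \<omega>)\<^sup>2) * ((fst z)\<^sup>2 + (snd z)\<^sup>2)"
      unfolding nc ns by algebra
    also have "\<dots> = n\<^sup>2" by (simp add: nsq)
    finally have cs: "c\<^sup>2 + s\<^sup>2 = 1" using n by simp
    obtain t where t: "\<bar>t\<bar> \<le> pi" "c = cos t" "s = sin t"
    proof (cases "s \<ge> 0")
      case True
      from sincos_total_pi[OF True cs] obtain t where "0 \<le> t" "t \<le> pi" "c = cos t" "s = sin t" by blast
      then show ?thesis by (intro that[of t]) auto
    next
      case False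
      from sincos_total_pi[of "-s" c] cs False obtain t where "0 \<le> t" "t \<le> pi" "c = cos t" "- s = sin t" by auto
      then show ?thesis by (intro that[of "-t"]) auto
    qed
    have "- \<kappa> < c" using z(3) n by (simp add: c_def e_def n_def[symmetric] field_simps)
    then have "cos (\<delta> / 2) < cos \<bar>t\<bar>" using t by (simp add: \<kappa>_def)
    then have "\<bar>t\<bar> < \<delta> / 2" using cos_monotone_0_pi_le[of "\<delta>/2" "\<bar>t\<bar>"] d t(1) by fastforce
    moreover have "z = n *\<^sub>R (cos (\<omega> + t), sin (\<omega> + t))"
    proof -
      have "n * cos (\<omega> + t) = cos \<omega> * (n * c) - sin \<omega> * (n * s)"
        "n * sin (\<omega> + t) = sin \<omega> * (n * c) + cos \<omega> * (n * s)"
        by (simp_all add: cos_add sin_add t algebra_simps)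
      then have "n * cos (\<omega> + t) = ((cos \<omega>)\<^sup>2 + (sin \<omega>)\<^sup>2) * fst z" "n * sin (\<omega> + t) = ((cos \<omega>)\<^sup>2 + (sin \<omega>)\<^sup>2) * snd z"
        unfolding nc ns by algebra+
      then show ?thesis by (simp add: prod_eq_iff)
    qed
    ultimately have "p + z \<in> open_sector p \<epsilon> \<alpha> \<delta>"
      unfolding open_sector_def mem_Collect_eq
      by - (rule exI[of _ n], rule exI[of _ "\<omega> + t"],
          use n z(2) in \<open>auto simp: n_def \<omega>_def abs_less_iff\<close>)
    with sub show ?thesis by auto
  qed
  moreover have "(fst e)\<^sup>2 + (snd e)\<^sup>2 = 1" by (simp add: e_def)
  ultimately show ?thesis using that \<kappa> d(1) by blast
qed

lemma has_hessian_mult: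
  assumes u: "has_hessian U u ux uy uxx uxy uyy" and v: "has_hessian U v vx vy vxx vxy vyy"
  shows "has_hessian U (\<lambda>p. u p * v p) (\<lambda>p. ux p * v p + u p * vx p) (\<lambda>p. uy p * v p + u p * vy p)
    (\<lambda>p. uxx p * v p + 2 * ux p * vx p + u p * vxx p)
    (\<lambda>p. uxy p * v p + ux p * vy p + uy p * vx p + u p * vxy p)
    (\<lambda>p. uyy p * v p + 2 * uy p * vy p + u p * vyy p)"
proof -
  note U = u[unfolded has_hessian_def] v[unfolded has_hessian_def]
  show ?thesis
    unfolding has_hessian_def
    by (intro conjI;
        rule has_partials_rhs[OF has_partials_add[OF has_partials_mult has_partials_mult]] has_partials_mult;
        (rule U[THEN conjunct1] U[THEN conjunct2, THEN conjunct1] U[THEN conjunct2, THEN conjunct2])?; simp)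
qed

lemma has_hessian_norm_powr:
  fixes q :: real and y :: "real \<times> real"
  defines "s \<equiv> \<lambda>p. (fst p - fst y)\<^sup>2 + (snd p - snd y)\<^sup>2"
  assumes U: "y \<notin> U"
  shows "has_hessian U (\<lambda>p. s p powr q) (\<lambda>p. 2 * q * (fst p - fst y) * s p powr (q - 1))
    (\<lambda>p. 2 * q * (snd p - snd y) * s p powr (q - 1))
    (\<lambda>p. 2 * q * s p powr (q - 1) + 4 * q * (q - 1) * (fst p - fst y)\<^sup>2 * s p powr (q - 2))
    (\<lambda>p. 4 * q * (q - 1) * (fst p - fst y) * (snd p - snd y) * s p powr (q - 2))
    (\<lambda>p. 2 * q * s p powr (q - 1) + 4 * q * (q - 1) * (snd p - snd y)\<^sup>2 * s p powr (q - 2))"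
proof -
  have 1: "has_partials U (\<lambda>p. fst p - fst y) (\<lambda>p. 1) (\<lambda>p. 0)"
    by (rule has_partials_rhs[OF has_partials_diff[OF has_partials_fst has_partials_const]]) auto
  have 2: "has_partials U (\<lambda>p. snd p - snd y) (\<lambda>p. 0) (\<lambda>p. 1)"
    by (rule has_partials_rhs[OF has_partials_diff[OF has_partials_snd has_partials_const]]) auto
  have s: "has_partials U s (\<lambda>p. 2 * (fst p - fst y)) (\<lambda>p. 2 * (snd p - snd y))"
    unfolding power2_eq_square s_def
    by (rule has_partials_rhs[OF has_partials_add[OF has_partials_mult[OF 1 1] has_partials_mult[OF 2 2]]]) auto
  have pos: "s p > 0" if "p \<in> U" for p
  proof -
    have "p - y \<noteq> 0" using that U by auto
    then have "(norm (p - y))\<^sup>2 > 0" by simp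
    then show ?thesis by (simp only: norm_sq_coords s_def fst_diff snd_diff)
  qed
  have g: "has_partials U (\<lambda>p. s p powr r) (\<lambda>p. 2 * r * (fst p - fst y) * s p powr (r - 1))
    (\<lambda>p. 2 * r * (snd p - snd y) * s p powr (r - 1))" for r
    by (rule has_partials_rhs[OF has_partials_chain[OF s has_real_derivative_powr[OF pos]]]) auto
  show ?thesis
    unfolding has_hessian_def
    by (intro conjI g;
       rule has_partials_rhs[OF has_partials_mult[OF has_partials_cmult[OF 1] g]]
         has_partials_rhs[OF has_partials_mult[OF has_partials_cmult[OF 2] g]];
       simp add: algebra_simps power2_eq_square)
qed

context elliptic_operator
begin

text \<open>With \<open>z = p - y\<close>, \<open>r = |z|\<close> and \<open>X = e \<bullet> z\<close> this is \<open>r\<close> to the power \<open>- \<epsilon>\<close> times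
\<open>X + \<epsilon> (24 / lam) r\<close>: a perturbation of the linear function \<open>X\<close>, which is annihilated by every
elliptic operator and positive on a half plane. For small \<open>\<epsilon>\<close> the barrier is positive only in a
sector slightly wider than the half plane, it is not Lipschitz at the corner, and to first order in
\<open>\<epsilon>\<close> its angular profile \<open>cos \<theta> + 24 \<epsilon> / lam\<close> makes it a subsolution. The linear function is
written with a constant term so that it has the form of an affine function of \<open>p\<close>.\<close>

definition corner_barrier :: "real \<times> real \<Rightarrow> real \<times> real \<Rightarrow> real \<Rightarrow> real \<times> real \<Rightarrow> real" where
  "corner_barrier y e \<epsilon> p =
     ((fst p - fst y)\<^sup>2 + (snd p - snd y)\<^sup>2) powr (- \<epsilon> / 2) * (fst e * fst p + snd e * snd p + - (fst e * fst y + snd e * snd y)) +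
     \<epsilon> * (24 / lam) * ((fst p - fst y)\<^sup>2 + (snd p - snd y)\<^sup>2) powr ((1 - \<epsilon>) / 2)"

lemma corner_barrier_eq:
  assumes "z \<noteq> 0"
  shows "corner_barrier y e \<epsilon> (y + z)
     = norm z powr (- \<epsilon>) * (fst e * fst z + snd e * snd z + \<epsilon> * (24 / lam) * norm z)"
proof -
  have s: "(fst (y + z) - fst y)\<^sup>2 + (snd (y + z) - snd y)\<^sup>2 = norm z powr 2"
    using assms by (simp add: norm_sq_coords[symmetric] powr_numeral)
  have "norm z powr (1 - \<epsilon>) = norm z powr (- \<epsilon>) * norm z powr 1" unfolding powr_add[symmetric] by simp
  moreover have h: "2 * ((1 - \<epsilon>) / 2) = 1 - \<epsilon>" "2 * (- \<epsilon> / 2) = - \<epsilon>" by simp_all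
  ultimately show ?thesis
    unfolding corner_barrier_def s powr_powr h using assms by (simp add: algebra_simps)
qed

text \<open>Polarisation of the quadratic form, which lies between 0 and \<open>|x|\<^sup>2\<close>.\<close>

lemma polar_form_bound:
  assumes p: "p \<in> \<Omega>" and r: "0 < r" "s\<^sup>2 + t\<^sup>2 = r\<^sup>2" and e: "e\<^sup>2 + f\<^sup>2 = 1" and X: "\<bar>s * e + t * f\<bar> \<le> r"
  shows "\<bar>a p * s * e + b p * (s * f + t * e) + c p * t * f\<bar> \<le> r"
proof -
  let ?Y = "a p * s * e + b p * (s * f + t * e) + c p * t * f"
  let ?Q = "\<lambda>s t. a p * s\<^sup>2 + 2 * b p * s * t + c p * t\<^sup>2"
  have *: "4 * (r * ?Y) = ?Q (s + r * e) (t + r * f) - ?Q (s - r * e) (t - r * f)"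
    by (simp add: algebra_simps power2_eq_square)
  have n: "(s + r * e)\<^sup>2 + (t + r * f)\<^sup>2 = 2 * r\<^sup>2 + 2 * (r * (s * e + t * f))"
    "(s - r * e)\<^sup>2 + (t - r * f)\<^sup>2 = 2 * r\<^sup>2 - 2 * (r * (s * e + t * f))"
  proof -
    have "(s + r * e)\<^sup>2 + (t + r * f)\<^sup>2 = (s\<^sup>2 + t\<^sup>2) + r\<^sup>2 * (e\<^sup>2 + f\<^sup>2) + 2 * (r * (s * e + t * f))"
      "(s - r * e)\<^sup>2 + (t - r * f)\<^sup>2 = (s\<^sup>2 + t\<^sup>2) + r\<^sup>2 * (e\<^sup>2 + f\<^sup>2) - 2 * (r * (s * e + t * f))"
      by (simp_all add: algebra_simps power2_eq_square)
    then show "(s + r * e)\<^sup>2 + (t + r * f)\<^sup>2 = 2 * r\<^sup>2 + 2 * (r * (s * e + t * f))"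
    "(s - r * e)\<^sup>2 + (t - r * f)\<^sup>2 = 2 * r\<^sup>2 - 2 * (r * (s * e + t * f))" unfolding r(2) e by simp_all
  qed
  have X': "r * (s * e + t * f) \<le> r * r" "r * (- (s * e + t * f)) \<le> r * r"
    using X r(1) by (auto intro!: mult_left_mono simp: abs_le_iff)
  have "4 * (r * ?Y) \<le> 4 * r\<^sup>2"
    using * quadratic_form_nonneg[OF p, of "s - r * e" "t - r * f"] upper[OF p, of "s + r * e" "t + r * f"] n X'
    unfolding power2_eq_square by linarith
  moreover have "- (4 * (r * ?Y)) \<le> 4 * r\<^sup>2"
    using * quadratic_form_nonneg[OF p, of "s + r * e" "t + r * f"] upper[OF p, of "s - r * e" "t - r * f"] n X'
    unfolding power2_eq_square by linarith
  ultimately have "r * ?Y \<le> r * r" "r * (- ?Y) \<le> r * r"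
    unfolding mult_minus_right power2_eq_square by linarith+
  then have "?Y \<le> r" "- ?Y \<le> r" using r(1) mult_le_cancel_left_pos by blast+
  then show ?thesis by (simp only: abs_le_iff)
qed

text \<open>The operator applied to the barrier is a positive factor times this expression, in which the last
term dominates. It is positive because \<open>(a + c) - Z\<close> is the quadratic form at the unit vector
orthogonal to \<open>(s, t)\<close>, hence at least \<open>lam\<close>; the first two terms are at least \<open>- 5 r\<close>, and the
constant \<open>24 / lam\<close> makes the last one at least \<open>6 r\<close>.\<close>

lemma corner_barrier_bracket:
  assumes p: "p \<in> \<Omega>" and r: "0 < r" "s\<^sup>2 + t\<^sup>2 = r\<^sup>2" and e: "e\<^sup>2 + f\<^sup>2 = 1" and \<epsilon>: "0 < \<epsilon>" "\<epsilon> \<le> lam / 2"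
  defines "X \<equiv> e * s + f * t" and "Z \<equiv> (a p * s\<^sup>2 + 2 * b p * s * t + c p * t\<^sup>2) / r\<^sup>2"
    and "Y \<equiv> a p * s * e + b p * (s * f + t * e) + c p * t * f"
  shows "0 < X * (- (a p + c p) + (2 + \<epsilon>) * Z) - 2 * Y + (24 / lam) * r * (1 - \<epsilon>) * ((a p + c p) - (1 + \<epsilon>) * Z)"
proof -
  have lam1: "lam \<le> 1" "a p \<le> 1" "c p \<le> 1" "lam \<le> a p" "lam \<le> c p" using diagonal_bounds[OF p] by auto
  have Xr: "\<bar>X\<bar> \<le> r"
  proof -
    have "X\<^sup>2 + (e * t - f * s)\<^sup>2 = (e\<^sup>2 + f\<^sup>2) * (s\<^sup>2 + t\<^sup>2)" by (simp add: X_def algebra_simps power2_eq_square)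
    then have "X\<^sup>2 + (e * t - f * s)\<^sup>2 = r\<^sup>2" using r(2) e by simp
    moreover have "0 \<le> (e * t - f * s)\<^sup>2" by simp
    ultimately have "X\<^sup>2 \<le> r\<^sup>2" by linarith
    then show ?thesis using r(1) by (simp add: abs_le_square_iff[symmetric])
  qed
  have Yr: "\<bar>Y\<bar> \<le> r" unfolding Y_def
    by (rule polar_form_bound[OF p r e]) (use Xr in \<open>simp add: X_def mult.commute\<close>)
  have r2: "r\<^sup>2 > 0" using r(1) by simp
  have Z: "lam \<le> Z" "Z \<le> 1"
    using lower[OF p, of s t] upper[OF p, of s t] r2 unfolding Z_def r(2) by (simp_all add: field_simps)
  have "(a p * t\<^sup>2 + 2 * b p * t * (-s) + c p * (-s)\<^sup>2) = ((a p + c p) - Z) * r\<^sup>2"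
  proof -
    have "Z * r\<^sup>2 = a p * s\<^sup>2 + 2 * b p * s * t + c p * t\<^sup>2" using r2 by (simp add: Z_def)
    then show ?thesis unfolding left_diff_distrib unfolding r(2)[symmetric] by (simp add: algebra_simps)
  qed
  moreover have "t\<^sup>2 + (-s)\<^sup>2 = r\<^sup>2" using r(2) by simp
  ultimately have "lam * r\<^sup>2 \<le> ((a p + c p) - Z) * r\<^sup>2" using lower[OF p, of t "-s"] by simp
  then have TZ: "lam \<le> (a p + c p) - Z" using r2 by simp
  have "\<epsilon> * Z \<le> \<epsilon>" using Z \<epsilon> by simp
  then have "lam / 2 \<le> (a p + c p) - (1 + \<epsilon>) * Z" using TZ \<epsilon> unfolding distrib_right by linarith
  then have "(1/2) * (lam / 2) \<le> (1 - \<epsilon>) * ((a p + c p) - (1 + \<epsilon>) * Z)"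
    using \<epsilon> lam1 lam_pos by (intro mult_mono) auto
  then have "(24 / lam * r) * ((1/2) * (lam / 2)) \<le> (24 / lam * r) * ((1 - \<epsilon>) * ((a p + c p) - (1 + \<epsilon>) * Z))"
    using lam_pos r by (intro mult_left_mono) auto
  then have A: "6 * r \<le> (24 / lam) * r * (1 - \<epsilon>) * ((a p + c p) - (1 + \<epsilon>) * Z)" using lam_pos by (simp add: mult.assoc)
  have "\<bar>- (a p + c p) + (2 + \<epsilon>) * Z\<bar> \<le> 3"
  proof -
    define W where "W = (2 + \<epsilon>) * Z"
    have "W \<le> (2 + \<epsilon>) * 1" unfolding W_def using Z \<epsilon> by (intro mult_left_mono) auto
    then have "W \<le> 2 + \<epsilon>" by simp
    moreover have "0 \<le> W" unfolding W_def using Z \<epsilon> lam_pos by simp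
    ultimately show ?thesis unfolding W_def[symmetric] using lam1 \<epsilon> lam_pos by linarith
  qed
  with Xr have "\<bar>X\<bar> * \<bar>- (a p + c p) + (2 + \<epsilon>) * Z\<bar> \<le> r * 3" by (intro mult_mono) auto
  then have B: "\<bar>X * (- (a p + c p) + (2 + \<epsilon>) * Z)\<bar> \<le> 3 * r" by (simp add: abs_mult)
  show ?thesis using A B Yr r(1) by linarith
qed

lemma corner_barrier_subsolution:
  assumes e: "(fst e)\<^sup>2 + (snd e)\<^sup>2 = 1" and \<epsilon>: "0 < \<epsilon>" "\<epsilon> \<le> lam / 2" and U: "y \<notin> U"
  obtains ux uy uxx uxy uyy where
    "has_hessian U (corner_barrier y e \<epsilon>) ux uy uxx uxy uyy"
    "\<And>p. p \<in> U \<Longrightarrow> p \<in> \<Omega> \<Longrightarrow> 0 < a p * uxx p + 2 * b p * uxy p + c p * uyy p"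
proof -
  define s where "s = (\<lambda>p. (fst p - fst y)\<^sup>2 + (snd p - snd y)\<^sup>2)"
  define X where "X = (\<lambda>p. fst e * fst p + snd e * snd p + - (fst e * fst y + snd e * snd y))"
  define q where "q = - \<epsilon> / 2"
  define q' where "q' = (1 - \<epsilon>) / 2"
  note H = has_hessian_add[OF has_hessian_mult[OF has_hessian_norm_powr[OF U, of q]
      has_hessian_affine[of _ "fst e" "snd e" "- (fst e * fst y + snd e * snd y)"]]
     has_hessian_cmult[OF has_hessian_norm_powr[OF U, of q'], of "\<epsilon> * (24 / lam)"]]
  have eq: "corner_barrier y e \<epsilon> = (\<lambda>p. s p powr q * X p + \<epsilon> * (24 / lam) * s p powr q')"
    by (rule ext) (simp add: corner_barrier_def s_def X_def q_def q'_def)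
  show thesis
  proof (rule that, unfold eq s_def X_def, rule H, goal_cases)
    case (1 p)
    note p = 1
    let ?z = "fst p - fst y" and ?t = "snd p - snd y"
    define r where "r = norm (p - y)"
    have r: "r > 0" using p(1) U by (auto simp: r_def)
    have rs: "?z\<^sup>2 + ?t\<^sup>2 = r\<^sup>2" using norm_sq_coords[of "p - y"] by (simp add: r_def)
    define P where "P = (r\<^sup>2) powr q"
    have P: "P > 0" using r by (simp add: P_def)
    have e1: "(r\<^sup>2) powr (q - 1) = P / r\<^sup>2" "(r\<^sup>2) powr (q - 2) = P / (r\<^sup>2)\<^sup>2"
      using r by (simp_all add: P_def powr_diff powr_numeral)
    have "q' = q + 1/2" by (simp add: q_def q'_def field_simps)
    then have "(r\<^sup>2) powr q' = P * (r\<^sup>2) powr (1/2)" by (simp only: powr_add P_def)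
    also have "(r\<^sup>2) powr (1/2) = r" using r by (simp add: powr_half_sqrt)
    finally have e2: "(r\<^sup>2) powr q' = P * r" .
    then have e3: "(r\<^sup>2) powr (q' - 1) = P * r / r\<^sup>2" "(r\<^sup>2) powr (q' - 2) = P * r / (r\<^sup>2)\<^sup>2"
      using r by (simp_all add: powr_diff powr_numeral)
    have Xe: "fst e * fst p + snd e * snd p + - (fst e * fst y + snd e * snd y) = fst e * ?z + snd e * ?t"
      by (simp add: algebra_simps)
    let ?T = "a p + c p"
    define Z where "Z = (a p * ?z\<^sup>2 + 2 * b p * ?z * ?t + c p * ?t\<^sup>2) / r\<^sup>2"
    let ?Y = "a p * ?z * fst e + b p * (?z * snd e + ?t * fst e) + c p * ?t * snd e"
    let ?X = "fst e * ?z + snd e * ?t"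
    let ?K = "24 / lam"
    have br: "0 < ?X * (- ?T + (2 + \<epsilon>) * Z) - 2 * ?Y + ?K * r * (1 - \<epsilon>) * (?T - (1 + \<epsilon>) * Z)"
      unfolding Z_def by (rule corner_barrier_bracket[OF p(2) r rs e \<epsilon>])
    have Zr: "a p * ?z\<^sup>2 + 2 * b p * ?z * ?t + c p * ?t\<^sup>2 = Z * r\<^sup>2" using r by (simp add: Z_def)
    have "\<epsilon> * P / r\<^sup>2 * (?X * (- ?T + (2 + \<epsilon>) * Z) - 2 * ?Y + ?K * r * (1 - \<epsilon>) * (?T - (1 + \<epsilon>) * Z)) > 0"
      using br \<epsilon> P r by simp
    also have "\<epsilon> * P / r\<^sup>2 * (?X * (- ?T + (2 + \<epsilon>) * Z) - 2 * ?Y + ?K * r * (1 - \<epsilon>) * (?T - (1 + \<epsilon>) * Z))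
      = (2 * q * (P / r\<^sup>2) * ?T + 4 * q * (q - 1) * (Z * r\<^sup>2) * (P / (r\<^sup>2)\<^sup>2)) * ?X + 2 * (2 * q * (P / r\<^sup>2)) * ?Y
        + \<epsilon> * ?K * (2 * q' * (P * r / r\<^sup>2) * ?T + 4 * q' * (q' - 1) * (Z * r\<^sup>2) * (P * r / (r\<^sup>2)\<^sup>2))"
    proof -
      have "Z * r\<^sup>2 * (P / (r\<^sup>2)\<^sup>2) = Z * (P / r\<^sup>2)" "Z * r\<^sup>2 * (P * r / (r\<^sup>2)\<^sup>2) = Z * (P / r\<^sup>2) * r"
        "P * r / r\<^sup>2 = P / r\<^sup>2 * r"
        using r by (simp_all add: power2_eq_square)
      then have *: "4 * q * (q - 1) * (Z * r\<^sup>2) * (P / (r\<^sup>2)\<^sup>2) = 4 * q * (q - 1) * (Z * (P / r\<^sup>2))"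
        "4 * q' * (q' - 1) * (Z * r\<^sup>2) * (P * r / (r\<^sup>2)\<^sup>2) = 4 * q' * (q' - 1) * (Z * (P / r\<^sup>2) * r)"
        "2 * q' * (P * r / r\<^sup>2) * ?T = 2 * q' * (P / r\<^sup>2 * r) * ?T"
        by (simp_all only: mult.assoc)
      have **: "4 * q * (q - 1) = \<epsilon> * (2 + \<epsilon>)" "4 * q' * (q' - 1) = - ((1 - \<epsilon>) * (1 + \<epsilon>))"
        "2 * q = - \<epsilon>" "2 * q' = 1 - \<epsilon>"
        by (simp_all add: q_def q'_def algebra_simps diff_divide_distrib add_divide_distrib)
      show ?thesis unfolding * unfolding ** times_divide_eq_left[symmetric] by algebra
    qed
    finally have pos: "0 < (2 * q * (P / r\<^sup>2) * ?T + 4 * q * (q - 1) * (Z * r\<^sup>2) * (P / (r\<^sup>2)\<^sup>2)) * ?X + 2 * (2 * q * (P / r\<^sup>2)) * ?Y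
        + \<epsilon> * ?K * (2 * q' * (P * r / r\<^sup>2) * ?T + 4 * q' * (q' - 1) * (Z * r\<^sup>2) * (P * r / (r\<^sup>2)\<^sup>2))" .
    show ?case
      unfolding rs Xe e1 e3
      by (rule less_le_trans[OF pos[folded Zr]], rule eq_refl) algebra
  qed
qed

end

lemma tendsto_powr_at_right_0:
  assumes "0 < (q::real)"
  shows "((\<lambda>r. r powr q) \<longlongrightarrow> 0) (at_right 0)"
  by (rule tendsto_zero_powrI[OF tendsto_ident_at tendsto_const _ assms])
     (use eventually_at_right_less[of 0] in \<open>auto elim: eventually_mono\<close>)

lemma gradient_bound_segment:
  assumes u: "has_partials U u ux uy" and M: "\<And>p. p \<in> U \<Longrightarrow> \<bar>ux p\<bar> \<le> M \<and> \<bar>uy p\<bar> \<le> M"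
    and e: "(fst e)\<^sup>2 + (snd e)\<^sup>2 = 1" and s: "0 < s" "s < r"
    and seg: "\<And>t. s \<le> t \<Longrightarrow> t \<le> r \<Longrightarrow> y + t *\<^sub>R e \<in> U"
  shows "u (y + r *\<^sub>R e) \<le> u (y + s *\<^sub>R e) + 2 * M * r"
proof -
  have "\<exists>z>s. z < r \<and> u (y + r *\<^sub>R e) - u (y + s *\<^sub>R e)
      = (r - s) * (ux (y + z *\<^sub>R e) * fst e + uy (y + z *\<^sub>R e) * snd e)"
    by (rule MVT2[OF s(2)]) (rule has_partials_line[OF u seg])
  then obtain z where z: "s < z" "z < r" and eq: "u (y + r *\<^sub>R e) - u (y + s *\<^sub>R e)
      = (r - s) * (ux (y + z *\<^sub>R e) * fst e + uy (y + z *\<^sub>R e) * snd e)" by blast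
  have b: "\<bar>ux (y + z *\<^sub>R e)\<bar> \<le> M" "\<bar>uy (y + z *\<^sub>R e)\<bar> \<le> M" using M seg z by auto
  have "(fst e)\<^sup>2 \<le> 1" "(snd e)\<^sup>2 \<le> 1" using e zero_le_power2[of "fst e"] zero_le_power2[of "snd e"] by linarith+
  then have e1: "\<bar>fst e\<bar> \<le> 1" "\<bar>snd e\<bar> \<le> 1" by (simp_all add: abs_square_le_1)
  have "\<bar>ux (y + z *\<^sub>R e) * fst e\<bar> \<le> M * 1" "\<bar>uy (y + z *\<^sub>R e) * snd e\<bar> \<le> M * 1"
    unfolding abs_mult by (intro mult_mono; use b e1 in linarith)+
  then have "ux (y + z *\<^sub>R e) * fst e + uy (y + z *\<^sub>R e) * snd e \<le> 2 * M" by linarith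
  moreover have "0 \<le> 2 * M" using b by linarith
  ultimately have "(r - s) * (ux (y + z *\<^sub>R e) * fst e + uy (y + z *\<^sub>R e) * snd e) \<le> r * (2 * M)"
    using s by (intro order_trans[OF mult_left_mono mult_right_mono]) auto
  with eq show ?thesis by (simp add: algebra_simps)
qed

context elliptic_operator
begin

text \<open>Comparison with the barrier on the part of a disk around the corner where the barrier is positive:
its straight sides carry the value 0 of the barrier, on the outer arc \<open>u\<close> has a positive minimum,
and near the corner the barrier tends to 0.\<close>

lemma corner_growth:
  assumes H: "has_hessian \<Omega> u ux uy uxx uxy uyy" and con: "connected \<Omega>"
    and L: "\<And>p. p \<in> \<Omega> \<Longrightarrow> a p * uxx p + 2 * b p * uxy p + c p * uyy p = 0"
    and pos: "\<And>p. p \<in> \<Omega> \<Longrightarrow> 0 < u p"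
    and e: "(fst e)\<^sup>2 + (snd e)\<^sup>2 = 1" and \<kappa>: "0 < \<kappa>" and r0: "0 < r0"
    and cone: "\<And>z. z \<noteq> 0 \<Longrightarrow> norm z < r0 \<Longrightarrow> - \<kappa> * norm z < fst e * fst z + snd e * snd z \<Longrightarrow> y + z \<in> \<Omega>"
    and yU: "y \<notin> \<Omega>"
  obtains \<epsilon> k r1 where "0 < \<epsilon>" "0 < k" "0 < r1" "r1 < r0"
    "\<And>r. 0 < r \<Longrightarrow> r \<le> r1 \<Longrightarrow> k * r powr (1 - \<epsilon>) \<le> u (y + r *\<^sub>R e)"
proof -
  define \<epsilon> where "\<epsilon> = min (lam / 2) (\<kappa> * lam / 48)"
  have \<epsilon>: "0 < \<epsilon>" "\<epsilon> \<le> lam / 2" using lam_pos \<kappa> by (auto simp: \<epsilon>_def)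
  define \<mu> where "\<mu> = \<epsilon> * (24 / lam)"
  have mu0: "\<mu> > 0" using \<epsilon> lam_pos by (simp add: \<mu>_def)
  have "\<epsilon> * (24 / lam) \<le> \<kappa> * lam / 48 * (24 / lam)" using lam_pos by (intro mult_right_mono) (auto simp: \<epsilon>_def)
  also have "\<dots> = \<kappa> / 2" using lam_pos by simp
  finally have mu1: "\<mu> < \<kappa>" using \<kappa> by (simp add: \<mu>_def)
  define r1 where "r1 = r0 / 2"
  have r1: "0 < r1" "r1 < r0" using r0 by (auto simp: r1_def)
  define l where "l = (\<lambda>z. fst e * fst z + snd e * snd z)"
  have lcont: "continuous_on X l" for X unfolding l_def by (intro continuous_intros)
  define \<Phi> where "\<Phi> = corner_barrier y e \<epsilon>"
  have \<Phi>: "\<Phi> p = norm (p - y) powr (- \<epsilon>) * (l (p - y) + \<mu> * norm (p - y))" if "p \<noteq> y" for p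
    using corner_barrier_eq[of "p - y" y e \<epsilon>] that by (simp add: \<Phi>_def l_def \<mu>_def)
  have lle: "l z \<le> norm z" for z
  proof -
    have "(l z)\<^sup>2 + (fst e * snd z - snd e * fst z)\<^sup>2 = ((fst e)\<^sup>2 + (snd e)\<^sup>2) * (norm z)\<^sup>2"
      unfolding norm_sq_coords l_def by algebra
    then have "(l z)\<^sup>2 \<le> (norm z)\<^sup>2" unfolding e
      using zero_le_power2[of "fst e * snd z - snd e * fst z"] by linarith
    then have "\<bar>l z\<bar> \<le> norm z" by (simp add: abs_le_square_iff[symmetric])
    then show ?thesis by simp
  qed
  have inU: "p \<in> \<Omega>" if "p \<noteq> y" "norm (p - y) \<le> r1" "- \<mu> * norm (p - y) \<le> l (p - y)" for p
  proof -
    have "- \<kappa> * norm (p - y) < - \<mu> * norm (p - y)" using that mu1 by simp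
    then have "- \<kappa> * norm (p - y) < l (p - y)" using that(3) by linarith
    then show ?thesis using cone[of "p - y"] that r1 by (simp add: l_def)
  qed
  have uc: "continuous_on \<Omega> u" using H by (rule has_hessian_continuous_on)
  \<comment> \<open>lower bound on the outer arc\<close>
  define A where "A = {p. norm (p - y) = r1 \<and> - \<mu> * norm (p - y) \<le> l (p - y)}"
  have ndy: "continuous_on X (\<lambda>p. norm (p - y))" "continuous_on X (\<lambda>p. l (p - y))" for X
    unfolding l_def by (auto intro!: continuous_intros)
  have "closed A" unfolding A_def
    by (intro closed_Collect_conj closed_Collect_eq closed_Collect_le continuous_intros ndy)
  moreover have "bounded A"
    by (rule bounded_subset[of "cball y r1"]) (auto simp: A_def dist_norm norm_minus_commute)
  ultimately have cA: "compact A" by (simp add: compact_eq_bounded_closed)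
  have AU: "A \<subseteq> \<Omega>" using inU r1 by (auto simp: A_def)
  have "norm e = 1" using e norm_sq_coords[of e] by (simp add: power2_eq_1_iff) (smt (verit) norm_ge_zero)
  then have ne: "norm e = 1" .
  have le: "l (r *\<^sub>R e) = r" for r
  proof -
    have "l (r *\<^sub>R e) = r * ((fst e)\<^sup>2 + (snd e)\<^sup>2)" by (simp add: l_def algebra_simps power2_eq_square)
    then show ?thesis using e by simp
  qed
  have "y + r1 *\<^sub>R e \<in> A"
    unfolding A_def mem_Collect_eq add_diff_cancel_left' le using ne r1 mu0 by (simp add: mult_nonneg_nonneg order_trans[of _ 0])
  then have Ane: "A \<noteq> {}" by blast
  obtain x0 where x0: "x0 \<in> A" "\<And>x. x \<in> A \<Longrightarrow> u x0 \<le> u x"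
    using continuous_attains_inf[OF cA Ane continuous_on_subset[OF uc AU]] by blast
  define k where "k = u x0 / (r1 powr (- \<epsilon>) * (r1 + \<mu> * r1))"
  have denom: "0 < r1 powr (- \<epsilon>) * (r1 + \<mu> * r1)" using r1 mu0 by (simp add: add_pos_pos)
  have k: "k > 0" using pos[of x0] x0(1) AU denom by (auto simp: k_def)
  have main: "k * \<Phi> p \<le> u p" if p: "p \<noteq> y" "norm (p - y) \<le> r1" "- \<mu> * norm (p - y) \<le> l (p - y)" for p
  proof (rule field_le_epsilon)
    fix \<eta> :: real assume \<eta>: "0 < \<eta>"
    \<comment> \<open>the barrier is smaller than \<open>\<eta>\<close> close to the corner\<close>
    have "((\<lambda>r. k * ((1 + \<mu>) * r powr (1 - \<epsilon>))) \<longlongrightarrow> k * ((1 + \<mu>) * 0)) (at_right 0)"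
    proof (intro tendsto_intros)
      have "lam \<le> 1" using diagonal_bounds[OF AU[THEN subsetD, OF x0(1)]] by linarith
      then have "0 < 1 - \<epsilon>" using \<epsilon> by linarith
      then show "((\<lambda>r. r powr (1 - \<epsilon>)) \<longlongrightarrow> 0) (at_right 0)"
        by (intro tendsto_powr_at_right_0)
    qed
    then have "eventually (\<lambda>r. k * ((1 + \<mu>) * r powr (1 - \<epsilon>)) < \<eta>) (at_right 0)"
      using \<eta> by (auto dest: order_tendstoD(2))
    then obtain d where d: "d > 0" "\<And>r. 0 < r \<Longrightarrow> r < d \<Longrightarrow> k * ((1 + \<mu>) * r powr (1 - \<epsilon>)) < \<eta>"
      unfolding eventually_at_right[OF zero_less_one] by blast
    \<comment> \<open>a disk of radius \<open>r2\<close> is removed, on whose boundary the barrier is below \<open>\<eta> / k\<close>\<close>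
    define r2 where "r2 = min (min (d/2) r1) (norm (p - y))"
    have r2: "0 < r2" "r2 \<le> r1" "r2 < d" "r2 \<le> norm (p - y)" using d r1 p by (auto simp: r2_def)
    define S where "S = {q. r2 \<le> norm (q - y) \<and> norm (q - y) \<le> r1 \<and> - \<mu> * norm (q - y) \<le> l (q - y)}"
    have "closed S" unfolding S_def
      by (intro closed_Collect_conj closed_Collect_le continuous_intros ndy)
    moreover have "bounded S"
      by (rule bounded_subset[of "cball y r1"]) (auto simp: S_def dist_norm norm_minus_commute)
    ultimately have cS: "compact S" by (simp add: compact_eq_bounded_closed)
    have Sy: "q \<noteq> y" if "q \<in> S" for q using that r2(1) by (auto simp: S_def)
    have SU: "S \<subseteq> \<Omega>" using inU Sy by (auto simp: S_def)
    have iS: "interior S \<subseteq> \<Omega>" "y \<notin> interior S" "y \<notin> S" using SU Sy interior_subset by blast+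
    obtain v vx vy vxx vxy vyy where v: "has_hessian (interior S) (corner_barrier y e \<epsilon>) vx vy vxx vxy vyy"
      "\<And>p. p \<in> interior S \<Longrightarrow> p \<in> \<Omega> \<Longrightarrow> 0 < a p * vxx p + 2 * b p * vxy p + c p * vyy p"
      using corner_barrier_subsolution[OF e \<epsilon> iS(2)] by metis
    obtain wx wy wxx wxy wyy where w: "has_hessian S (corner_barrier y e \<epsilon>) wx wy wxx wxy wyy"
      using corner_barrier_subsolution[OF e \<epsilon> iS(3)] by metis
    have Hc: "has_hessian (interior S) (\<lambda>p. \<eta>) (\<lambda>p. 0) (\<lambda>p. 0) (\<lambda>p. 0) (\<lambda>p. 0) (\<lambda>p. 0)"
      by (simp add: has_hessian_def has_partials_const)
    have "0 \<le> u p + - k * \<Phi> p + \<eta>"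
    proof (rule strict_minimum_principle[OF cS iS(1) _ has_hessian_add[OF has_hessian_add[OF has_hessian_subset[OF H iS(1)] has_hessian_cmult[OF v(1), folded \<Phi>_def, of "- k"]] Hc]])
      show "continuous_on S (\<lambda>p. u p + - k * \<Phi> p + \<eta>)"
        unfolding \<Phi>_def by (intro continuous_intros continuous_on_subset[OF uc SU] has_hessian_continuous_on[OF w])
      show "p \<in> S" using p r2 by (simp add: S_def)
      show "0 \<le> u q + - k * \<Phi> q + \<eta>" if q: "q \<in> frontier S" for q
      proof -
        have qS: "q \<in> S" using that cS compact_imp_closed frontier_subset_closed by blast
        have qy: "q \<noteq> y" by (rule Sy[OF qS])
        have uq: "0 \<le> u q" using pos[of q] SU qS by force
        define O1 where "O1 = {q. r2 < norm (q - y) \<and> norm (q - y) < r1 \<and> - \<mu> * norm (q - y) < l (q - y)}"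
        have "open O1" unfolding O1_def
          by (intro open_Collect_conj open_Collect_less continuous_intros ndy)
        moreover have "O1 \<subseteq> S" by (auto simp: O1_def S_def)
        ultimately have "O1 \<subseteq> interior S" by (simp add: interior_maximal)
        then have "q \<notin> O1" using q by (auto simp: frontier_def)
        then consider "norm (q - y) = r2" | "norm (q - y) = r1" | "- \<mu> * norm (q - y) = l (q - y)"
          using qS by (force simp: O1_def S_def)
        then show ?thesis
        proof cases
          case 1
          have "l (q - y) + \<mu> * norm (q - y) \<le> (1 + \<mu>) * r2" using lle[of "q - y"] 1 by (simp add: algebra_simps)
          then have "\<Phi> q \<le> r2 powr (- \<epsilon>) * ((1 + \<mu>) * r2)" unfolding \<Phi>[OF qy] 1 by (intro mult_left_mono) auto
          also have "\<dots> = (1 + \<mu>) * r2 powr (1 - \<epsilon>)"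
          proof -
            have "r2 powr (1 - \<epsilon>) = r2 powr (- \<epsilon>) * r2 powr 1" unfolding powr_add[symmetric] by simp
            then show ?thesis using r2 by (simp add: mult_ac)
          qed
          finally have "k * \<Phi> q \<le> k * ((1 + \<mu>) * r2 powr (1 - \<epsilon>))" using k by (intro mult_left_mono) auto
          also have "\<dots> < \<eta>" by (rule d(2)) (use r2 in auto)
          finally show ?thesis using uq by simp
        next
          case 2
          have "l (q - y) + \<mu> * norm (q - y) \<le> r1 + \<mu> * r1" using lle[of "q - y"] 2 by (simp add: algebra_simps)
          then have "\<Phi> q \<le> r1 powr (- \<epsilon>) * (r1 + \<mu> * r1)" unfolding \<Phi>[OF qy] 2 by (intro mult_left_mono) auto
          then have "k * \<Phi> q \<le> k * (r1 powr (- \<epsilon>) * (r1 + \<mu> * r1))" using k by (intro mult_left_mono) auto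
          also have "\<dots> = u x0" using denom unfolding k_def by (metis less_irrefl nonzero_eq_divide_eq)
          also have "\<dots> \<le> u q" by (rule x0(2)) (use 2 qS in \<open>auto simp: A_def S_def\<close>)
          finally show ?thesis using \<eta> by simp
        next
          case 3
          then have "\<Phi> q = 0" unfolding \<Phi>[OF qy] by (simp flip: 3)
          then show ?thesis using uq \<eta> by simp
        qed
      qed
      fix q assume q: "q \<in> interior S"
      then have "0 < k * (a q * vxx q + 2 * b q * vxy q + c q * vyy q)"
        using v(2)[OF q] iS(1) k by (intro mult_pos_pos) auto
      moreover have "a q * uxx q + 2 * b q * uxy q + c q * uyy q = 0" using L q iS(1) by blast
      ultimately show "a q * (uxx q + - k * vxx q + 0) + 2 * b q * (uxy q + - k * vxy q + 0) + c q * (uyy q + - k * vyy q + 0) < 0"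
        by (simp add: algebra_simps)
    qed
    then show "k * \<Phi> p \<le> u p + \<eta>" by simp
  qed
  show thesis
  proof (rule that[OF \<epsilon>(1) k r1])
    fix r assume r: "0 < r" "r \<le> r1"
    have "norm (y + r *\<^sub>R e - y) = r" "l (y + r *\<^sub>R e - y) = r" using ne r le by simp_all
    moreover have ry: "y + r *\<^sub>R e \<noteq> y" using r ne by auto
    moreover have "- \<mu> * r \<le> r" using mu0 r by (simp add: order_trans[of _ 0])
    ultimately have "k * (r powr (- \<epsilon>) * (r + \<mu> * r)) \<le> u (y + r *\<^sub>R e)" using main[of "y + r *\<^sub>R e"] \<Phi>[OF ry] r by simp
    moreover have "k * (r powr (- \<epsilon>) * r) \<le> k * (r powr (- \<epsilon>) * (r + \<mu> * r))"
      using k mu0 r by (intro mult_left_mono) auto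
    moreover have "r powr (1 - \<epsilon>) = r powr (- \<epsilon>) * r powr 1" unfolding powr_add[symmetric] by simp
    ultimately show "k * r powr (1 - \<epsilon>) \<le> u (y + r *\<^sub>R e)" using r by simp
  qed
qed

text \<open>A solution with bounded gradient grows at most linearly along the bisector, which contradicts the
growth that the barrier enforces.\<close>

lemma nonneg_solution_at_corner_vanishes:
  assumes H: "has_hessian \<Omega> u ux uy uxx uxy uyy" and con: "connected \<Omega>"
    and L: "\<And>p. p \<in> \<Omega> \<Longrightarrow> a p * uxx p + 2 * b p * uxy p + c p * uyy p = 0"
    and nonneg: "\<And>p. p \<in> \<Omega> \<Longrightarrow> 0 \<le> u p"
    and M: "\<And>p. p \<in> \<Omega> \<Longrightarrow> \<bar>ux p\<bar> \<le> M \<and> \<bar>uy p\<bar> \<le> M"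
    and e: "(fst e)\<^sup>2 + (snd e)\<^sup>2 = 1" and \<kappa>: "0 < \<kappa>" and r0: "0 < r0"
    and cone: "\<And>z. z \<noteq> 0 \<Longrightarrow> norm z < r0 \<Longrightarrow> - \<kappa> * norm z < fst e * fst z + snd e * snd z \<Longrightarrow> y + z \<in> \<Omega>"
    and yU: "y \<notin> \<Omega>" and lim: "(u \<longlongrightarrow> 0) (at y within \<Omega>)" and q: "q \<in> \<Omega>"
  shows "u q = 0"
proof (rule ccontr)
  assume "u q \<noteq> 0"
  then have uq: "0 < u q" using nonneg[OF q] by simp
  have pos: "0 < u p" if "p \<in> \<Omega>" for p
    by (rule strong_minimum_principle[OF H con L nonneg q uq that])
  obtain \<epsilon> k r1 where 1: "0 < \<epsilon>" "0 < k" "0 < r1" "r1 < r0"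
    and low: "\<And>r. 0 < r \<Longrightarrow> r \<le> r1 \<Longrightarrow> k * r powr (1 - \<epsilon>) \<le> u (y + r *\<^sub>R e)"
    by (rule corner_growth[OF H con L pos e \<kappa> r0 cone yU], assumption+, rule that)
  have ne: "norm e = 1" using e norm_sq_coords[of e] by (simp add: power2_eq_1_iff) (smt (verit) norm_ge_zero)
  have seg: "y + t *\<^sub>R e \<in> \<Omega>" if "0 < t" "t \<le> r1" for t
  proof (rule cone)
    show "t *\<^sub>R e \<noteq> 0" "norm (t *\<^sub>R e) < r0" using that ne 1 by auto
    have "fst e * fst (t *\<^sub>R e) + snd e * snd (t *\<^sub>R e) = t * ((fst e)\<^sup>2 + (snd e)\<^sup>2)"
      by (simp add: algebra_simps power2_eq_square)
    moreover have "- \<kappa> * norm (t *\<^sub>R e) < 0" using that ne \<kappa> by simp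
    ultimately show "- \<kappa> * norm (t *\<^sub>R e) < fst e * fst (t *\<^sub>R e) + snd e * snd (t *\<^sub>R e)"
      unfolding e using that by linarith
  qed
  have up: "u (y + r *\<^sub>R e) \<le> 2 * M * r" if r: "0 < r" "r \<le> r1" for r
  proof (rule tendsto_lowerbound)
    have "filterlim (\<lambda>s. y + s *\<^sub>R e) (at y within \<Omega>) (at_right 0)"
      unfolding filterlim_at
    proof
      have "eventually (\<lambda>s::real. 0 < s \<and> s < r) (at_right 0)"
        unfolding eventually_at_right[OF zero_less_one] using r by blast
      then show "eventually (\<lambda>s. y + s *\<^sub>R e \<in> \<Omega> \<and> y + s *\<^sub>R e \<noteq> y) (at_right 0)"
        by eventually_elim (use seg r ne in auto)
      show "((\<lambda>s. y + s *\<^sub>R e) \<longlongrightarrow> y) (at_right 0)"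
        by (rule tendsto_eq_intros tendsto_ident_at refl | simp)+
    qed
    from filterlim_compose[OF lim this]
    show "((\<lambda>s. u (y + s *\<^sub>R e) + 2 * M * r) \<longlongrightarrow> 2 * M * r) (at_right 0)"
      by (auto intro!: tendsto_eq_intros)
    have "eventually (\<lambda>s::real. 0 < s \<and> s < r) (at_right 0)"
      unfolding eventually_at_right[OF zero_less_one] using r by blast
    then show "eventually (\<lambda>s. u (y + r *\<^sub>R e) \<le> u (y + s *\<^sub>R e) + 2 * M * r) (at_right 0)"
    proof eventually_elim
      case (elim s)
      show ?case
        by (rule gradient_bound_segment[OF _ M e]) (use H elim seg r in \<open>auto simp: has_hessian_def\<close>)
    qed
  qed simp
  have "eventually (\<lambda>r. 2 * M * r < k * r powr (1 - \<epsilon>)) (at_right 0)"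
  proof -
    have "((\<lambda>r. 2 * M * r powr \<epsilon>) \<longlongrightarrow> 2 * M * 0) (at_right 0)"
      by (intro tendsto_intros tendsto_powr_at_right_0 1)
    then have "eventually (\<lambda>r. 2 * M * r powr \<epsilon> < k) (at_right 0)" using 1 by (auto dest: order_tendstoD(2))
    then show ?thesis using eventually_at_right_less[of 0]
    proof eventually_elim
      case (elim r)
      have "r = r powr \<epsilon> * r powr (1 - \<epsilon>)" using elim(2) unfolding powr_add[symmetric] by simp
      moreover have "2 * M * r powr \<epsilon> * r powr (1 - \<epsilon>) < k * r powr (1 - \<epsilon>)"
        using elim by (intro mult_strict_right_mono) auto
      ultimately show ?case by (metis mult.assoc)
    qed
  qed
  moreover have "eventually (\<lambda>s::real. 0 < s \<and> s < r1) (at_right 0)"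
    unfolding eventually_at_right[OF zero_less_one] using 1 by blast
  ultimately have "eventually (\<lambda>s::real. False) (at_right 0)"
  proof eventually_elim
    case (elim r)
    with up[of r] low[of r] show ?case by simp
  qed
  then show False by simp
qed

end

section \<open>Integrals over circles\<close>

text \<open>Integrate the square \<open>(g' + k T g)\<^sup>2\<close> with \<open>T(x) = tan (k (x - m))\<close>, where \<open>m\<close> is the midpoint: it
differs from \<open>g'\<^sup>2 - k\<^sup>2 g\<^sup>2\<close> by the derivative of \<open>k T g\<^sup>2\<close>, which vanishes at both ends. Taking
\<open>k < 1\<close> keeps the tangent bounded.\<close>

lemma wirtinger_half_period:
  fixes g g' :: "real \<Rightarrow> real"
  assumes g: "\<And>x. (g has_real_derivative g' x) (at x)" and g': "continuous_on UNIV g'"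
    and k: "0 < k" "k < 1" and zero: "g \<alpha> = 0" "g (\<alpha> + pi) = 0"
  shows "k\<^sup>2 * integral {\<alpha>..\<alpha> + pi} (\<lambda>x. (g x)\<^sup>2) \<le> integral {\<alpha>..\<alpha> + pi} (\<lambda>x. (g' x)\<^sup>2)"
proof -
  define m where "m = \<alpha> + pi / 2"
  define T where "T = (\<lambda>x. tan (k * (x - m)))"
  define H where "H = (\<lambda>x. k * T x * (g x)\<^sup>2)"
  define H' where "H' = (\<lambda>x. k\<^sup>2 * (1 + (T x)\<^sup>2) * (g x)\<^sup>2 + 2 * k * T x * g x * g' x)"
  have cg: "continuous_on X g" for X
    using g by (meson DERIV_continuous_on has_field_derivative_at_within)
  have cg': "continuous_on X g'" for X using g' by (rule continuous_on_subset) auto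
  have cos: "cos (k * (x - m)) \<noteq> 0" if "x \<in> {\<alpha>..\<alpha> + pi}" for x
  proof -
    have x: "\<bar>x - m\<bar> \<le> pi / 2" using that unfolding m_def atLeastAtMost_iff by linarith
    have "\<bar>k * (x - m)\<bar> = k * \<bar>x - m\<bar>" using k by (simp add: abs_mult)
    also have "\<dots> \<le> k * (pi / 2)" using x k by (intro mult_left_mono) auto
    also have "\<dots> < 1 * (pi / 2)" using k by (intro mult_strict_right_mono) auto
    finally have "cos (k * (x - m)) > 0" by (intro cos_gt_zero_pi) auto
    then show ?thesis by simp
  qed
  have cT: "continuous_on {\<alpha>..\<alpha> + pi} T"
    unfolding T_def by (intro continuous_intros) (use cos in auto)
  have T': "(T has_real_derivative k * (1 + (T x)\<^sup>2)) (at x)" if "x \<in> {\<alpha>..\<alpha> + pi}" for x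
    unfolding T_def
    by (rule derivative_eq_intros refl cos[OF that])+ (use cos[OF that] in \<open>simp add: tan_sec power_inverse\<close>)
  have "(H has_real_derivative H' x) (at x within {\<alpha>..\<alpha> + pi})" if "x \<in> {\<alpha>..\<alpha> + pi}" for x
    unfolding H_def H'_def
    by (rule DERIV_subset[OF _ subset_UNIV])
       (rule derivative_eq_intros refl T'[OF that] g | simp add: algebra_simps power2_eq_square)+
  then have "(H' has_integral (H (\<alpha> + pi) - H \<alpha>)) {\<alpha>..\<alpha> + pi}"
    by (intro fundamental_theorem_of_calculus) (auto simp: has_real_derivative_iff_has_vector_derivative)
  then have H0: "(H' has_integral 0) {\<alpha>..\<alpha> + pi}" by (simp add: H_def zero)
  have I1: "((\<lambda>x. (g' x)\<^sup>2) has_integral integral {\<alpha>..\<alpha> + pi} (\<lambda>x. (g' x)\<^sup>2)) {\<alpha>..\<alpha> + pi}"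
    by (intro integrable_integral integrable_continuous_real continuous_intros cg')
  have I2: "((\<lambda>x. k\<^sup>2 * (g x)\<^sup>2) has_integral k\<^sup>2 * integral {\<alpha>..\<alpha> + pi} (\<lambda>x. (g x)\<^sup>2)) {\<alpha>..\<alpha> + pi}"
    by (intro has_integral_mult_right integrable_integral integrable_continuous_real continuous_intros cg)
  have "((\<lambda>x. (g' x)\<^sup>2 - k\<^sup>2 * (g x)\<^sup>2 + H' x) has_integral
     integral {\<alpha>..\<alpha> + pi} (\<lambda>x. (g' x)\<^sup>2) - k\<^sup>2 * integral {\<alpha>..\<alpha> + pi} (\<lambda>x. (g x)\<^sup>2) + 0) {\<alpha>..\<alpha> + pi}"
    by (intro has_integral_add has_integral_diff I1 I2 H0)
  moreover have "(g' x)\<^sup>2 - k\<^sup>2 * (g x)\<^sup>2 + H' x = (g' x + k * T x * g x)\<^sup>2" for x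
    unfolding H'_def by (simp add: algebra_simps power2_eq_square)
  ultimately have "((\<lambda>x. (g' x + k * T x * g x)\<^sup>2) has_integral
     integral {\<alpha>..\<alpha> + pi} (\<lambda>x. (g' x)\<^sup>2) - k\<^sup>2 * integral {\<alpha>..\<alpha> + pi} (\<lambda>x. (g x)\<^sup>2)) {\<alpha>..\<alpha> + pi}"
    by simp
  then have "0 \<le> integral {\<alpha>..\<alpha> + pi} (\<lambda>x. (g' x)\<^sup>2) - k\<^sup>2 * integral {\<alpha>..\<alpha> + pi} (\<lambda>x. (g x)\<^sup>2)"
    by (rule has_integral_nonneg) simp
  then show ?thesis by simp
qed

lemma integral_period_shift:
  fixes f :: "real \<Rightarrow> real"
  assumes f: "continuous_on UNIV f" and per: "\<And>x. f (x + 2 * pi) = f x" and \<alpha>: "0 \<le> \<alpha>" "\<alpha> \<le> 2 * pi"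
  shows "integral {\<alpha>..\<alpha> + 2 * pi} f = integral {0..2 * pi} f"
proof -
  have int: "f integrable_on {a..b}" for a b
    by (intro integrable_continuous_real continuous_on_subset[OF f]) auto
  have "integral {0..\<alpha>} f = integral {2 * pi..\<alpha> + 2 * pi} f"
    using integral_shift_Icc_real[of 0 \<alpha> f "2 * pi"] by (simp add: o_def per add.commute)
  moreover have "integral {\<alpha>..2 * pi} f + integral {2 * pi..\<alpha> + 2 * pi} f = integral {\<alpha>..\<alpha> + 2 * pi} f"
    by (rule Henstock_Kurzweil_Integration.integral_combine) (use \<alpha> int in auto)
  moreover have "integral {0..\<alpha>} f + integral {\<alpha>..2 * pi} f = integral {0..2 * pi} f"
    by (rule Henstock_Kurzweil_Integration.integral_combine) (use \<alpha> int in auto)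
  ultimately show ?thesis by simp
qed

text \<open>By the intermediate value theorem \<open>g\<close> takes the same value \<open>c\<close> at two antipodal points, so the
previous lemma applies to \<open>g - c\<close> on both half periods.\<close>

lemma wirtinger:
  fixes g g' :: "real \<Rightarrow> real"
  assumes g: "\<And>x. (g has_real_derivative g' x) (at x)" and g': "continuous_on UNIV g'"
    and per: "\<And>x. g (x + 2 * pi) = g x" and k: "0 < k" "k < 1"
  shows "\<exists>c. k\<^sup>2 * integral {0..2 * pi} (\<lambda>x. (g x - c)\<^sup>2) \<le> integral {0..2 * pi} (\<lambda>x. (g' x)\<^sup>2)"
proof -
  have cg: "continuous_on X g" for X
    using g by (meson DERIV_continuous_on has_field_derivative_at_within)
  have per': "g' (x + 2 * pi) = g' x" for x
  proof -
    have "((\<lambda>x. g (x + 2 * pi)) has_real_derivative g' (x + 2 * pi)) (at x)"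
      using DERIV_shift[of g "g' (x + 2 * pi)" x "2 * pi"] g by simp
    then show ?thesis using g[of x] per DERIV_unique by force
  qed
  have "\<exists>\<alpha>\<ge>0. \<alpha> \<le> pi \<and> g \<alpha> = g (\<alpha> + pi)"
  proof -
    define h where "h = (\<lambda>x. g x - g (x + pi))"
    have h: "continuous_on X h" for X
      unfolding h_def by (intro continuous_intros cg continuous_on_compose2[OF cg[of UNIV]]) auto
    have "h pi = - h 0" using per[of 0] by (simp add: h_def)
    then consider "h 0 \<le> 0" "0 \<le> h pi" | "h pi \<le> 0" "0 \<le> h 0" by linarith
    then have "\<exists>\<alpha>\<ge>0. \<alpha> \<le> pi \<and> h \<alpha> = 0"
    proof cases
      case 1 then show ?thesis using IVT'[of h 0 0 pi] h by auto
    next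
      case 2 then show ?thesis using IVT2'[of h pi 0 0] h by auto
    qed
    then show ?thesis by (auto simp: h_def)
  qed
  then obtain \<alpha> where \<alpha>: "0 \<le> \<alpha>" "\<alpha> \<le> pi" "g \<alpha> = g (\<alpha> + pi)" by blast
  define c where "c = g \<alpha>"
  have gc: "((\<lambda>x. g x - c) has_real_derivative g' x) (at x)" for x
    using DERIV_diff[OF g DERIV_const[of c]] by simp
  have 1: "k\<^sup>2 * integral {\<alpha>..\<alpha> + pi} (\<lambda>x. (g x - c)\<^sup>2) \<le> integral {\<alpha>..\<alpha> + pi} (\<lambda>x. (g' x)\<^sup>2)"
    by (rule wirtinger_half_period[OF gc g' k]) (use \<alpha> in \<open>auto simp: c_def\<close>)
  have 2: "k\<^sup>2 * integral {\<alpha> + pi..\<alpha> + pi + pi} (\<lambda>x. (g x - c)\<^sup>2) \<le> integral {\<alpha> + pi..\<alpha> + pi + pi} (\<lambda>x. (g' x)\<^sup>2)"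
    by (rule wirtinger_half_period[OF gc g' k]) (use \<alpha> per[of \<alpha>] in \<open>auto simp: c_def add.assoc\<close>)
  have cs: "continuous_on X (\<lambda>x. (g x - c)\<^sup>2)" "continuous_on X (\<lambda>x. (g' x)\<^sup>2)" for X
    by (intro continuous_intros cg continuous_on_subset[OF g'] subset_UNIV)+
  have sum: "integral {\<alpha>..\<alpha> + pi} f + integral {\<alpha> + pi..\<alpha> + pi + pi} f = integral {0..2 * pi} f"
    if "continuous_on UNIV f" "\<And>x. f (x + 2 * pi) = f x" for f :: "real \<Rightarrow> real"
  proof -
    have "integral {\<alpha>..\<alpha> + pi} f + integral {\<alpha> + pi..\<alpha> + 2 * pi} f = integral {\<alpha>..\<alpha> + 2 * pi} f"
      by (rule Henstock_Kurzweil_Integration.integral_combine)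
         (auto intro!: integrable_continuous_real continuous_on_subset[OF that(1)])
    also have "\<dots> = integral {0..2 * pi} f" by (rule integral_period_shift) (use that \<alpha> in auto)
    finally show ?thesis by (simp add: add.assoc)
  qed
  have s: "integral {\<alpha>..\<alpha> + pi} (\<lambda>x. (g x - c)\<^sup>2) + integral {\<alpha> + pi..\<alpha> + pi + pi} (\<lambda>x. (g x - c)\<^sup>2)
      = integral {0..2 * pi} (\<lambda>x. (g x - c)\<^sup>2)"
    "integral {\<alpha>..\<alpha> + pi} (\<lambda>x. (g' x)\<^sup>2) + integral {\<alpha> + pi..\<alpha> + pi + pi} (\<lambda>x. (g' x)\<^sup>2)
      = integral {0..2 * pi} (\<lambda>x. (g' x)\<^sup>2)"
    by (rule sum[OF cs(1)], simp add: per) (rule sum[OF cs(2)], simp add: per')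
  have "k\<^sup>2 * integral {0..2 * pi} (\<lambda>x. (g x - c)\<^sup>2) \<le> integral {0..2 * pi} (\<lambda>x. (g' x)\<^sup>2)"
    using add_mono[OF 1 2] unfolding distrib_left[symmetric] s .
  then show ?thesis by blast
qed

text \<open>A form of the Cauchy-Schwarz inequality with a free parameter \<open>e\<close> in place of a square root.\<close>

lemma oscillation_le:
  fixes g g' :: "real \<Rightarrow> real"
  assumes g: "\<And>x. (g has_real_derivative g' x) (at x)" and g': "continuous_on UNIV g'"
    and x: "x \<in> {0..2 * pi}" and y: "y \<in> {0..2 * pi}" and e: "e > 0"
  shows "\<bar>g x - g y\<bar> \<le> pi * e + integral {0..2 * pi} (\<lambda>x. (g' x)\<^sup>2) / (2 * e)"
proof -
  have c: "continuous_on X g'" for X using g' by (rule continuous_on_subset) auto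
  have *: "\<bar>g v - g u\<bar> \<le> pi * e + integral {0..2 * pi} (\<lambda>x. (g' x)\<^sup>2) / (2 * e)"
    if uv: "u \<in> {0..2 * pi}" "v \<in> {0..2 * pi}" "u \<le> v" for u v
  proof -
    let ?h = "\<lambda>x. e / 2 + (g' x)\<^sup>2 / (2 * e)"
    have "(g' has_integral (g v - g u)) {u..v}"
      by (rule fundamental_theorem_of_calculus)
         (use uv g in \<open>auto simp flip: has_real_derivative_iff_has_vector_derivative intro: has_field_derivative_at_within\<close>)
    then have gi: "integral {u..v} g' = g v - g u" by (rule integral_unique)
    have pw: "\<bar>g' t\<bar> \<le> ?h t" for t
    proof -
      have "0 \<le> (\<bar>g' t\<bar> - e)\<^sup>2" by simp
      then have "2 * e * \<bar>g' t\<bar> \<le> e\<^sup>2 + (g' t)\<^sup>2" by (simp add: power2_diff algebra_simps)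
      then show ?thesis using e by (simp add: field_simps power2_eq_square)
    qed
    have "norm (integral {u..v} g') \<le> integral {u..v} ?h"
      by (rule integral_norm_bound_integral) (use pw e in \<open>auto intro!: integrable_continuous_real continuous_intros c\<close>)
    also have "\<dots> \<le> integral {0..2 * pi} ?h"
      by (rule integral_subset_le) (use uv e in \<open>auto intro!: integrable_continuous_real continuous_intros c\<close>)
    also have "\<dots> = pi * e + integral {0..2 * pi} (\<lambda>x. (g' x)\<^sup>2) / (2 * e)"
      by (subst Henstock_Kurzweil_Integration.integral_add) (use e in \<open>auto intro!: integrable_continuous_real continuous_intros c\<close>)
    finally show ?thesis by (simp add: gi)
  qed
  show ?thesis
    using *[OF x y] *[OF y x] by (cases "x \<le> y") (auto simp: abs_minus_commute)
qed

text \<open>In logarithmic polar coordinates \<open>(t, \<theta>)\<close> the outside of a disk becomes a half-infinite cylinder,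
whose circles \<open>t = const\<close> all have length \<open>2 \<pi>\<close>.\<close>

abbreviation cylinder :: "real \<Rightarrow> (real \<times> real) set" where
  "cylinder T \<equiv> {T<..} \<times> UNIV"

definition circ :: "(real \<times> real \<Rightarrow> real) \<Rightarrow> real \<Rightarrow> real" where
  "circ f t = integral {0..2 * pi} (\<lambda>\<theta>. f (t, \<theta>))"

definition periodic :: "(real \<times> real \<Rightarrow> real) \<Rightarrow> bool" where
  "periodic f \<longleftrightarrow> (\<forall>t \<theta>. f (t, \<theta> + 2 * pi) = f (t, \<theta>))"

lemma continuous_on_circle:
  assumes "continuous_on (cylinder T) f" "T < t"
  shows "continuous_on X (\<lambda>\<theta>. f (t, \<theta>))"
  by (rule continuous_on_compose2[OF assms(1)]) (use assms(2) in \<open>auto intro!: continuous_intros\<close>)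

lemma circ_integrable:
  fixes f :: "real \<times> real \<Rightarrow> real"
  assumes "continuous_on (cylinder T) f" "T < t"
  shows "(\<lambda>\<theta>. f (t, \<theta>)) integrable_on {0..2 * pi}"
  by (intro integrable_continuous_real continuous_on_circle[OF assms])

lemma circ_add:
  assumes "continuous_on (cylinder T) f" "continuous_on (cylinder T) g" "T < t"
  shows "circ (\<lambda>z. f z + g z) t = circ f t + circ g t"
  unfolding circ_def
  by (rule Henstock_Kurzweil_Integration.integral_add) (rule circ_integrable[OF assms(1,3)] circ_integrable[OF assms(2,3)])+

lemma circ_diff:
  assumes "continuous_on (cylinder T) f" "continuous_on (cylinder T) g" "T < t"
  shows "circ (\<lambda>z. f z - g z) t = circ f t - circ g t"
  unfolding circ_def
  by (rule Henstock_Kurzweil_Integration.integral_diff) (rule circ_integrable[OF assms(1,3)] circ_integrable[OF assms(2,3)])+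

lemma circ_cmult: "circ (\<lambda>z. c * f z) t = c * circ f t"
  unfolding circ_def by simp

lemma circ_mono:
  assumes "continuous_on (cylinder T) f" "continuous_on (cylinder T) g" "T < t"
    and "\<And>\<theta>. f (t, \<theta>) \<le> g (t, \<theta>)"
  shows "circ f t \<le> circ g t"
  unfolding circ_def
  by (rule integral_le) (use assms in \<open>auto intro: circ_integrable\<close>)

lemma circ_nonneg:
  assumes "continuous_on (cylinder T) f" "T < t" and "\<And>\<theta>. 0 \<le> f (t, \<theta>)"
  shows "0 \<le> circ f t"
  unfolding circ_def
  by (rule integral_nonneg) (use assms in \<open>auto intro: circ_integrable\<close>)

lemma circ_const: "circ (\<lambda>z. c) t = 2 * pi * c"
  unfolding circ_def by simp

lemma circ_derivative:
  assumes f: "has_partials (cylinder T) f ft f\<theta>" and ft: "continuous_on (cylinder T) ft" and t: "T < t"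
  shows "(circ f has_real_derivative circ ft t) (at t)"
proof -
  have "((\<lambda>t. integral (cbox 0 (2 * pi)) (\<lambda>\<theta>. f (t, \<theta>))) has_field_derivative
      integral (cbox 0 (2 * pi)) (\<lambda>\<theta>. ft (t, \<theta>))) (at t within {T<..})"
  proof (rule leibniz_rule_field_derivative)
    show "((\<lambda>x. f (x, \<theta>)) has_real_derivative ft (x, \<theta>)) (at x within {T<..})" if "x \<in> {T<..}" for x \<theta>
      by (rule has_partials_slice_fst[OF f]) (use that in auto)
    show "(\<lambda>\<theta>. f (x, \<theta>)) integrable_on cbox 0 (2 * pi)" if "x \<in> {T<..}" for x
      using circ_integrable[OF has_partials_continuous_on[OF f], of x] that by simp
    show "continuous_on ({T<..} \<times> cbox 0 (2 * pi)) (\<lambda>(x, t). ft (x, t))"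
      unfolding case_prod_unfold prod.collapse by (rule continuous_on_subset[OF ft]) auto
  qed (use t in auto)
  then show ?thesis
    using t at_within_open[of t "{T<..}"] by (simp add: circ_def[abs_def])
qed

lemma circ_angular_derivative:
  assumes f: "has_partials (cylinder T) f ft f\<theta>" and per: "periodic f" and t: "T < t"
  shows "circ f\<theta> t = 0"
proof -
  have "((\<lambda>\<theta>. f\<theta> (t, \<theta>)) has_integral (f (t, 2 * pi) - f (t, 0))) {0..2 * pi}"
    by (rule fundamental_theorem_of_calculus)
       (use t in \<open>auto simp flip: has_real_derivative_iff_has_vector_derivative intro!: has_partials_slice_snd[OF f]\<close>)
  moreover have "f (t, 2 * pi) = f (t, 0)" using per[unfolded periodic_def, rule_format, of t 0] by simp
  ultimately show ?thesis unfolding circ_def by (simp add: integral_unique)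
qed

text \<open>The integral of \<open>f g\<^sub>\<theta>\<close> is the signed area enclosed by the image of the circle under \<open>(f, g)\<close>. Its
derivative in \<open>t\<close> is the integral of the Jacobian, after the mixed derivative of \<open>g\<close> has been moved
onto \<open>f\<close> by integration by parts. The functions \<open>gt\<close> and \<open>g\<theta>\<close> stand for the derivatives of \<open>g\<close>, and
\<open>gt\<theta>\<close> for the mixed one. As \<open>f\<close> is differentiated only once, it may be a composition with a
function that has only one continuous derivative.\<close>

lemma area_derivative:
  assumes f: "has_partials (cylinder T) f ft f\<theta>" and g\<theta>: "has_partials (cylinder T) g\<theta> gt\<theta> x1"
    and gt: "has_partials (cylinder T) gt x2 gt\<theta>"
    and c: "continuous_on (cylinder T) ft" "continuous_on (cylinder T) f\<theta>" "continuous_on (cylinder T) gt\<theta>"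
    and per: "periodic f" "periodic gt" and t: "T < t"
  shows "(circ (\<lambda>z. f z * g\<theta> z) has_real_derivative circ (\<lambda>z. ft z * g\<theta> z - f\<theta> z * gt z) t) (at t)"
proof -
  note cc = c has_partials_continuous_on[OF f] has_partials_continuous_on[OF g\<theta>] has_partials_continuous_on[OF gt]
  have 1: "(circ (\<lambda>z. f z * g\<theta> z) has_real_derivative circ (\<lambda>z. ft z * g\<theta> z + f z * gt\<theta> z) t) (at t)"
    by (rule circ_derivative[OF has_partials_mult[OF f g\<theta>] _ t]) (intro continuous_intros cc)
  have 2: "circ (\<lambda>z. f\<theta> z * gt z + f z * gt\<theta> z) t = 0"
    by (rule circ_angular_derivative[OF has_partials_mult[OF f gt] _ t]) (use per in \<open>simp add: periodic_def\<close>)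
  have "circ (\<lambda>z. (ft z * g\<theta> z + f z * gt\<theta> z) - (f\<theta> z * gt z + f z * gt\<theta> z)) t
      = circ (\<lambda>z. ft z * g\<theta> z + f z * gt\<theta> z) t - 0"
    unfolding 2[symmetric] by (rule circ_diff[OF _ _ t]) (intro continuous_intros cc)+
  moreover have "(\<lambda>z. (ft z * g\<theta> z + f z * gt\<theta> z) - (f\<theta> z * gt z + f z * gt\<theta> z)) = (\<lambda>z. ft z * g\<theta> z - f\<theta> z * gt z)"
    by auto
  ultimately show ?thesis using 1 by simp
qed

lemma circ_wirtinger:
  assumes f: "has_partials (cylinder T) f ft f\<theta>" and c: "continuous_on (cylinder T) f\<theta>"
    and per: "periodic f" and k: "0 < k" "k < 1" and t: "T < t"
  shows "\<exists>c. k\<^sup>2 * circ (\<lambda>z. (f z - c)\<^sup>2) t \<le> circ (\<lambda>z. (f\<theta> z)\<^sup>2) t"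
  unfolding circ_def
  by (rule wirtinger[OF _ continuous_on_circle[OF c t] _ k])
     (use has_partials_slice_snd[OF f] t per in \<open>auto simp: periodic_def\<close>)

lemma circ_oscillation:
  assumes f: "has_partials (cylinder T) f ft f\<theta>" and c: "continuous_on (cylinder T) f\<theta>"
    and t: "T < t" and e: "e > 0" and xy: "x \<in> {0..2 * pi}" "y \<in> {0..2 * pi}"
  shows "\<bar>f (t, x) - f (t, y)\<bar> \<le> pi * e + circ (\<lambda>z. (f\<theta> z)\<^sup>2) t / (2 * e)"
  unfolding circ_def
  by (rule oscillation_le[OF _ continuous_on_circle[OF c t] xy e])
     (use has_partials_slice_snd[OF f] t in auto)

section \<open>Differential inequalities and maps with a Jacobian of one sign\<close>

lemma mono_from_derivative:
  fixes f f' :: "real \<Rightarrow> real"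
  assumes f: "\<And>t. T < t \<Longrightarrow> (f has_real_derivative f' t) (at t)" and pos: "\<And>t. T < t \<Longrightarrow> 0 \<le> f' t"
    and st: "T < s" "s \<le> t"
  shows "f s \<le> f t"
  by (rule DERIV_nonneg_imp_nondecreasing[OF st(2)]) (use f pos st in \<open>meson less_le_trans\<close>)

lemma antimono_from_derivative:
  fixes f f' :: "real \<Rightarrow> real"
  assumes f: "\<And>t. T < t \<Longrightarrow> (f has_real_derivative f' t) (at t)" and pos: "\<And>t. T < t \<Longrightarrow> f' t \<le> 0"
    and st: "T < s" "s \<le> t"
  shows "f t \<le> f s"
  by (rule DERIV_nonpos_imp_nonincreasing[OF st(2)]) (use f pos st in \<open>meson less_le_trans\<close>)

lemma exp_growth:
  fixes f f' :: "real \<Rightarrow> real"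
  assumes f: "\<And>t. T < t \<Longrightarrow> (f has_real_derivative f' t) (at t)" and gr: "\<And>t. T < t \<Longrightarrow> k * f t \<le> f' t"
    and st: "T < s" "s \<le> t"
  shows "f s * exp (k * (t - s)) \<le> f t"
proof -
  have "f s * exp (- k * s) \<le> f t * exp (- k * t)"
  proof (rule mono_from_derivative[OF _ _ st])
    fix x assume x: "T < x"
    show "((\<lambda>x. f x * exp (- k * x)) has_real_derivative (f' x - k * f x) * exp (- k * x)) (at x)"
      by (rule derivative_eq_intros refl f[OF x] | simp add: algebra_simps)+
    show "0 \<le> (f' x - k * f x) * exp (- k * x)" using gr[OF x] by simp
  qed
  then have "f s * exp (- k * s) * exp (k * t) \<le> f t * exp (- k * t) * exp (k * t)" by (rule mult_right_mono) simp
  then show ?thesis by (simp add: mult.assoc algebra_simps flip: exp_add)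
qed

lemma exp_decay:
  fixes f f' :: "real \<Rightarrow> real"
  assumes f: "\<And>t. T < t \<Longrightarrow> (f has_real_derivative f' t) (at t)" and gr: "\<And>t. T < t \<Longrightarrow> f' t \<le> - k * f t"
    and st: "T < s" "s \<le> t"
  shows "f t \<le> f s * exp (- k * (t - s))"
proof -
  have "(- f s) * exp ((- k) * (t - s)) \<le> - f t"
  proof (rule exp_growth[where f = "\<lambda>t. - f t", OF DERIV_minus[OF f] _ st])
    show "- k * - f x \<le> - f' x" if "T < x" for x using gr[OF that] by simp
  qed
  then show ?thesis by simp
qed

text \<open>Once negative, \<open>f\<close> would stay negative and \<open>1 / f\<close> would increase at a rate of at least \<open>c\<close>, so it
would reach 0 in finite time.\<close>

lemma riccati_nonneg:
  fixes f f' :: "real \<Rightarrow> real"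
  assumes f: "\<And>t. T < t \<Longrightarrow> (f has_real_derivative f' t) (at t)"
    and f'0: "\<And>t. T < t \<Longrightarrow> f' t \<le> 0"
    and f': "\<And>t. T < t \<Longrightarrow> f t < 0 \<Longrightarrow> f' t \<le> - c * (f t)\<^sup>2" and c: "c > 0" and t0: "T < t0"
  shows "0 \<le> f t0"
proof (rule ccontr)
  assume neg: "\<not> 0 \<le> f t0"
  have neg': "f t < 0" if "t0 \<le> t" for t
    using antimono_from_derivative[OF f f'0 t0 that] neg by simp
  have "t - t0 \<le> - inverse (f t0) / c" if t: "t0 < t" for t
  proof -
    have "inverse (f t0) - c * t0 \<le> inverse (f t) - c * t"
    proof (rule DERIV_nonneg_imp_nondecreasing[where f = "\<lambda>t. inverse (f t) - c * t"])
      fix x assume x: "t0 \<le> x" "x \<le> t"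
      have fx: "f x < 0" using neg'[of x] x by simp
      have "((\<lambda>t. inverse (f t) - c * t) has_real_derivative - (f' x * (inverse (f x))\<^sup>2) - c) (at x)"
        by (rule derivative_eq_intros refl f | use t0 x fx in \<open>simp add: power2_eq_square\<close>)+
      moreover have "0 \<le> - (f' x * (inverse (f x))\<^sup>2) - c"
      proof -
        have "f' x * (inverse (f x))\<^sup>2 \<le> (- c * (f x)\<^sup>2) * (inverse (f x))\<^sup>2"
          by (rule mult_right_mono[OF f']) (use t0 x fx in auto)
        also have "\<dots> = - c" using fx by (simp add: field_simps)
        finally show ?thesis by simp
      qed
      ultimately show "\<exists>y. ((\<lambda>t. inverse (f t) - c * t) has_real_derivative y) (at x) \<and> 0 \<le> y" by blast
    qed (use t in auto)
    moreover have "inverse (f t) < 0" using neg' t by simp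
    ultimately have "c * (t - t0) \<le> - inverse (f t0)" unfolding right_diff_distrib by linarith
    then show ?thesis unfolding pos_le_divide_eq[OF c] by (simp only: mult.commute)
  qed
  from this[of "t0 + \<bar>- inverse (f t0) / c\<bar> + 1"] show False by linarith
qed

lemma exp_neg_tendsto_0: "0 < a \<Longrightarrow> ((\<lambda>t::real. exp (- a * t)) \<longlongrightarrow> 0) at_top"
  by (rule filterlim_compose[OF exp_at_bot filterlim_tendsto_neg_mult_at_bot[OF tendsto_const _ filterlim_ident]]) simp

text \<open>The operator \<open>d\<^sup>2/dt\<^sup>2 - k\<^sup>2\<close> factors. The function \<open>z = q' + k q - N\<close> satisfies \<open>z' \<ge> k z\<close>; if it were ever
positive, it would grow like \<open>exp (k t)\<close>, and \<open>q\<close> with it, which is excluded since \<open>\<beta> < k\<close>. Hence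
\<open>q' + k q \<le> N\<close>, and \<open>q\<close> tends to 0 together with \<open>N\<close>. The inhomogeneity enters as the derivative of
\<open>N\<close>, so that an integral bound on it suffices.\<close>

lemma second_order_decay:
  fixes q q1 q2 N N' :: "real \<Rightarrow> real"
  assumes q: "\<And>t. T < t \<Longrightarrow> (q has_real_derivative q1 t) (at t)"
    and q1: "\<And>t. T < t \<Longrightarrow> (q1 has_real_derivative q2 t) (at t)"
    and N: "\<And>t. T < t \<Longrightarrow> (N has_real_derivative N' t) (at t)"
    and ineq: "\<And>t. T < t \<Longrightarrow> k\<^sup>2 * q t + N' t \<le> q2 t"
    and nonneg: "\<And>t. T < t \<Longrightarrow> 0 \<le> q t" "\<And>t. T < t \<Longrightarrow> 0 \<le> N t"
    and lim: "(N \<longlongrightarrow> 0) at_top"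
    and bound: "\<And>t. T < t \<Longrightarrow> q t \<le> K * exp (\<beta> * t)" and k: "0 < k" "\<beta> < k"
  shows "(q \<longlongrightarrow> 0) at_top"
proof -
  define z where "z = (\<lambda>t. q1 t + k * q t - N t)"
  have z': "(z has_real_derivative q2 t + k * q1 t - N' t) (at t)" if "T < t" for t
    unfolding z_def by (intro DERIV_diff DERIV_add DERIV_cmult q q1 N that)
  have zg: "k * z t \<le> q2 t + k * q1 t - N' t" if "T < t" for t
  proof -
    have "0 \<le> k * N t" using nonneg(2)[OF that] k by simp
    then show ?thesis using ineq[OF that] by (simp add: z_def algebra_simps power2_eq_square)
  qed
  have zle: "z s \<le> 0" if s: "T < s" for s
  proof (rule ccontr)
    assume "\<not> z s \<le> 0"
    then have zs: "z s > 0" by simp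
    define c where "c = z s * exp (- k * s)"
    have c: "c > 0" using zs by (simp add: c_def)
    have zlow: "c * exp (k * t) \<le> q1 t + k * q t" if "s \<le> t" for t
    proof -
      have "c * exp (k * t) = z s * exp (k * (t - s))" by (simp add: c_def algebra_simps flip: exp_add)
      also have "\<dots> \<le> z t" by (rule exp_growth[OF z' zg s that])
      also have "\<dots> \<le> q1 t + k * q t" using nonneg(2)[of t] s that by (simp add: z_def)
      finally show ?thesis .
    qed
    have qlow: "c / (2 * k) * exp (k * t) - c / (2 * k) * exp (2 * k * s) * exp (- k * t) \<le> q t" if t: "s \<le> t" for t
    proof -
      have "q s * exp (k * s) - c / (2 * k) * exp (2 * k * s) \<le> q t * exp (k * t) - c / (2 * k) * exp (2 * k * t)"
      proof (rule DERIV_nonneg_imp_nondecreasing[OF t])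
        fix x assume x: "s \<le> x" "x \<le> t"
        have "((\<lambda>t. q t * exp (k * t) - c / (2 * k) * exp (2 * k * t)) has_real_derivative
            (q1 x + k * q x) * exp (k * x) - c * exp (2 * k * x)) (at x)"
          by (rule derivative_eq_intros refl q | use s x k in \<open>simp add: algebra_simps\<close>)+
        moreover have "c * exp (k * x) * exp (k * x) \<le> (q1 x + k * q x) * exp (k * x)"
          by (rule mult_right_mono[OF zlow]) (use x in auto)
        moreover have "exp (k * x) * exp (k * x) = exp (2 * k * x)" by (simp flip: exp_add)
        ultimately show "\<exists>y. ((\<lambda>t. q t * exp (k * t) - c / (2 * k) * exp (2 * k * t)) has_real_derivative y) (at x) \<and> 0 \<le> y"
          by (intro exI conjI) (auto simp: mult.assoc)
      qed
      moreover have "0 \<le> q s * exp (k * s)" using nonneg(1)[OF s] by simp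
      ultimately have "c / (2 * k) * exp (2 * k * t) - c / (2 * k) * exp (2 * k * s) \<le> q t * exp (k * t)" by linarith
      then have "(c / (2 * k) * exp (2 * k * t) - c / (2 * k) * exp (2 * k * s)) * exp (- k * t) \<le> q t * exp (k * t) * exp (- k * t)"
        by (rule mult_right_mono) simp
      then show ?thesis by (simp add: left_diff_distrib mult.assoc flip: exp_add)
    qed
    define d where "d = c / (2 * k)"
    have d: "d > 0" using c k by (simp add: d_def)
    have ev: "d \<le> d * exp (2 * k * s) * exp (- (2 * k) * t) + K * exp (- (k - \<beta>) * t)" if t: "s \<le> t" for t
    proof -
      have "d * exp (k * t) \<le> d * exp (2 * k * s) * exp (- k * t) + K * exp (\<beta> * t)"
        using qlow[OF t] bound[of t] s t by (simp add: d_def)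
      then have "d * exp (k * t) * exp (- k * t) \<le> (d * exp (2 * k * s) * exp (- k * t) + K * exp (\<beta> * t)) * exp (- k * t)"
        by (rule mult_right_mono) simp
      then show ?thesis by (simp add: distrib_right mult.assoc algebra_simps flip: exp_add)
    qed
    have "((\<lambda>t. d * exp (2 * k * s) * exp (- (2 * k) * t) + K * exp (- (k - \<beta>) * t)) \<longlongrightarrow> d * exp (2 * k * s) * 0 + K * 0) at_top"
      by (intro tendsto_add tendsto_mult tendsto_const exp_neg_tendsto_0) (use k in auto)
    then have "d \<le> d * exp (2 * k * s) * 0 + K * 0"
      by (rule tendsto_lowerbound) (use ev in \<open>auto intro: eventually_mono[OF eventually_ge_at_top[of s]]\<close>)
    with d show False by simp
  qed
  show ?thesis
  proof (rule tendstoI)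
    fix e :: real assume e: "e > 0"
    define \<eta> where "\<eta> = e * k / 2"
    have \<eta>: "\<eta> > 0" using e k by (simp add: \<eta>_def)
    obtain s where s: "s > T" "\<And>t. s \<le> t \<Longrightarrow> N t < \<eta>"
    proof -
      obtain s0 where "\<And>t. s0 \<le> t \<Longrightarrow> N t < \<eta>"
        using order_tendstoD(2)[OF lim \<eta>] unfolding eventually_at_top_linorder by blast
      then show ?thesis by (intro that[of "max s0 (T + 1)"]) auto
    qed
    have up: "q t \<le> \<eta> / k + (q s - \<eta> / k) * exp (- k * (t - s))" if t: "s \<le> t" for t
    proof -
      have "(q t - \<eta> / k) * exp (k * t) \<le> (q s - \<eta> / k) * exp (k * s)"
      proof (rule DERIV_nonpos_imp_nonincreasing[OF t])
        fix x assume x: "s \<le> x" "x \<le> t"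
        have "((\<lambda>t. (q t - \<eta> / k) * exp (k * t)) has_real_derivative (q1 x + k * q x - \<eta>) * exp (k * x)) (at x)"
          by (rule derivative_eq_intros refl q | use s x k in \<open>simp add: algebra_simps\<close>)+
        moreover have "q1 x + k * q x - \<eta> \<le> 0" using zle[of x] s(2)[of x] s(1) x by (simp add: z_def)
        ultimately show "\<exists>y. ((\<lambda>t. (q t - \<eta> / k) * exp (k * t)) has_real_derivative y) (at x) \<and> y \<le> 0"
          by (meson exp_ge_zero mult_nonpos_nonneg)
      qed
      then have "(q t - \<eta> / k) * exp (k * t) * exp (- k * t) \<le> (q s - \<eta> / k) * exp (k * s) * exp (- k * t)"
        by (rule mult_right_mono) simp
      then show ?thesis by (simp add: mult.assoc algebra_simps flip: exp_add)
    qed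
    have "((\<lambda>t. exp (k * s) * exp (- k * t)) \<longlongrightarrow> exp (k * s) * 0) at_top"
      by (intro tendsto_mult tendsto_const exp_neg_tendsto_0 k)
    then have e0: "((\<lambda>t. exp (- k * (t - s))) \<longlongrightarrow> 0) at_top"
      by (simp add: algebra_simps flip: exp_add)
    have "((\<lambda>t. \<eta> / k + (q s - \<eta> / k) * exp (- k * (t - s))) \<longlongrightarrow> \<eta> / k + (q s - \<eta> / k) * 0) at_top"
      by (intro tendsto_add tendsto_mult tendsto_const e0)
    moreover have "\<eta> / k + (q s - \<eta> / k) * 0 < e" using e k by (simp add: \<eta>_def)
    ultimately have "eventually (\<lambda>t. \<eta> / k + (q s - \<eta> / k) * exp (- k * (t - s)) < e) at_top"
      by (rule order_tendstoD(2))
    then show "eventually (\<lambda>t. dist (q t) 0 < e) at_top"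
      using eventually_ge_at_top[of s]
    proof eventually_elim
      case (elim t)
      then show ?case using up[of t] nonneg(1)[of t] s(1) by simp
    qed
  qed
qed

lemma DERIV_times_abs: "((\<lambda>x::real. x * \<bar>x\<bar>) has_real_derivative 2 * \<bar>x\<bar>) (at x)"
proof (cases x "0::real" rule: linorder_cases)
  case less
  have "((\<lambda>x::real. - (x * x)) has_real_derivative 2 * \<bar>x\<bar>) (at x)"
    by (rule derivative_eq_intros refl | use less in simp)+
  then show ?thesis
    by (rule has_field_derivative_transform_within_open[where S = "{..<0}"]) (use less in auto)
next
  case greater
  have "((\<lambda>x::real. x * x) has_real_derivative 2 * \<bar>x\<bar>) (at x)"
    by (rule derivative_eq_intros refl | use greater in simp)+
  then show ?thesis
    by (rule has_field_derivative_transform_within_open[where S = "{0<..}"]) (use greater in auto)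
next
  case equal
  have "((\<lambda>h::real. \<bar>h\<bar>) \<longlongrightarrow> \<bar>0\<bar>) (at 0)" by (intro tendsto_intros)
  moreover have "eventually (\<lambda>h::real. \<bar>h\<bar> = h * \<bar>h\<bar> / h) (at 0)"
    by (simp add: eventually_at_filter)
  ultimately have "((\<lambda>h::real. h * \<bar>h\<bar> / h) \<longlongrightarrow> \<bar>0\<bar>) (at 0)"
    by (rule Lim_transform_eventually)
  then show ?thesis by (simp add: equal DERIV_def)
qed

text \<open>A component of a map with a Jacobian of one sign has no interior maximum. With \<open>\<Phi>\<close> twice the
square of the positive part of \<open>u - s\<close>, the signed area of \<open>(\<Phi> \<circ> f, g)\<close> vanishes on both boundary
circles, and its derivative has one sign; so the Jacobian vanishes wherever \<open>f > s\<close>, where \<open>f\<close> is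
then constant along \<open>t\<close>.\<close>

lemma jacobian_max_principle:
  fixes f ft f\<theta> g\<theta> gt gt\<theta> x1 x2 :: "real \<times> real \<Rightarrow> real"
  assumes f: "has_partials (cylinder T) f ft f\<theta>" and g\<theta>: "has_partials (cylinder T) g\<theta> gt\<theta> x1"
    and gt: "has_partials (cylinder T) gt x2 gt\<theta>"
    and c: "continuous_on (cylinder T) ft" "continuous_on (cylinder T) f\<theta>" "continuous_on (cylinder T) gt\<theta>"
    and per: "periodic f" "periodic gt"
    and jac: "\<And>z. z \<in> cylinder T \<Longrightarrow> ft z * g\<theta> z - f\<theta> z * gt z \<le> 0"
    and jac0: "\<And>z. z \<in> cylinder T \<Longrightarrow> ft z * g\<theta> z - f\<theta> z * gt z = 0 \<Longrightarrow> ft z = 0"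
    and t: "T < t1" "t1 < t2"
    and bd: "\<And>\<theta>. \<theta> \<in> {0..2 * pi} \<Longrightarrow> f (t1, \<theta>) \<le> s" "\<And>\<theta>. \<theta> \<in> {0..2 * pi} \<Longrightarrow> f (t2, \<theta>) \<le> s"
    and x: "t1 \<le> t" "t \<le> t2" "\<theta> \<in> {0..2 * pi}"
  shows "f (t, \<theta>) \<le> s"
proof -
  define \<Phi> \<phi> where "\<Phi> = (\<lambda>u::real. (u - s)\<^sup>2 + (u - s) * \<bar>u - s\<bar>)" and "\<phi> = (\<lambda>u::real. 2 * (u - s) + 2 * \<bar>u - s\<bar>)"
  have \<Phi>: "(\<Phi> has_real_derivative \<phi> u) (at u)" for u
  proof -
    have "((\<lambda>u. u - s) has_real_derivative 1) (at u)" by (auto intro!: derivative_eq_intros)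
    from DERIV_chain2[OF DERIV_times_abs this]
    have "((\<lambda>u. (u - s) * \<bar>u - s\<bar>) has_real_derivative 2 * \<bar>u - s\<bar>) (at u)" by simp
    moreover have "((\<lambda>u. (u - s)\<^sup>2) has_real_derivative 2 * (u - s)) (at u)"
      by (auto intro!: derivative_eq_intros)
    ultimately show ?thesis unfolding \<Phi>_def \<phi>_def by (intro DERIV_add)
  qed
  have \<phi>0: "\<phi> u \<ge> 0" for u by (cases "s \<le> u") (simp_all add: \<phi>_def)
  have \<phi>c: "continuous_on X (\<lambda>z. \<phi> (f z))" if "X \<subseteq> cylinder T" for X
    unfolding \<phi>_def by (intro continuous_intros continuous_on_subset[OF has_partials_continuous_on[OF f] that])
  have \<Phi>0: "\<Phi> u = 0 \<longleftrightarrow> u \<le> s" for u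
  proof (cases "s \<le> u")
    case True
    then have "\<Phi> u = 2 * (u - s)\<^sup>2" by (simp add: \<Phi>_def power2_eq_square)
    then show ?thesis using True by auto
  next
    case False
    then have "\<bar>u - s\<bar> = - (u - s)" by simp
    then have "\<Phi> u = (u - s)\<^sup>2 - (u - s) * (u - s)" unfolding \<Phi>_def by (simp add: algebra_simps)
    then show ?thesis using False by (simp add: power2_eq_square)
  qed
  have \<Phi>f: "has_partials (cylinder T) (\<lambda>z. \<Phi> (f z)) (\<lambda>z. \<phi> (f z) * ft z) (\<lambda>z. \<phi> (f z) * f\<theta> z)"
    by (rule has_partials_chain[OF f \<Phi>])
  define G where "G = circ (\<lambda>z. \<Phi> (f z) * g\<theta> z)"
  define j where "j = (\<lambda>z. \<phi> (f z) * (ft z * g\<theta> z - f\<theta> z * gt z))"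
  note cc = c has_partials_continuous_on[OF f] has_partials_continuous_on[OF g\<theta>] has_partials_continuous_on[OF gt] \<phi>c[OF subset_refl]
  have jc: "continuous_on (cylinder T) j" unfolding j_def by (intro continuous_intros cc)
  have G': "(G has_real_derivative circ j t) (at t)" if "T < t" for t
  proof -
    have "(G has_real_derivative circ (\<lambda>z. \<phi> (f z) * ft z * g\<theta> z - \<phi> (f z) * f\<theta> z * gt z) t) (at t)"
      unfolding G_def
      by (rule area_derivative[OF \<Phi>f g\<theta> gt _ _ c(3) _ per(2) that])
         (use per in \<open>auto intro!: continuous_intros cc simp: periodic_def\<close>)
    moreover have "(\<lambda>z. \<phi> (f z) * ft z * g\<theta> z - \<phi> (f z) * f\<theta> z * gt z) = j" by (auto simp: j_def algebra_simps)
    ultimately show ?thesis by simp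
  qed
  have j0: "j z \<le> 0" if "z \<in> cylinder T" for z
    unfolding j_def by (intro mult_nonneg_nonpos \<phi>0 jac that)
  have circj: "circ j t \<le> 0" if "T < t" for t
    using circ_mono[OF jc _ that, of "\<lambda>z. 0"] j0 that by (simp add: circ_const)
  have Gend: "G t1 = 0" "G t2 = 0"
  proof -
    have "G t = integral {0..2 * pi} (\<lambda>\<theta>. 0)" if "\<And>\<theta>. \<theta> \<in> {0..2 * pi} \<Longrightarrow> f (t, \<theta>) \<le> s" for t
    proof -
      have "\<Phi> (f (t, \<theta>)) = 0" if "\<theta> \<in> {0..2 * pi}" for \<theta>
        using \<Phi>0 \<open>\<And>\<theta>. \<theta> \<in> {0..2 * pi} \<Longrightarrow> f (t, \<theta>) \<le> s\<close>[OF that] by blast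
      then show ?thesis unfolding G_def circ_def by (intro integral_cong) simp
    qed
    then show "G t1 = 0" "G t2 = 0" using bd by simp_all
  qed
  have G0: "G x = 0" if "t1 \<le> x" "x \<le> t2" for x
    using antimono_from_derivative[OF G' circj t(1) that(1)] antimono_from_derivative[OF G' circj _ that(2)] t that Gend
    by force
  have cj0: "circ j x = 0" if "t1 < x" "x < t2" for x
  proof -
    have "(G has_real_derivative 0) (at x)"
      by (rule has_field_derivative_transform_within_open[OF DERIV_const[of 0], of "{t1<..<t2}"])
         (use G0 that in auto)
    moreover have "T < x" using t that by simp
    ultimately show ?thesis using DERIV_unique[OF G'] by blast
  qed
  have jz: "j (x, \<theta>) = 0" if "t1 < x" "x < t2" "\<theta> \<in> {0..2 * pi}" for x \<theta>
  proof -
    have Tx: "T < x" using t that by simp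
    have "((\<lambda>\<theta>. - j (x, \<theta>)) has_integral 0) (cbox 0 (2 * pi))"
      using has_integral_neg[OF integrable_integral[OF circ_integrable[OF jc Tx]]] cj0[OF that(1,2)]
      unfolding circ_def by simp
    then have "- j (x, \<theta>) = 0"
      by (rule has_integral_0_cbox_imp_0[rotated 2])
         (use that j0 Tx in \<open>auto simp: pi_gt_zero[THEN not_le[THEN iffD2]] intro!: continuous_intros continuous_on_circle[OF jc Tx]\<close>)
    then show ?thesis by simp
  qed
  have "((\<lambda>t. \<Phi> (f (t, \<theta>))) has_real_derivative 0) (at y)" if "t1 < y" "y < t2" for y
  proof -
    have yc: "(y, \<theta>) \<in> cylinder T" using that t by auto
    have "\<phi> (f (y, \<theta>)) * ft (y, \<theta>) = 0"
      using jz[OF that x(3)] jac0[OF yc] by (auto simp: j_def)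
    with has_partials_slice_fst[OF \<Phi>f yc, of UNIV] show ?thesis by simp
  qed
  moreover have "continuous_on {t1..t2} (\<lambda>t. \<Phi> (f (t, \<theta>)))"
    by (rule continuous_on_compose2[OF has_partials_continuous_on[OF \<Phi>f]]) (use t in \<open>auto intro!: continuous_intros\<close>)
  ultimately have "\<Phi> (f (t, \<theta>)) = \<Phi> (f (t1, \<theta>))"
    using DERIV_isconst2[OF t(2), of "\<lambda>t. \<Phi> (f (t, \<theta>))" t] x by auto
  moreover have "\<Phi> (f (t1, \<theta>)) = 0" using \<Phi>0 bd(1)[OF x(3)] by blast
  ultimately have "\<Phi> (f (t, \<theta>)) = 0" by (rule trans)
  then show ?thesis using \<Phi>0 by blast
qed

section \<open>Solutions near infinity\<close>

text \<open>\<open>D i j\<close> is the derivative of order \<open>i\<close> in \<open>x\<close> and \<open>j\<close> in \<open>y\<close> of a function near infinity. The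
assumptions in \<open>small\<close> follow from \<open>decay\<close> when \<open>R\<close> is large enough; the bound 1/400 makes the
gradient almost conformal, so that the rates below are close to those of a harmonic function.\<close>

locale exterior_solution =
  fixes D :: "nat \<Rightarrow> nat \<Rightarrow> real \<times> real \<Rightarrow> real" and R C :: real
  assumes R: "0 < R" and C: "0 \<le> C"
    and partials: "\<And>i j. has_partials {p. R < norm p} (D i j) (D (Suc i) j) (D i (Suc j))"
    and laplace: "\<And>p. R < norm p \<Longrightarrow> (D 2 0 p + D 0 2 p)\<^sup>2
      \<le> C * ((D 1 0 p)\<^sup>2 + (D 0 1 p)\<^sup>2) * ((D 2 0 p)\<^sup>2 + 2 * (D 1 1 p)\<^sup>2 + (D 0 2 p)\<^sup>2)"
    and small: "\<And>p. R < norm p \<Longrightarrow> (D 1 0 p)\<^sup>2 + (D 0 1 p)\<^sup>2 \<le> 1"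
      "\<And>p. R < norm p \<Longrightarrow> C * ((D 1 0 p)\<^sup>2 + (D 0 1 p)\<^sup>2) \<le> 1 / 400"
    and decay: "(D 1 0 \<longlongrightarrow> 0) at_infinity" "(D 0 1 \<longlongrightarrow> 0) at_infinity"
begin

definition T :: real where "T = ln R"

text \<open>The point with logarithmic polar coordinates \<open>z\<close> is \<open>(ec z, es z)\<close>; each of the two functions is,
up to sign, the angular derivative of the other and its own radial derivative.\<close>

definition ec :: "real \<times> real \<Rightarrow> real" where "ec z = exp (fst z) * cos (snd z)"
definition es :: "real \<times> real \<Rightarrow> real" where "es z = exp (fst z) * sin (snd z)"

definition E :: "nat \<Rightarrow> nat \<Rightarrow> real \<times> real \<Rightarrow> real" where "E i j z = D i j (ec z, es z)"

lemma ec_es_sq: "(ec z)\<^sup>2 + (es z)\<^sup>2 = exp (2 * fst z)"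
proof -
  have "(ec z)\<^sup>2 + (es z)\<^sup>2 = (exp (fst z))\<^sup>2 * ((cos (snd z))\<^sup>2 + (sin (snd z))\<^sup>2)"
    unfolding ec_def es_def by (simp only: power_mult_distrib distrib_left)
  then show ?thesis by (simp add: exp_double)
qed

lemma norm_polar: "norm (ec z, es z) = exp (fst z)"
proof -
  have "(norm (ec z, es z))\<^sup>2 = (exp (fst z))\<^sup>2"
    unfolding norm_sq_coords using ec_es_sq[of z] by (simp add: exp_double)
  then show ?thesis by (simp add: power2_eq_iff_nonneg)
qed

lemma polar_outside: "z \<in> cylinder T \<Longrightarrow> R < norm (ec z, es z)"
proof -
  assume "z \<in> cylinder T"
  then have "exp (ln R) < exp (fst z)" by (auto simp: T_def)
  then show ?thesis using R by (simp add: norm_polar)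
qed

lemma partials_ec: "has_partials U ec ec (\<lambda>z. - es z)"
  and partials_es: "has_partials U es es ec"
  unfolding has_partials_def ec_def[abs_def] es_def[abs_def]
  by (auto intro!: derivative_eq_intros simp: algebra_simps)

lemma partials_E:
  "has_partials (cylinder T) (E i j) (\<lambda>z. E (Suc i) j z * ec z + E i (Suc j) z * es z)
     (\<lambda>z. E i (Suc j) z * ec z - E (Suc i) j z * es z)"
  unfolding E_def[abs_def]
  by (rule has_partials_rhs[OF has_partials_compose[OF partials partials_ec partials_es]])
     (use polar_outside in auto)

text \<open>The functions on the cylinder that occur below form an algebra that is closed under
differentiation. Membership gives continuity, periodicity and smoothness at once.\<close>

inductive cylfun :: "(real \<times> real \<Rightarrow> real) \<Rightarrow> bool" where
  E: "cylfun (E i j)"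
| ec: "cylfun ec"
| es: "cylfun es"
| const: "cylfun (\<lambda>z. c)"
| add: "cylfun f \<Longrightarrow> cylfun g \<Longrightarrow> cylfun (\<lambda>z. f z + g z)"
| diff: "cylfun f \<Longrightarrow> cylfun g \<Longrightarrow> cylfun (\<lambda>z. f z - g z)"
| mult: "cylfun f \<Longrightarrow> cylfun g \<Longrightarrow> cylfun (\<lambda>z. f z * g z)"

lemma cylfun_uminus: "cylfun f \<Longrightarrow> cylfun (\<lambda>z. - f z)"
  using cylfun.diff[OF cylfun.const[of 0]] by simp

lemma cylfun_power2: "cylfun f \<Longrightarrow> cylfun (\<lambda>z. (f z)\<^sup>2)"
  unfolding power2_eq_square by (rule cylfun.mult)

lemmas cylfun_intros = cylfun.intros cylfun_uminus cylfun_power2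

lemma cylfun_partials:
  "cylfun f \<Longrightarrow> \<exists>ft f\<theta>. cylfun ft \<and> cylfun f\<theta> \<and> has_partials (cylinder T) f ft f\<theta>"
proof (induction rule: cylfun.induct)
  case (E i j)
  then show ?case by (intro exI conjI; (rule partials_E)?) (intro cylfun_intros)+
next
  case ec
  then show ?case by (intro exI conjI; (rule partials_ec)?) (intro cylfun_intros)+
next
  case es
  then show ?case by (intro exI conjI; (rule partials_es)?) (intro cylfun_intros)+
next
  case (const c)
  then show ?case by (intro exI conjI; (rule has_partials_const)?) (intro cylfun_intros)+
next
  case (add f g)
  then obtain ft fs gt gs where *: "cylfun ft" "cylfun fs" "has_partials (cylinder T) f ft fs"
    "cylfun gt" "cylfun gs" "has_partials (cylinder T) g gt gs" by blast
  from has_partials_add[OF *(3,6)] show ?case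
    by (intro exI conjI; assumption?) (intro cylfun_intros *)+
next
  case (diff f g)
  then obtain ft fs gt gs where *: "cylfun ft" "cylfun fs" "has_partials (cylinder T) f ft fs"
    "cylfun gt" "cylfun gs" "has_partials (cylinder T) g gt gs" by blast
  from has_partials_diff[OF *(3,6)] show ?case
    by (intro exI conjI; assumption?) (intro cylfun_intros *)+
next
  case (mult f g)
  then obtain ft fs gt gs where *: "cylfun ft" "cylfun fs" "has_partials (cylinder T) f ft fs"
    "cylfun gt" "cylfun gs" "has_partials (cylinder T) g gt gs" by blast
  from has_partials_mult[OF *(3,6)] show ?case
    by (intro exI conjI; assumption?) (intro cylfun_intros * mult)+
qed

lemma cylfun_continuous: "cylfun f \<Longrightarrow> continuous_on (cylinder T) f"
  using cylfun_partials has_partials_continuous_on by blast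

lemma cylfun_periodic: "cylfun f \<Longrightarrow> periodic f"
proof -
  have "cylfun f \<Longrightarrow> \<forall>t \<theta>. f (t, \<theta> + 2 * pi) = f (t, \<theta>)"
    by (induction rule: cylfun.induct) (auto simp: E_def ec_def es_def)
  then show "cylfun f \<Longrightarrow> periodic f" by (simp add: periodic_def)
qed

lemma cylfun_mixed:
  assumes g: "has_partials (cylinder T) g gt g\<theta>" and c: "cylfun gt" "cylfun g\<theta>"
  obtains x1 x2 gt\<theta> where "has_partials (cylinder T) g\<theta> gt\<theta> x1" "has_partials (cylinder T) gt x2 gt\<theta>" "cylfun gt\<theta>"
proof -
  obtain a b where ab: "cylfun b" "has_partials (cylinder T) gt a b" using cylfun_partials[OF c(1)] by blast
  obtain d e where de: "cylfun d" "has_partials (cylinder T) g\<theta> d e" using cylfun_partials[OF c(2)] by blast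
  have "b z = d z" if "z \<in> cylinder T" for z
    by (rule mixed_partials_commute[OF _ that g ab(2) de(2)]) (intro open_Times open_greaterThan open_UNIV)
  then have "has_partials (cylinder T) gt a d" by (intro has_partials_rhs[OF ab(2)]) auto
  with de show ?thesis by (intro that)
qed

lemma cylfun_area_derivative:
  assumes f: "has_partials (cylinder T) f ft f\<theta>" and g: "has_partials (cylinder T) g gt g\<theta>"
    and c: "cylfun f" "cylfun ft" "cylfun f\<theta>" "cylfun gt" "cylfun g\<theta>" and t: "T < t"
  shows "(circ (\<lambda>z. f z * g\<theta> z) has_real_derivative circ (\<lambda>z. ft z * g\<theta> z - f\<theta> z * gt z) t) (at t)"
proof -
  obtain x1 x2 gt\<theta> where *: "has_partials (cylinder T) g\<theta> gt\<theta> x1" "has_partials (cylinder T) gt x2 gt\<theta>" "cylfun gt\<theta>"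
    using cylfun_mixed[OF g c(4,5)] by blast
  show ?thesis
    by (rule area_derivative[OF f *(1,2)]) (intro cylfun_continuous cylfun_periodic c *(3) t)+
qed

lemma circ_mono': "cylfun f \<Longrightarrow> cylfun g \<Longrightarrow> T < t \<Longrightarrow> (\<And>\<theta>. f (t, \<theta>) \<le> g (t, \<theta>)) \<Longrightarrow> circ f t \<le> circ g t"
  by (rule circ_mono[OF cylfun_continuous cylfun_continuous])

abbreviation (input) "w \<equiv> E 0 0"
abbreviation (input) "p \<equiv> E (Suc 0) 0"
abbreviation (input) "q \<equiv> E 0 (Suc 0)"
abbreviation (input) "wxx \<equiv> E (Suc (Suc 0)) 0"
abbreviation (input) "wxy \<equiv> E (Suc 0) (Suc 0)"
abbreviation (input) "wyy \<equiv> E 0 (Suc (Suc 0))"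

text \<open>Derivatives of the gradient \<open>(p, q)\<close> in the direction of \<open>t\<close> and of \<open>\<theta>\<close>.\<close>

definition pt where "pt z = wxx z * ec z + wxy z * es z"
definition p\<theta> where "p\<theta> z = wxy z * ec z - wxx z * es z"
definition qt where "qt z = wxy z * ec z + wyy z * es z"
definition q\<theta> where "q\<theta> z = wyy z * ec z - wxy z * es z"

lemma partials_p: "has_partials (cylinder T) p pt p\<theta>"
  and partials_q: "has_partials (cylinder T) q qt q\<theta>"
  using partials_E[of "Suc 0" 0] partials_E[of 0 "Suc 0"]
  by (simp_all add: pt_def[abs_def] p\<theta>_def[abs_def] qt_def[abs_def] q\<theta>_def[abs_def])

lemma cylfun_pq: "cylfun pt" "cylfun p\<theta>" "cylfun qt" "cylfun q\<theta>"
  unfolding pt_def[abs_def] p\<theta>_def[abs_def] qt_def[abs_def] q\<theta>_def[abs_def]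
  by (intro cylfun_intros)+

text \<open>Minus the Jacobian of \<open>(p, q)\<close> with respect to \<open>(t, \<theta>)\<close>, and the squared size of the Hessian in
the same scaling. As the Laplacian is small compared with the Hessian, \<open>nJ\<close> is close to \<open>H2 / 2\<close>.\<close>

definition nJ where "nJ z = ((ec z)\<^sup>2 + (es z)\<^sup>2) * ((wxy z)\<^sup>2 - wxx z * wyy z)"
definition H2 where "H2 z = ((ec z)\<^sup>2 + (es z)\<^sup>2) * ((wxx z)\<^sup>2 + 2 * (wxy z)\<^sup>2 + (wyy z)\<^sup>2)"

lemma cylfun_nJ: "cylfun nJ"
  unfolding nJ_def[abs_def] by (intro cylfun_intros)

lemma area_form: "pt z * q\<theta> z - p\<theta> z * qt z = - nJ z"
  unfolding pt_def p\<theta>_def qt_def q\<theta>_def nJ_def by algebra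

lemma laplace_E:
  assumes z: "z \<in> cylinder T"
  shows "(wxx z + wyy z)\<^sup>2 \<le> C * ((p z)\<^sup>2 + (q z)\<^sup>2) * ((wxx z)\<^sup>2 + 2 * (wxy z)\<^sup>2 + (wyy z)\<^sup>2)"
    "(p z)\<^sup>2 + (q z)\<^sup>2 \<le> 1" "C * ((p z)\<^sup>2 + (q z)\<^sup>2) \<le> 1 / 400"
    "(wxx z + wyy z)\<^sup>2 \<le> ((wxx z)\<^sup>2 + 2 * (wxy z)\<^sup>2 + (wyy z)\<^sup>2) / 400"
proof -
  note z' = polar_outside[OF z]
  show 1: "(wxx z + wyy z)\<^sup>2 \<le> C * ((p z)\<^sup>2 + (q z)\<^sup>2) * ((wxx z)\<^sup>2 + 2 * (wxy z)\<^sup>2 + (wyy z)\<^sup>2)"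
    using laplace[OF z'] by (simp add: E_def numeral_2_eq_2)
  show "(p z)\<^sup>2 + (q z)\<^sup>2 \<le> 1" and 2: "C * ((p z)\<^sup>2 + (q z)\<^sup>2) \<le> 1 / 400"
    using small[OF z'] by (simp_all add: E_def numeral_2_eq_2)
  have "C * ((p z)\<^sup>2 + (q z)\<^sup>2) * ((wxx z)\<^sup>2 + 2 * (wxy z)\<^sup>2 + (wyy z)\<^sup>2)
     \<le> 1 / 400 * ((wxx z)\<^sup>2 + 2 * (wxy z)\<^sup>2 + (wyy z)\<^sup>2)"
    by (rule mult_right_mono[OF 2]) simp
  with 1 show "(wxx z + wyy z)\<^sup>2 \<le> ((wxx z)\<^sup>2 + 2 * (wxy z)\<^sup>2 + (wyy z)\<^sup>2) / 400" by simp
qed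

lemma H2_le: assumes z: "z \<in> cylinder T" shows "399 / 800 * H2 z \<le> nJ z" "H2 z \<le> 3 * nJ z" "0 \<le> H2 z" "0 \<le> nJ z"
proof -
  let ?K = "(wxx z)\<^sup>2 + 2 * (wxy z)\<^sup>2 + (wyy z)\<^sup>2"
  define K where "K = ?K"
  have "K = (wxx z + wyy z)\<^sup>2 + 2 * (wxy z)\<^sup>2 - 2 * (wxx z * wyy z)"
    by (simp add: K_def power2_eq_square algebra_simps)
  moreover have "(wxx z + wyy z)\<^sup>2 \<le> K / 400" using laplace_E(4)[OF z] by (simp only: K_def)
  ultimately have "399 / 800 * K \<le> (wxy z)\<^sup>2 - wxx z * wyy z" by linarith
  then have K: "399 / 800 * ?K \<le> (wxy z)\<^sup>2 - wxx z * wyy z" by (simp only: K_def)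
  have "((ec z)\<^sup>2 + (es z)\<^sup>2) * (399 / 800 * ?K) \<le> nJ z"
    unfolding nJ_def by (rule mult_left_mono[OF K]) simp
  then show 1: "399 / 800 * H2 z \<le> nJ z" unfolding H2_def by (simp only: mult.left_commute)
  show 2: "0 \<le> H2 z" unfolding H2_def by simp
  show "H2 z \<le> 3 * nJ z" "0 \<le> nJ z" using 1 2 by linarith+
qed

lemma radial_le: assumes z: "z \<in> cylinder T" shows "(pt z)\<^sup>2 \<le> 3 * nJ z" "(qt z)\<^sup>2 \<le> 3 * nJ z"
proof -
  have cs: "(a * ec z + b * es z)\<^sup>2 \<le> ((ec z)\<^sup>2 + (es z)\<^sup>2) * (a\<^sup>2 + b\<^sup>2)" for a b
  proof -
    have "((ec z)\<^sup>2 + (es z)\<^sup>2) * (a\<^sup>2 + b\<^sup>2) = (a * ec z + b * es z)\<^sup>2 + (a * es z - b * ec z)\<^sup>2" by algebra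
    then show ?thesis by simp
  qed
  have "(pt z)\<^sup>2 \<le> ((ec z)\<^sup>2 + (es z)\<^sup>2) * ((wxx z)\<^sup>2 + (wxy z)\<^sup>2)" unfolding pt_def by (rule cs)
  also have "\<dots> \<le> H2 z" unfolding H2_def by (rule mult_left_mono) auto
  finally show "(pt z)\<^sup>2 \<le> 3 * nJ z" using H2_le(2)[OF z] by linarith
  have "(qt z)\<^sup>2 \<le> ((ec z)\<^sup>2 + (es z)\<^sup>2) * ((wxy z)\<^sup>2 + (wyy z)\<^sup>2)" unfolding qt_def by (rule cs)
  also have "\<dots> \<le> H2 z" unfolding H2_def by (rule mult_left_mono) auto
  finally show "(qt z)\<^sup>2 \<le> 3 * nJ z" using H2_le(2)[OF z] by linarith
qed

text \<open>For a harmonic function \<open>p\<^sub>\<theta>\<^sup>2 + q\<^sub>\<theta>\<^sup>2 = nJ\<close>. In general the Cayley-Hamilton theorem for the Hessian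
leaves the error \<open>?h * ?Q\<close>, with \<open>?h\<close> the Laplacian and \<open>?Q\<close> the Hessian form in the angular
direction; it is at most \<open>H2 / 20\<close>.\<close>

lemma angular_le: assumes z: "z \<in> cylinder T" shows "(p\<theta> z)\<^sup>2 + (q\<theta> z)\<^sup>2 \<le> 9 / 8 * nJ z"
proof -
  let ?K = "(wxx z)\<^sup>2 + 2 * (wxy z)\<^sup>2 + (wyy z)\<^sup>2" and ?h = "wxx z + wyy z"
  let ?Q = "wxx z * (es z)\<^sup>2 - 2 * wxy z * ec z * es z + wyy z * (ec z)\<^sup>2"
  let ?r = "(ec z)\<^sup>2 + (es z)\<^sup>2"
  have id: "(p\<theta> z)\<^sup>2 + (q\<theta> z)\<^sup>2 = nJ z + ?h * ?Q"
    unfolding p\<theta>_def q\<theta>_def nJ_def by algebra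
  have "?r\<^sup>2 * ?K = ?Q\<^sup>2 + 2 * ((es z)\<^sup>2 * wxy z + ec z * es z * wxx z)\<^sup>2
      + ((es z)\<^sup>2 * wyy z - (ec z)\<^sup>2 * wxx z)\<^sup>2 + 2 * (ec z * es z * wyy z + (ec z)\<^sup>2 * wxy z)\<^sup>2" by algebra
  moreover have "0 \<le> 2 * ((es z)\<^sup>2 * wxy z + ec z * es z * wxx z)\<^sup>2
      + ((es z)\<^sup>2 * wyy z - (ec z)\<^sup>2 * wxx z)\<^sup>2 + 2 * (ec z * es z * wyy z + (ec z)\<^sup>2 * wxy z)\<^sup>2" by simp
  ultimately have Q: "?Q\<^sup>2 \<le> ?r\<^sup>2 * ?K" by linarith
  have "(?h * ?Q)\<^sup>2 = ?h\<^sup>2 * ?Q\<^sup>2" by (simp add: power_mult_distrib)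
  also have "\<dots> \<le> (?K / 400) * (?r\<^sup>2 * ?K)" by (rule mult_mono[OF laplace_E(4)[OF z] Q]) simp_all
  also have "\<dots> = (H2 z / 20)\<^sup>2" unfolding H2_def by (simp add: power2_eq_square)
  finally have "?h * ?Q \<le> H2 z / 20" by (rule power2_le_imp_le) (simp add: H2_le(3)[OF z])
  with id H2_le(1)[OF z] H2_le(4)[OF z] show ?thesis by linarith
qed

text \<open>\<open>S\<close> is the signed area enclosed by the gradient image of a circle and \<open>cJ\<close> is its rate of decrease.
Since the gradient tends to 0, \<open>S\<close> measures the Dirichlet integral of the gradient outside the circle.\<close>

definition S where "S = circ (\<lambda>z. p z * q\<theta> z)"
definition cJ where "cJ = circ nJ"

lemma cJ_nonneg: "T < t \<Longrightarrow> 0 \<le> cJ t"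
  unfolding cJ_def by (rule circ_nonneg[OF cylfun_continuous[OF cylfun_nJ]]) (auto intro: H2_le(4))

lemma S_derivative: assumes t: "T < t" shows "(S has_real_derivative - cJ t) (at t)"
proof -
  have "(S has_real_derivative circ (\<lambda>z. pt z * q\<theta> z - p\<theta> z * qt z) t) (at t)"
    unfolding S_def
    by (rule cylfun_area_derivative[OF partials_p partials_q _ _ _ _ _ t]) (intro cylfun_pq cylfun_intros)+
  moreover have "circ (\<lambda>z. - nJ z) t = - cJ t" unfolding cJ_def circ_def by simp
  ultimately show ?thesis by (simp add: area_form)
qed

lemma angular_circ: assumes t: "T < t"
  shows "circ (\<lambda>z. (p\<theta> z)\<^sup>2) t + circ (\<lambda>z. (q\<theta> z)\<^sup>2) t \<le> 9 / 8 * cJ t"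
    "circ (\<lambda>z. (p\<theta> z)\<^sup>2) t \<le> 9 / 8 * cJ t" "circ (\<lambda>z. (q\<theta> z)\<^sup>2) t \<le> 9 / 8 * cJ t"
proof -
  have c: "cylfun (\<lambda>z. (p\<theta> z)\<^sup>2)" "cylfun (\<lambda>z. (q\<theta> z)\<^sup>2)" by (intro cylfun_intros cylfun_pq)+
  have "circ (\<lambda>z. (p\<theta> z)\<^sup>2 + (q\<theta> z)\<^sup>2) t \<le> circ (\<lambda>z. 9 / 8 * nJ z) t"
  proof (rule circ_mono'[OF _ _ t])
    show "(p\<theta> (t, \<theta>))\<^sup>2 + (q\<theta> (t, \<theta>))\<^sup>2 \<le> 9 / 8 * nJ (t, \<theta>)" for \<theta>
      by (rule angular_le) (use t in simp)
  qed (intro cylfun_intros cylfun_pq cylfun_nJ)+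
  then show 1: "circ (\<lambda>z. (p\<theta> z)\<^sup>2) t + circ (\<lambda>z. (q\<theta> z)\<^sup>2) t \<le> 9 / 8 * cJ t"
    unfolding circ_cmult cJ_def[symmetric] circ_add[OF cylfun_continuous[OF c(1)] cylfun_continuous[OF c(2)] t] .
  have "0 \<le> circ (\<lambda>z. (p\<theta> z)\<^sup>2) t" "0 \<le> circ (\<lambda>z. (q\<theta> z)\<^sup>2) t"
    using circ_nonneg[OF cylfun_continuous[OF c(1)] t] circ_nonneg[OF cylfun_continuous[OF c(2)] t] by simp_all
  with 1 show "circ (\<lambda>z. (p\<theta> z)\<^sup>2) t \<le> 9 / 8 * cJ t" "circ (\<lambda>z. (q\<theta> z)\<^sup>2) t \<le> 9 / 8 * cJ t" by linarith+
qed

text \<open>The isoperimetric inequality for the gradient image of a circle, from Wirtinger's inequality with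
constant \<open>19/20\<close>. The sharp constants would give 2 instead of \<open>8/5\<close>; the losses of Wirtinger's
inequality and of \<open>angular_le\<close> are small enough for what follows.\<close>

lemma isoperimetric: assumes t: "T < t" shows "8 / 5 * S t \<le> cJ t"
proof -
  let ?k = "19 / 20 :: real"
  obtain c where c: "?k\<^sup>2 * circ (\<lambda>z. (p z - c)\<^sup>2) t \<le> circ (\<lambda>z. (p\<theta> z)\<^sup>2) t"
    using circ_wirtinger[OF partials_p cylfun_continuous[OF cylfun_pq(2)] cylfun_periodic[OF cylfun.E] _ _ t, of ?k] by auto
  have cf: "cylfun (\<lambda>z. p z * q\<theta> z)" "cylfun (\<lambda>z. c * q\<theta> z)" "cylfun (\<lambda>z. (p z - c)\<^sup>2)" "cylfun (\<lambda>z. (q\<theta> z)\<^sup>2)"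
    "cylfun (\<lambda>z. 1 / 2 * (p z - c)\<^sup>2)" "cylfun (\<lambda>z. 1 / 2 * (q\<theta> z)\<^sup>2)"
    by (intro cylfun_intros cylfun_pq)+
  have "circ q\<theta> t = 0" by (rule circ_angular_derivative[OF partials_q cylfun_periodic[OF cylfun.E] t])
  then have "S t = circ (\<lambda>z. p z * q\<theta> z - c * q\<theta> z) t"
    using circ_diff[OF cylfun_continuous[OF cf(1)] cylfun_continuous[OF cf(2)] t] by (simp add: S_def circ_cmult)
  also have "\<dots> \<le> circ (\<lambda>z. 1 / 2 * (p z - c)\<^sup>2 + 1 / 2 * (q\<theta> z)\<^sup>2) t"
  proof (rule circ_mono'[OF _ _ t])
    fix \<theta>
    have "0 \<le> ((p (t, \<theta>) - c) - q\<theta> (t, \<theta>))\<^sup>2" by simp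
    then show "p (t, \<theta>) * q\<theta> (t, \<theta>) - c * q\<theta> (t, \<theta>) \<le> 1 / 2 * (p (t, \<theta>) - c)\<^sup>2 + 1 / 2 * (q\<theta> (t, \<theta>))\<^sup>2"
      by (simp add: power2_eq_square algebra_simps)
  qed (intro cylfun_intros cylfun_pq)+
  also have "\<dots> = 1 / 2 * circ (\<lambda>z. (p z - c)\<^sup>2) t + 1 / 2 * circ (\<lambda>z. (q\<theta> z)\<^sup>2) t"
    unfolding circ_add[OF cylfun_continuous[OF cf(5)] cylfun_continuous[OF cf(6)] t] circ_cmult ..
  finally have "S t \<le> 1 / 2 * circ (\<lambda>z. (p z - c)\<^sup>2) t + 1 / 2 * circ (\<lambda>z. (q\<theta> z)\<^sup>2) t" .
  moreover have "361 / 400 * circ (\<lambda>z. (p z - c)\<^sup>2) t \<le> circ (\<lambda>z. (p\<theta> z)\<^sup>2) t"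
    using c by (simp add: power2_eq_square)
  moreover have "0 \<le> circ (\<lambda>z. (q\<theta> z)\<^sup>2) t"
    by (rule circ_nonneg[OF cylfun_continuous[OF cf(4)] t]) simp
  ultimately show ?thesis using angular_circ(1)[OF t] cJ_nonneg[OF t] by linarith
qed

text \<open>As the gradient is bounded, \<open>|S|\<close> is at most a constant times the \<open>L\<^sup>2\<close> norm of \<open>q\<^sub>\<theta>\<close>. The parameter \<open>\<eta>\<close> optimises the inequality between the two means.\<close>

lemma S_negative: assumes t: "T < t" and neg: "S t < 0" shows "(S t)\<^sup>2 \<le> 9 * pi / 4 * cJ t"
proof -
  define u where "u = - S t"
  have u: "u > 0" using neg by (simp add: u_def)
  define \<eta> where "\<eta> = u / (2 * pi)"
  have \<eta>: "\<eta> > 0" using u by (simp add: \<eta>_def)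
  have cf: "cylfun (\<lambda>z. \<eta> / 2)" "cylfun (\<lambda>z. 1 / (2 * \<eta>) * (q\<theta> z)\<^sup>2)"
    by (intro cylfun_intros cylfun_pq)+
  have "u = circ (\<lambda>z. (-1) * (p z * q\<theta> z)) t" unfolding circ_cmult u_def S_def by simp
  also have "\<dots> \<le> circ (\<lambda>z. \<eta> / 2 + 1 / (2 * \<eta>) * (q\<theta> z)\<^sup>2) t"
  proof (rule circ_mono'[OF _ _ t])
    fix \<theta>
    let ?a = "p (t, \<theta>)" and ?b = "q\<theta> (t, \<theta>)"
    have "?a\<^sup>2 + (q (t, \<theta>))\<^sup>2 \<le> 1" by (rule laplace_E(2)) (use t in auto)
    then have "?a\<^sup>2 \<le> 1" using zero_le_power2[of "q (t, \<theta>)"] by linarith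
    then have "\<eta>\<^sup>2 * ?a\<^sup>2 \<le> \<eta>\<^sup>2 * 1" by (rule mult_left_mono) simp
    moreover have "0 \<le> (\<eta> * ?a + ?b)\<^sup>2" by simp
    ultimately have "2 * \<eta> * ((-1) * (?a * ?b)) \<le> \<eta>\<^sup>2 + ?b\<^sup>2" by (simp add: power2_eq_square algebra_simps)
    then have "(-1) * (?a * ?b) \<le> (\<eta>\<^sup>2 + ?b\<^sup>2) / (2 * \<eta>)" using \<eta> by (simp add: pos_le_divide_eq mult.commute)
    also have "\<dots> = \<eta> / 2 + 1 / (2 * \<eta>) * ?b\<^sup>2" using \<eta> by (simp add: add_divide_distrib power2_eq_square)
    finally show "(-1) * (?a * ?b) \<le> \<eta> / 2 + 1 / (2 * \<eta>) * ?b\<^sup>2" .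
  qed (intro cylfun_intros cylfun_pq)+
  also have "\<dots> = pi * \<eta> + 1 / (2 * \<eta>) * circ (\<lambda>z. (q\<theta> z)\<^sup>2) t"
    unfolding circ_add[OF cylfun_continuous[OF cf(1)] cylfun_continuous[OF cf(2)] t] circ_cmult circ_const by simp
  also have "1 / (2 * \<eta>) * circ (\<lambda>z. (q\<theta> z)\<^sup>2) t \<le> 1 / (2 * \<eta>) * (9 / 8 * cJ t)"
    by (rule mult_left_mono[OF angular_circ(3)[OF t]]) (use \<eta> in simp)
  finally have "u \<le> pi * \<eta> + 1 / (2 * \<eta>) * (9 / 8 * cJ t)" by simp
  then have "u \<le> u / 2 + pi / u * (9 / 8 * cJ t)" using u by (simp add: \<eta>_def)
  then have "u * u \<le> u * (u / 2 + pi / u * (9 / 8 * cJ t))" using u by (intro mult_left_mono) auto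
  also have "\<dots> = u * u / 2 + 9 * pi / 8 * cJ t" using u by (simp add: distrib_left)
  finally show ?thesis by (simp add: u_def power2_eq_square)
qed

text \<open>By \<open>S_negative\<close>, a negative value would blow up to minus infinity at a finite \<open>t\<close>.\<close>

lemma S_nonneg: "T < t \<Longrightarrow> 0 \<le> S t"
proof (rule riccati_nonneg[OF S_derivative])
  show "- cJ s \<le> 0" if "T < s" for s using cJ_nonneg[OF that] by simp
  show "0 < 4 / (9 * pi)" by simp
  show "- cJ s \<le> - (4 / (9 * pi)) * (S s)\<^sup>2" if "T < s" "S s < 0" for s
    using S_negative[OF that] by (simp add: field_simps)
qed

definition CS where "CS = S (T + 1) * exp (8 / 5 * (T + 1))"

lemma CS_nonneg: "0 \<le> CS"
  unfolding CS_def using S_nonneg[of "T + 1"] by simp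

lemma S_decay: assumes t: "T + 1 \<le> t" shows "S t \<le> CS * exp (- (8 / 5) * t)"
proof -
  have "S t \<le> S (T + 1) * exp (- (8 / 5) * (t - (T + 1)))"
    by (rule exp_decay[OF S_derivative _ _ t]) (use isoperimetric in auto)
  also have "\<dots> = CS * exp (- (8 / 5) * t)"
  proof -
    have "exp (- (8 / 5) * (t - (T + 1))) = exp (8 / 5 * (T + 1)) * exp (- (8 / 5) * t)"
      unfolding exp_add[symmetric] by (rule arg_cong[where f = exp]) (simp add: field_simps)
    then show ?thesis by (simp add: CS_def)
  qed
  finally show ?thesis .
qed

end

section \<open>Decay of the gradient at infinity\<close>

lemma nonincreasing_tendsto_0_nonneg:
  fixes f f' :: "real \<Rightarrow> real"
  assumes f: "\<And>t. T < t \<Longrightarrow> (f has_real_derivative f' t) (at t)" and f': "\<And>t. T < t \<Longrightarrow> f' t \<le> 0"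
    and lim: "(f \<longlongrightarrow> 0) at_top" and s: "T < s"
  shows "0 \<le> f s"
  by (rule tendsto_upperbound[OF lim])
     (use antimono_from_derivative[OF f f' s] in \<open>auto intro: eventually_mono[OF eventually_ge_at_top[of s]]\<close>)

context exterior_solution
begin

lemma uniform_decay:
  assumes lim: "(D i j \<longlongrightarrow> 0) at_infinity"
  shows "0 < e \<Longrightarrow> \<exists>s. \<forall>t\<ge>s. \<forall>\<theta>. \<bar>E i j (t, \<theta>)\<bar> < e"
proof -
  assume e: "0 < e"
  have "eventually (\<lambda>x. dist (D i j x) 0 < e) at_infinity" by (rule tendstoD[OF lim e])
  then obtain b where b: "\<And>x. b \<le> norm x \<Longrightarrow> \<bar>D i j x\<bar> < e" by (auto simp: eventually_at_infinity)
  have "\<bar>E i j (t, \<theta>)\<bar> < e" if "ln (max b 1) \<le> t" for t \<theta>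
  proof -
    have "exp (ln (max b 1)) \<le> exp t" using that unfolding exp_le_cancel_iff .
    moreover have "exp (ln (max b 1)) = max b 1" by (rule exp_ln) simp
    ultimately have "max b 1 \<le> exp t" by simp
    then have "b \<le> norm (ec (t, \<theta>), es (t, \<theta>))" unfolding norm_polar by simp
    from b[OF this] show ?thesis by (simp add: E_def)
  qed
  then show ?thesis by blast
qed

text \<open>Mean value theorem: the Dirichlet integral over a ring of unit width is at most \<open>S t\<close>.\<close>

lemma circle_with_small_energy:
  assumes t: "T < t"
  obtains s where "t < s" "s < t + 1" "cJ s \<le> S t"
proof -
  have "\<exists>z>t. z < t + 1 \<and> S (t + 1) - S t = (t + 1 - t) * (- cJ z)"
    by (rule MVT2) (use S_derivative t in auto)
  then obtain z where z: "t < z" "z < t + 1" "cJ z = S t - S (t + 1)" by auto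
  then show ?thesis using S_nonneg[of "t + 1"] t by (intro that[of z]) auto
qed

text \<open>The integral \<open>m\<close> of \<open>g\<close> over circles changes at a rate bounded by the energy, which is integrable with
weight \<open>exp (4 t / 5)\<close>; since \<open>m\<close> tends to 0, it is bounded by the function \<open>N\<close> built from \<open>S\<close>. In
every ring of unit width there is a circle of small energy, on which the oscillation of \<open>g\<close> around
its mean is of the same order. The maximum principle carries the bound over to the circles in between.
Only an upper bound is stated, as it is applied to both components and their negatives.\<close>

lemma gradient_component_decay:
  assumes g: "has_partials (cylinder T) g gt g\<theta>" and h: "has_partials (cylinder T) h ht h\<theta>"
    and cf: "cylfun g" "cylfun gt" "cylfun g\<theta>" "cylfun h" "cylfun ht" "cylfun h\<theta>"
    and jac: "\<And>z. gt z * h\<theta> z - g\<theta> z * ht z = - nJ z"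
    and rad: "\<And>z. z \<in> cylinder T \<Longrightarrow> (gt z)\<^sup>2 \<le> 3 * nJ z"
    and ang: "\<And>t. T < t \<Longrightarrow> circ (\<lambda>z. (g\<theta> z)\<^sup>2) t \<le> 9 / 8 * cJ t"
    and lim: "\<And>e. 0 < e \<Longrightarrow> \<exists>s. \<forall>t\<ge>s. \<forall>\<theta>. \<bar>g (t, \<theta>)\<bar> < e"
  shows "\<exists>K\<ge>0. \<forall>t>T + 2. \<forall>\<theta>\<in>{0..2 * pi}. g (t, \<theta>) \<le> K * exp (- (4 / 5) * t)"
proof -
  define m where "m = circ g"
  have m': "(m has_real_derivative circ gt t) (at t)" if "T < t" for t
    unfolding m_def by (rule circ_derivative[OF g cylfun_continuous[OF cf(2)] that])
  have m'_le: "\<bar>circ gt t\<bar> \<le> pi * exp (- (4 / 5) * t) + 3 / 2 * exp (4 / 5 * t) * cJ t" if t: "T < t" for t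
  proof -
    define e where "e = exp (- (4 / 5) * t)"
    have e: "e > 0" "inverse e = exp (4 / 5 * t)" by (simp_all add: e_def flip: exp_minus)
    have cb: "cylfun (\<lambda>z. e / 2)" "cylfun (\<lambda>z. 3 / 2 * inverse e * nJ z)" by (intro cylfun_intros cylfun_nJ)+
    have pw: "\<bar>gt (t, \<theta>)\<bar> \<le> e / 2 + 3 / 2 * inverse e * nJ (t, \<theta>)" for \<theta>
    proof -
      have "0 \<le> (\<bar>gt (t, \<theta>)\<bar> - e)\<^sup>2" by simp
      then have "2 * e * \<bar>gt (t, \<theta>)\<bar> \<le> e\<^sup>2 + (gt (t, \<theta>))\<^sup>2" by (simp add: power2_diff algebra_simps)
      also have "\<dots> \<le> e\<^sup>2 + 3 * nJ (t, \<theta>)" using rad[of "(t, \<theta>)"] t by simp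
      finally have "\<bar>gt (t, \<theta>)\<bar> \<le> (e\<^sup>2 + 3 * nJ (t, \<theta>)) / (2 * e)"
        using e(1) by (simp add: pos_le_divide_eq mult.commute)
      also have "\<dots> = e / 2 + 3 / 2 * inverse e * nJ (t, \<theta>)"
        using e(1) by (simp add: power2_eq_square field_simps)
      finally show ?thesis .
    qed
    have "circ gt t \<le> circ (\<lambda>z. e / 2 + 3 / 2 * inverse e * nJ z) t"
      by (rule circ_mono'[OF cf(2) cylfun.add[OF cb] t]) (use pw abs_le_D1 in blast)
    moreover have "circ (\<lambda>z. - gt z) t \<le> circ (\<lambda>z. e / 2 + 3 / 2 * inverse e * nJ z) t"
      by (rule circ_mono'[OF cylfun_uminus[OF cf(2)] cylfun.add[OF cb] t]) (use pw abs_le_D2 in blast)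
    moreover have "circ (\<lambda>z. - gt z) t = - circ gt t" by (simp add: circ_def)
    moreover have "circ (\<lambda>z. e / 2 + 3 / 2 * inverse e * nJ z) t = pi * e + 3 / 2 * inverse e * cJ t"
      unfolding circ_add[OF cylfun_continuous[OF cb(1)] cylfun_continuous[OF cb(2)] t] circ_cmult circ_const cJ_def by simp
    ultimately show ?thesis unfolding e e_def[symmetric] by (simp add: abs_le_iff)
  qed
  define c where "c = (6 / 5 * CS + pi) * (5 / 4)"
  have c0: "c \<ge> 0" using CS_nonneg by (simp add: c_def)
  define N where "N = (\<lambda>t. 3 / 2 * exp (4 / 5 * t) * S t + c * exp (- (4 / 5) * t))"
  define N' where "N' = (\<lambda>t. 6 / 5 * exp (4 / 5 * t) * S t - 3 / 2 * exp (4 / 5 * t) * cJ t - 4 / 5 * c * exp (- (4 / 5) * t))"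
  have N_der: "(N has_real_derivative N' t) (at t)" if "T < t" for t
    unfolding N_def N'_def
    by (rule derivative_eq_intros refl S_derivative[OF that] | simp add: algebra_simps)+
  have eS: "exp (4 / 5 * t) * S t \<le> CS * exp (- (4 / 5) * t)" if t: "T + 1 \<le> t" for t
  proof -
    have "exp (4 / 5 * t) * S t \<le> exp (4 / 5 * t) * (CS * exp (- (8 / 5) * t))"
      by (rule mult_left_mono[OF S_decay[OF t]]) simp
    also have "\<dots> = CS * (exp (4 / 5 * t) * exp (- (8 / 5) * t))" by simp
    also have "exp (4 / 5 * t) * exp (- (8 / 5) * t) = exp (- (4 / 5) * t)"
      unfolding exp_add[symmetric] by (rule arg_cong[where f = exp]) simp
    finally show ?thesis .
  qed
  have N'_le: "N' t \<le> - \<bar>circ gt t\<bar>" if t: "T + 1 < t" for t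
  proof -
    define x where "x = exp (- (4 / 5) * t)"
    have "4 / 5 * c = 6 / 5 * CS + pi" by (simp add: c_def)
    then have "4 / 5 * c * x = 6 / 5 * (CS * x) + pi * x" by (simp add: distrib_right)
    moreover have "exp (4 / 5 * t) * S t \<le> CS * x" unfolding x_def by (rule eS) (use t in simp)
    moreover have "\<bar>circ gt t\<bar> \<le> pi * x + 3 / 2 * exp (4 / 5 * t) * cJ t" unfolding x_def by (rule m'_le) (use t in simp)
    ultimately show ?thesis unfolding N'_def x_def[symmetric] mult.assoc by linarith
  qed
  have N_nonneg: "0 \<le> N t" if "T < t" for t unfolding N_def using S_nonneg[OF that] c0 by simp
  have N_le: "N t \<le> (3 / 2 * CS + c) * exp (- (4 / 5) * t)" if t: "T + 1 \<le> t" for t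
    using eS[OF t] unfolding N_def distrib_right mult.assoc by linarith
  have N_lim: "(N \<longlongrightarrow> 0) at_top"
  proof (rule tendsto_sandwich[OF _ _ tendsto_const])
    show "eventually (\<lambda>t. 0 \<le> N t) at_top" using eventually_gt_at_top[of T] by eventually_elim (rule N_nonneg)
    show "eventually (\<lambda>t. N t \<le> (3 / 2 * CS + c) * exp (- (4 / 5) * t)) at_top"
      using eventually_ge_at_top[of "T + 1"] by eventually_elim (rule N_le)
    have "((\<lambda>t. (3 / 2 * CS + c) * exp (- (4 / 5) * t)) \<longlongrightarrow> (3 / 2 * CS + c) * 0) at_top"
      by (intro tendsto_mult tendsto_const exp_neg_tendsto_0) simp
    then show "((\<lambda>t. (3 / 2 * CS + c) * exp (- (4 / 5) * t)) \<longlongrightarrow> 0) at_top" by simp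
  qed
  have m_lim: "(m \<longlongrightarrow> 0) at_top"
  proof (rule tendstoI)
    fix e :: real assume e: "e > 0"
    then obtain s where s: "\<And>t \<theta>. s \<le> t \<Longrightarrow> \<bar>g (t, \<theta>)\<bar> < e / (4 * pi)"
      using lim[of "e / (4 * pi)"] by auto
    show "eventually (\<lambda>t. dist (m t) 0 < e) at_top"
      using eventually_ge_at_top[of "max s (T + 1)"]
    proof eventually_elim
      case (elim t)
      then have t: "T < t" "s \<le> t" by auto
      have b: "g (t, \<theta>) \<le> e / (4 * pi)" "- g (t, \<theta>) \<le> e / (4 * pi)" for \<theta> using s[OF t(2), of \<theta>] by linarith+
      have "circ g t \<le> circ (\<lambda>z. e / (4 * pi)) t"
        by (rule circ_mono'[OF cf(1) cylfun.const t(1) b(1)])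
      moreover have "circ (\<lambda>z. - g z) t \<le> circ (\<lambda>z. e / (4 * pi)) t"
        by (rule circ_mono'[OF cylfun_uminus[OF cf(1)] cylfun.const t(1) b(2)])
      moreover have "circ (\<lambda>z. - g z) t = - circ g t" by (simp add: circ_def)
      moreover have "circ (\<lambda>z. e / (4 * pi)) t = e / 2" by (simp add: circ_const)
      ultimately show ?case using e by (simp add: m_def dist_real_def abs_less_iff)
    qed
  qed
  have m_le: "m t \<le> N t" if t: "T + 1 < t" for t
  proof -
    have "0 \<le> N t - m t"
    proof (rule nonincreasing_tendsto_0_nonneg[where T = "T + 1" and f = "\<lambda>t. N t - m t" and f' = "\<lambda>t. N' t - circ gt t"])
      show "((\<lambda>t. N t - m t) has_real_derivative N' s - circ gt s) (at s)" if "T + 1 < s" for s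
        by (intro DERIV_diff N_der m') (use that in auto)
      show "N' s - circ gt s \<le> 0" if "T + 1 < s" for s using N'_le[OF that] by linarith
      show "((\<lambda>t. N t - m t) \<longlongrightarrow> 0) at_top" using tendsto_diff[OF N_lim m_lim] by simp
    qed (rule t)
    then show ?thesis by simp
  qed
  define K where "K = (pi + CS) + (3 / 2 * CS + c) / (2 * pi)"
  have K0: "0 \<le> K" using CS_nonneg c0 by (simp add: K_def add_nonneg_nonneg)
  have good: "\<exists>s. t < s \<and> s < t + 1 \<and> (\<forall>\<theta>\<in>{0..2 * pi}. g (s, \<theta>) \<le> K * exp (- (4 / 5) * t))" if t: "T + 1 < t" for t
  proof -
    have tT: "T < t" using t by simp
    obtain s where s: "t < s" "s < t + 1" "cJ s \<le> S t" using circle_with_small_energy[OF tT] .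
    define x where "x = exp (- (4 / 5) * t)"
    have x: "x > 0" by (simp add: x_def)
    have xx: "x * x = exp (- (8 / 5) * t)" unfolding x_def exp_add[symmetric] by (rule arg_cong[where f = exp]) simp
    have "cJ s \<le> CS * (x * x)" unfolding xx using s(3) S_decay[of t] t by simp
    then have cJs: "9 / 8 * cJ s \<le> 2 * (CS * (x * x))" using cJ_nonneg[of s] s(1) tT by simp
    have sT: "T < s" "T + 1 < s" using s t by auto
    have osc: "g (s, \<theta>) - g (s, \<theta>') \<le> (pi + CS) * x" if "\<theta> \<in> {0..2 * pi}" "\<theta>' \<in> {0..2 * pi}" for \<theta> \<theta>'
    proof -
      have "g (s, \<theta>) - g (s, \<theta>') \<le> pi * x + circ (\<lambda>z. (g\<theta> z)\<^sup>2) s / (2 * x)"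
        using circ_oscillation[OF g cylfun_continuous[OF cf(3)] sT(1) x that] by linarith
      also have "circ (\<lambda>z. (g\<theta> z)\<^sup>2) s / (2 * x) \<le> 2 * (CS * (x * x)) / (2 * x)"
        by (rule divide_right_mono) (use ang[OF sT(1)] cJs x in auto)
      also have "\<dots> = CS * x" using x by simp
      finally show ?thesis by (simp add: distrib_right)
    qed
    have "g (s, \<theta>) \<le> K * x" if \<theta>: "\<theta> \<in> {0..2 * pi}" for \<theta>
    proof -
      have "circ (\<lambda>z. g (s, \<theta>) - g z) s \<le> circ (\<lambda>z. (pi + CS) * x) s"
        unfolding circ_def
        by (rule integral_le) (use osc[OF \<theta>] in \<open>auto intro!: circ_integrable[OF _ sT(1)] cylfun_continuous cylfun_intros cf\<close>)
      moreover have "circ (\<lambda>z. g (s, \<theta>) - g z) s = 2 * pi * g (s, \<theta>) - m s"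
        unfolding circ_diff[OF cylfun_continuous[OF cylfun.const] cylfun_continuous[OF cf(1)] sT(1)] circ_const m_def ..
      moreover have "m s \<le> (3 / 2 * CS + c) * x"
      proof -
        have "m s \<le> (3 / 2 * CS + c) * exp (- (4 / 5) * s)" using m_le[OF sT(2)] N_le[of s] sT by simp
        also have "\<dots> \<le> (3 / 2 * CS + c) * x" unfolding x_def
          by (rule mult_left_mono) (use s CS_nonneg c0 in auto)
        finally show ?thesis .
      qed
      ultimately have "2 * pi * g (s, \<theta>) \<le> 2 * pi * ((pi + CS) * x) + (3 / 2 * CS + c) * x" by (simp add: circ_const)
      also have "\<dots> = (2 * pi * K) * x"
      proof -
        have "2 * pi * K = 2 * pi * (pi + CS) + (3 / 2 * CS + c)" unfolding K_def by (simp add: field_simps)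
        then show ?thesis by (simp add: distrib_right mult.assoc)
      qed
      finally show ?thesis by (simp add: mult.assoc)
    qed
    with s show ?thesis unfolding x_def by blast
  qed
  obtain x1 x2 ht\<theta> where mix: "has_partials (cylinder T) h\<theta> ht\<theta> x1" "has_partials (cylinder T) ht x2 ht\<theta>" "cylfun ht\<theta>"
    using cylfun_mixed[OF h cf(5,6)] by blast
  show ?thesis
  proof (intro exI[of _ "K * exp (4 / 5)"] conjI allI impI ballI)
    show "0 \<le> K * exp (4 / 5)" using K0 by simp
    fix t \<theta> assume t: "T + 2 < t" and \<theta>: "\<theta> \<in> {0..2 * pi}"
    obtain s1 where s1: "t - 1 < s1" "s1 < t" "\<And>\<theta>. \<theta> \<in> {0..2 * pi} \<Longrightarrow> g (s1, \<theta>) \<le> K * exp (- (4 / 5) * (t - 1))"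
      using good[of "t - 1"] t by auto
    obtain s2 where s2: "t < s2" "\<And>\<theta>. \<theta> \<in> {0..2 * pi} \<Longrightarrow> g (s2, \<theta>) \<le> K * exp (- (4 / 5) * t)"
      using good[of t] t by auto
    have "g (t, \<theta>) \<le> K * exp (- (4 / 5) * (t - 1))"
    proof (rule jacobian_max_principle[OF g mix(1,2), where ?t1.0 = s1 and ?t2.0 = s2])
      show "gt z * h\<theta> z - g\<theta> z * ht z \<le> 0" if "z \<in> cylinder T" for z
        unfolding jac using H2_le(4)[OF that] by simp
      show "gt z = 0" if "z \<in> cylinder T" "gt z * h\<theta> z - g\<theta> z * ht z = 0" for z
        using rad[OF that(1)] that(2) unfolding jac by simp
      show "g (s2, \<theta>) \<le> K * exp (- (4 / 5) * (t - 1))" if "\<theta> \<in> {0..2 * pi}" for \<theta>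
        by (rule order_trans[OF s2(2)[OF that] mult_left_mono[OF _ K0]]) simp
    qed (use s1 s2 t \<theta> in \<open>auto intro: cylfun_continuous cylfun_periodic cf mix\<close>)
    also have "\<dots> = K * exp (4 / 5) * exp (- (4 / 5) * t)"
      unfolding mult.assoc exp_add[symmetric] by (rule arg_cong[where f = "\<lambda>x. K * exp x"]) (simp add: field_simps)
    finally show "g (t, \<theta>) \<le> K * exp (4 / 5) * exp (- (4 / 5) * t)" .
  qed
qed

text \<open>Rotating the pair \<open>(p, q)\<close> by a quarter turn keeps its Jacobian, so each of \<open>p\<close>, \<open>- p\<close>, \<open>q\<close>, \<open>- q\<close> is
the first component of a pair to which the previous lemma applies.\<close>

lemma gradient_decay:
  "\<exists>K\<ge>0. \<forall>t>T + 2. \<forall>\<theta>\<in>{0..2 * pi}.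
     \<bar>p (t, \<theta>)\<bar> \<le> K * exp (- (4 / 5) * t) \<and> \<bar>q (t, \<theta>)\<bar> \<le> K * exp (- (4 / 5) * t)"
proof -
  have n: "pt z * q\<theta> z - p\<theta> z * qt z = - nJ z" for z by (rule area_form)
  have lim: "\<And>e. 0 < e \<Longrightarrow> \<exists>s. \<forall>t\<ge>s. \<forall>\<theta>. \<bar>p (t, \<theta>)\<bar> < e" "\<And>e. 0 < e \<Longrightarrow> \<exists>s. \<forall>t\<ge>s. \<forall>\<theta>. \<bar>q (t, \<theta>)\<bar> < e"
    using uniform_decay[of "Suc 0" 0] uniform_decay[of 0 "Suc 0"] decay by simp_all
  note cf = cylfun_pq cylfun.E cylfun_uminus
  have "\<exists>K\<ge>0. \<forall>t>T + 2. \<forall>\<theta>\<in>{0..2 * pi}. p (t, \<theta>) \<le> K * exp (- (4 / 5) * t)"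
    by (rule gradient_component_decay[OF partials_p partials_q])
       (use n lim radial_le angular_circ in \<open>auto intro!: cf\<close>)
  then obtain K1 where K1: "K1 \<ge> 0" "\<And>t \<theta>. T + 2 < t \<Longrightarrow> \<theta> \<in> {0..2 * pi} \<Longrightarrow> p (t, \<theta>) \<le> K1 * exp (- (4 / 5) * t)"
    by blast
  have "\<exists>K\<ge>0. \<forall>t>T + 2. \<forall>\<theta>\<in>{0..2 * pi}. - p (t, \<theta>) \<le> K * exp (- (4 / 5) * t)"
    by (rule gradient_component_decay[OF has_partials_minus[OF partials_p] has_partials_minus[OF partials_q]])
       (use n lim radial_le angular_circ in \<open>auto intro!: cf\<close>)
  then obtain K2 where K2: "K2 \<ge> 0" "\<And>t \<theta>. T + 2 < t \<Longrightarrow> \<theta> \<in> {0..2 * pi} \<Longrightarrow> - p (t, \<theta>) \<le> K2 * exp (- (4 / 5) * t)"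
    by blast
  have "\<exists>K\<ge>0. \<forall>t>T + 2. \<forall>\<theta>\<in>{0..2 * pi}. q (t, \<theta>) \<le> K * exp (- (4 / 5) * t)"
    by (rule gradient_component_decay[OF partials_q has_partials_minus[OF partials_p]])
       (use n lim radial_le angular_circ in \<open>auto intro!: cf simp: algebra_simps\<close>)
  then obtain K3 where K3: "K3 \<ge> 0" "\<And>t \<theta>. T + 2 < t \<Longrightarrow> \<theta> \<in> {0..2 * pi} \<Longrightarrow> q (t, \<theta>) \<le> K3 * exp (- (4 / 5) * t)"
    by blast
  have "\<exists>K\<ge>0. \<forall>t>T + 2. \<forall>\<theta>\<in>{0..2 * pi}. - q (t, \<theta>) \<le> K * exp (- (4 / 5) * t)"
    by (rule gradient_component_decay[OF has_partials_minus[OF partials_q] partials_p])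
       (use n lim radial_le angular_circ in \<open>auto intro!: cf simp: algebra_simps\<close>)
  then obtain K4 where K4: "K4 \<ge> 0" "\<And>t \<theta>. T + 2 < t \<Longrightarrow> \<theta> \<in> {0..2 * pi} \<Longrightarrow> - q (t, \<theta>) \<le> K4 * exp (- (4 / 5) * t)"
    by blast
  show ?thesis
  proof (intro exI[of _ "K1 + K2 + K3 + K4"] conjI allI impI ballI)
    show "0 \<le> K1 + K2 + K3 + K4" using K1 K2 K3 K4 by simp
    fix t \<theta> assume t: "T + 2 < t" "\<theta> \<in> {0..2 * pi}"
    define x where "x = exp (- (4 / 5) * t)"
    have "0 \<le> K1 * x" "0 \<le> K2 * x" "0 \<le> K3 * x" "0 \<le> K4 * x" using K1 K2 K3 K4 by (simp_all add: x_def)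
    then show "\<bar>p (t, \<theta>)\<bar> \<le> (K1 + K2 + K3 + K4) * exp (- (4 / 5) * t)"
      "\<bar>q (t, \<theta>)\<bar> \<le> (K1 + K2 + K3 + K4) * exp (- (4 / 5) * t)"
      using K1(2)[OF t] K2(2)[OF t] K3(2)[OF t] K4(2)[OF t]
      unfolding x_def[symmetric] distrib_right by linarith+
  qed
qed

end

context exterior_solution
begin

section \<open>Oscillation over large circles\<close>

definition wt where "wt z = p z * ec z + q z * es z"
definition w\<theta> where "w\<theta> z = q z * ec z - p z * es z"
definition wtt where "wtt z = pt z * ec z + p z * ec z + (qt z * es z + q z * es z)"
definition wt\<theta> where "wt\<theta> z = qt z * ec z + q z * ec z - (pt z * es z + p z * es z)"
definition w\<theta>\<theta> where "w\<theta>\<theta> z = q\<theta> z * ec z - q z * es z - (p\<theta> z * es z + p z * ec z)"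

lemma partials_w: "has_partials (cylinder T) w wt w\<theta>"
  using partials_E[of 0 0] by (simp add: wt_def[abs_def] w\<theta>_def[abs_def])

lemma partials_wt: "has_partials (cylinder T) wt wtt wt\<theta>"
  unfolding wt_def[abs_def] wtt_def[abs_def] wt\<theta>_def[abs_def]
  by (rule has_partials_rhs[OF has_partials_add[OF has_partials_mult[OF partials_p partials_ec]
        has_partials_mult[OF partials_q partials_es]]])
     (simp, simp add: pt_def p\<theta>_def qt_def q\<theta>_def algebra_simps)

lemma partials_w\<theta>: "has_partials (cylinder T) w\<theta> wt\<theta> w\<theta>\<theta>"
  unfolding w\<theta>_def[abs_def] w\<theta>\<theta>_def[abs_def] wt\<theta>_def[abs_def]
  by (rule has_partials_rhs[OF has_partials_diff[OF has_partials_mult[OF partials_q partials_ec]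
        has_partials_mult[OF partials_p partials_es]]])
     (simp_all add: algebra_simps)

lemma cylfun_w: "cylfun wt" "cylfun w\<theta>" "cylfun wtt" "cylfun wt\<theta>" "cylfun w\<theta>\<theta>"
  unfolding wt_def[abs_def] wtt_def[abs_def] wt\<theta>_def[abs_def] w\<theta>_def[abs_def] w\<theta>\<theta>_def[abs_def]
  by (intro cylfun_intros cylfun_pq)+

lemma laplace_cylinder: "wtt z + w\<theta>\<theta> z = ((ec z)\<^sup>2 + (es z)\<^sup>2) * (wxx z + wyy z)"
  unfolding wtt_def w\<theta>\<theta>_def pt_def p\<theta>_def qt_def q\<theta>_def by algebra

lemma w\<theta>_sq_le: "(w\<theta> z)\<^sup>2 \<le> exp (2 * fst z) * ((p z)\<^sup>2 + (q z)\<^sup>2)"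
proof -
  have "((ec z)\<^sup>2 + (es z)\<^sup>2) * ((p z)\<^sup>2 + (q z)\<^sup>2) = (w\<theta> z)\<^sup>2 + (p z * ec z + q z * es z)\<^sup>2"
    unfolding w\<theta>_def by algebra
  then show ?thesis unfolding ec_es_sq by simp
qed

text \<open>The quantity \<open>A\<close> bounds the oscillation of \<open>w\<close> over a circle.\<close>

definition A where "A = circ (\<lambda>z. w\<theta> z * w\<theta> z)"

lemma A_nonneg: "T < t \<Longrightarrow> 0 \<le> A t"
  unfolding A_def by (rule circ_nonneg[OF cylfun_continuous]) (auto intro: cylfun_intros cylfun_w)

lemma A_derivative: assumes t: "T < t"
  shows "(A has_real_derivative 2 * circ (\<lambda>z. w\<theta> z * wt\<theta> z) t) (at t)"
proof -
  have "(A has_real_derivative circ (\<lambda>z. wt\<theta> z * w\<theta> z + w\<theta> z * wt\<theta> z) t) (at t)"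
    unfolding A_def
    by (rule circ_derivative[OF has_partials_mult[OF partials_w\<theta> partials_w\<theta>] cylfun_continuous t])
       (intro cylfun_intros cylfun_w)+
  moreover have "(\<lambda>z. wt\<theta> z * w\<theta> z + w\<theta> z * wt\<theta> z) = (\<lambda>z. 2 * (w\<theta> z * wt\<theta> z))" by (auto simp: algebra_simps)
  ultimately show ?thesis by (simp add: circ_cmult)
qed

lemma A_second_derivative: assumes t: "T < t"
  shows "((\<lambda>t. 2 * circ (\<lambda>z. w\<theta> z * wt\<theta> z) t) has_real_derivative
     2 * circ (\<lambda>z. wt\<theta> z * wt\<theta> z - w\<theta>\<theta> z * wtt z) t) (at t)"
  by (intro DERIV_cmult cylfun_area_derivative[OF partials_w\<theta> partials_wt _ _ _ _ _ t] cylfun_w)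

text \<open>If \<open>w\<^sub>t\<^sub>t + w\<^sub>\<theta>\<^sub>\<theta> = L\<close>, then \<open>2 (w\<^sub>t\<^sub>\<theta>\<^sup>2 - w\<^sub>\<theta>\<^sub>\<theta> w\<^sub>t\<^sub>t) \<ge> w\<^sub>\<theta>\<^sub>\<theta>\<^sup>2 - L\<^sup>2\<close>, and Wirtinger's inequality bounds the
integral of \<open>w\<^sub>\<theta>\<^sub>\<theta>\<^sup>2\<close> from below by that of \<open>w\<^sub>\<theta>\<^sup>2\<close>, because \<open>w\<^sub>\<theta>\<close> has mean 0 as a derivative along the
circle. For a multivalued \<open>w\<close> this would fail.\<close>

lemma A_convexity: assumes t: "T < t"
  shows "(9 / 10)\<^sup>2 * A t - circ (\<lambda>z. (wtt z + w\<theta>\<theta> z)\<^sup>2) t \<le> 2 * circ (\<lambda>z. wt\<theta> z * wt\<theta> z - w\<theta>\<theta> z * wtt z) t"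
proof -
  let ?k = "19 / 20 :: real"
  let ?L = "\<lambda>z. (wtt z + w\<theta>\<theta> z)\<^sup>2"
  have cf: "cylfun (\<lambda>z. (w\<theta>\<theta> z)\<^sup>2)" "cylfun ?L" "cylfun (\<lambda>z. 2 * (wt\<theta> z * wt\<theta> z - w\<theta>\<theta> z * wtt z))"
    by (intro cylfun_intros cylfun_w)+
  have "circ (\<lambda>z. (w\<theta>\<theta> z)\<^sup>2 - ?L z) t \<le> circ (\<lambda>z. 2 * (wt\<theta> z * wt\<theta> z - w\<theta>\<theta> z * wtt z)) t"
  proof (rule circ_mono'[OF cylfun.diff[OF cf(1,2)] cf(3) t])
    fix \<theta> :: real
    let ?z = "(t, \<theta>)"
    have "2 * (wt\<theta> ?z * wt\<theta> ?z - w\<theta>\<theta> ?z * wtt ?z) - ((w\<theta>\<theta> ?z)\<^sup>2 - ?L ?z) = 2 * (wt\<theta> ?z)\<^sup>2 + (wtt ?z)\<^sup>2"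
      by (simp add: power2_eq_square algebra_simps)
    also have "0 \<le> \<dots>" by simp
    finally show "(w\<theta>\<theta> ?z)\<^sup>2 - ?L ?z \<le> 2 * (wt\<theta> ?z * wt\<theta> ?z - w\<theta>\<theta> ?z * wtt ?z)" by simp
  qed
  then have 1: "circ (\<lambda>z. (w\<theta>\<theta> z)\<^sup>2) t - circ ?L t \<le> 2 * circ (\<lambda>z. wt\<theta> z * wt\<theta> z - w\<theta>\<theta> z * wtt z) t"
    unfolding circ_diff[OF cylfun_continuous[OF cf(1)] cylfun_continuous[OF cf(2)] t] circ_cmult .
  obtain c where c: "?k\<^sup>2 * circ (\<lambda>z. (w\<theta> z - c)\<^sup>2) t \<le> circ (\<lambda>z. (w\<theta>\<theta> z)\<^sup>2) t"
    using circ_wirtinger[OF partials_w\<theta> cylfun_continuous[OF cylfun_w(5)] cylfun_periodic[OF cylfun_w(2)] _ _ t, of ?k] by auto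
  have mean: "circ w\<theta> t = 0" by (rule circ_angular_derivative[OF partials_w cylfun_periodic[OF cylfun.E] t])
  have cg: "cylfun (\<lambda>z. w\<theta> z * w\<theta> z)" "cylfun (\<lambda>z. 2 * c * w\<theta> z)" "cylfun (\<lambda>z. c\<^sup>2)" "cylfun (\<lambda>z. w\<theta> z * w\<theta> z - 2 * c * w\<theta> z)"
    by (intro cylfun_intros cylfun_w)+
  have "(\<lambda>z. (w\<theta> z - c)\<^sup>2) = (\<lambda>z. w\<theta> z * w\<theta> z - 2 * c * w\<theta> z + c\<^sup>2)" by (auto simp: power2_eq_square algebra_simps)
  then have "circ (\<lambda>z. (w\<theta> z - c)\<^sup>2) t = A t - 2 * c * circ w\<theta> t + 2 * pi * c\<^sup>2"
    using circ_add[OF cylfun_continuous[OF cg(4)] cylfun_continuous[OF cg(3)] t]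
      circ_diff[OF cylfun_continuous[OF cg(1)] cylfun_continuous[OF cg(2)] t]
    by (simp add: A_def circ_cmult circ_const)
  then have 2: "A t \<le> circ (\<lambda>z. (w\<theta> z - c)\<^sup>2) t" by (simp add: mean)
  have "(9 / 10)\<^sup>2 * A t \<le> ?k\<^sup>2 * circ (\<lambda>z. (w\<theta> z - c)\<^sup>2) t"
    by (rule mult_mono[OF _ 2]) (use A_nonneg[OF t] in \<open>simp_all add: power2_eq_square\<close>)
  with c 1 show ?thesis by linarith
qed

text \<open>By the decay of the gradient, the square of \<open>w\<^sub>t\<^sub>t + w\<^sub>\<theta>\<^sub>\<theta>\<close> is at most \<open>M exp (2 t / 5) nJ\<close>. Since \<open>- cJ\<close>
is the derivative of \<open>S\<close>, and \<open>S\<close> decays like \<open>exp (- 8 t / 5)\<close>, the integral of this bound over a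
circle is at most \<open>- N'\<close> for a decaying function \<open>N\<close>. The decay of the gradient also gives
\<open>A = O(exp (2 t / 5))\<close>, and \<open>2/5 < 9/10\<close>.\<close>

lemma oscillation_energy_tendsto_0: "(A \<longlongrightarrow> 0) at_top"
proof -
  obtain K where K: "K \<ge> 0" "\<And>t \<theta>. T + 2 < t \<Longrightarrow> \<theta> \<in> {0..2 * pi} \<Longrightarrow>
      \<bar>p (t, \<theta>)\<bar> \<le> K * exp (- (4 / 5) * t) \<and> \<bar>q (t, \<theta>)\<bar> \<le> K * exp (- (4 / 5) * t)"
    using gradient_decay by blast
  have pq: "exp (2 * t) * ((p (t, \<theta>))\<^sup>2 + (q (t, \<theta>))\<^sup>2) \<le> 2 * K\<^sup>2 * exp (2 / 5 * t)"
    if "T + 2 < t" "\<theta> \<in> {0..2 * pi}" for t \<theta>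
  proof -
    let ?x = "exp (- (4 / 5) * t)"
    have "\<bar>p (t, \<theta>)\<bar>\<^sup>2 \<le> (K * ?x)\<^sup>2" "\<bar>q (t, \<theta>)\<bar>\<^sup>2 \<le> (K * ?x)\<^sup>2"
      by (intro power_mono; use K(2)[OF that] in simp)+
    then have "(p (t, \<theta>))\<^sup>2 + (q (t, \<theta>))\<^sup>2 \<le> 2 * K\<^sup>2 * (?x * ?x)" by (simp add: power2_eq_square algebra_simps)
    then have "exp (2 * t) * ((p (t, \<theta>))\<^sup>2 + (q (t, \<theta>))\<^sup>2) \<le> exp (2 * t) * (2 * K\<^sup>2 * (?x * ?x))"
      by (rule mult_left_mono) simp
    also have "\<dots> = 2 * K\<^sup>2 * (exp (2 * t) * (?x * ?x))" by simp
    also have "exp (2 * t) * (?x * ?x) = exp (2 / 5 * t)" unfolding exp_add[symmetric]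
      by (rule arg_cong[where f = exp]) simp
    finally show ?thesis .
  qed
  define M where "M = 6 * C * K\<^sup>2"
  have M: "M \<ge> 0" using C by (simp add: M_def)
  have L: "circ (\<lambda>z. (wtt z + w\<theta>\<theta> z)\<^sup>2) t \<le> M * exp (2 / 5 * t) * cJ t" if t: "T + 2 < t" for t
  proof -
    have tT: "T < t" using t by simp
    have "(wtt (t, \<theta>) + w\<theta>\<theta> (t, \<theta>))\<^sup>2 \<le> M * exp (2 / 5 * t) * nJ (t, \<theta>)" if \<theta>: "\<theta> \<in> {0..2 * pi}" for \<theta>
    proof -
      let ?z = "(t, \<theta>)"
      let ?r = "(ec ?z)\<^sup>2 + (es ?z)\<^sup>2" and ?H = "(wxx ?z)\<^sup>2 + 2 * (wxy ?z)\<^sup>2 + (wyy ?z)\<^sup>2" and ?g = "(p ?z)\<^sup>2 + (q ?z)\<^sup>2"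
      have z: "?z \<in> cylinder T" using tT by simp
      have "(wtt ?z + w\<theta>\<theta> ?z)\<^sup>2 = ?r\<^sup>2 * (wxx ?z + wyy ?z)\<^sup>2" unfolding laplace_cylinder by (simp add: power_mult_distrib)
      also have "\<dots> \<le> ?r\<^sup>2 * (C * ?g * ?H)" by (rule mult_left_mono[OF laplace_E(1)[OF z]]) simp
      also have "\<dots> = C * (?r * ?g) * H2 ?z" unfolding H2_def power2_eq_square[of ?r] by (simp only: mult_ac)
      also have "\<dots> \<le> C * (2 * K\<^sup>2 * exp (2 / 5 * t)) * (3 * nJ ?z)"
      proof (rule mult_mono)
        show "C * (?r * ?g) \<le> C * (2 * K\<^sup>2 * exp (2 / 5 * t))"
          using pq[OF t \<theta>] C unfolding ec_es_sq fst_conv by (rule mult_left_mono)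
      qed (use H2_le[OF z] C in auto)
      also have "\<dots> = M * exp (2 / 5 * t) * nJ ?z" by (simp add: M_def)
      finally show ?thesis .
    qed
    then have "circ (\<lambda>z. (wtt z + w\<theta>\<theta> z)\<^sup>2) t \<le> circ (\<lambda>z. M * exp (2 / 5 * t) * nJ z) t"
      unfolding circ_def
      by (intro integral_le circ_integrable[OF _ tT] cylfun_continuous cylfun_intros cylfun_w cylfun_nJ)
    then show ?thesis unfolding circ_cmult cJ_def .
  qed
  define N where "N = (\<lambda>t. M * (exp (2 / 5 * t) * S t + CS / 3 * exp (- (6 / 5) * t)))"
  define N' where "N' = (\<lambda>t. M * (2 / 5 * exp (2 / 5 * t) * S t - exp (2 / 5 * t) * cJ t - 2 / 5 * CS * exp (- (6 / 5) * t)))"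
  have N: "(N has_real_derivative N' t) (at t)" if "T < t" for t
    unfolding N_def N'_def
    by (rule derivative_eq_intros refl S_derivative[OF that] | simp add: algebra_simps)+
  have eS: "exp (2 / 5 * t) * S t \<le> CS * exp (- (6 / 5) * t)" if t: "T + 1 \<le> t" for t
  proof -
    have "exp (2 / 5 * t) * S t \<le> exp (2 / 5 * t) * (CS * exp (- (8 / 5) * t))"
      by (rule mult_left_mono[OF S_decay[OF t]]) simp
    also have "\<dots> = CS * (exp (2 / 5 * t) * exp (- (8 / 5) * t))" by simp
    also have "exp (2 / 5 * t) * exp (- (8 / 5) * t) = exp (- (6 / 5) * t)"
      unfolding exp_add[symmetric] by (rule arg_cong[where f = exp]) simp
    finally show ?thesis .
  qed
  have N'_le: "N' t \<le> - circ (\<lambda>z. (wtt z + w\<theta>\<theta> z)\<^sup>2) t" if t: "T + 2 < t" for t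
  proof -
    have "2 / 5 * exp (2 / 5 * t) * S t - exp (2 / 5 * t) * cJ t - 2 / 5 * CS * exp (- (6 / 5) * t) \<le> - (exp (2 / 5 * t) * cJ t)"
    proof -
      have "exp (2 / 5 * t) * S t \<le> CS * exp (- (6 / 5) * t)" by (rule eS) (use t in simp)
      then show ?thesis unfolding mult.assoc by linarith
    qed
    then have "N' t \<le> M * (- (exp (2 / 5 * t) * cJ t))" unfolding N'_def by (rule mult_left_mono[OF _ M])
    then show ?thesis using L[OF t] by (simp add: mult.assoc)
  qed
  have N_nonneg: "0 \<le> N t" if "T < t" for t
    unfolding N_def using S_nonneg[OF that] CS_nonneg M by simp
  show ?thesis
  proof (rule second_order_decay[where T = "T + 2" and k = "9 / 10" and N = N and N' = N' and \<beta> = "2 / 5"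
        and K = "4 * pi * K\<^sup>2"])
    show "(A has_real_derivative 2 * circ (\<lambda>z. w\<theta> z * wt\<theta> z) t) (at t)" if "T + 2 < t" for t
      by (rule A_derivative) (use that in simp)
    show "((\<lambda>t. 2 * circ (\<lambda>z. w\<theta> z * wt\<theta> z) t) has_real_derivative
       2 * circ (\<lambda>z. wt\<theta> z * wt\<theta> z - w\<theta>\<theta> z * wtt z) t) (at t)" if "T + 2 < t" for t
      by (rule A_second_derivative) (use that in simp)
    show "(N has_real_derivative N' t) (at t)" if "T + 2 < t" for t
      by (rule N) (use that in simp)
    show "(9 / 10)\<^sup>2 * A t + N' t \<le> 2 * circ (\<lambda>z. wt\<theta> z * wt\<theta> z - w\<theta>\<theta> z * wtt z) t" if "T + 2 < t" for t
      using A_convexity[of t] N'_le[OF that] that by linarith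
    show "0 \<le> A t" "0 \<le> N t" if "T + 2 < t" for t using A_nonneg N_nonneg that by simp_all
    show "(N \<longlongrightarrow> 0) at_top"
    proof (rule tendsto_sandwich[OF _ _ tendsto_const])
      show "eventually (\<lambda>t. 0 \<le> N t) at_top" using eventually_gt_at_top[of T] by eventually_elim (rule N_nonneg)
      show "eventually (\<lambda>t. N t \<le> M * (4 / 3 * CS) * exp (- (6 / 5) * t)) at_top"
        using eventually_ge_at_top[of "T + 1"]
      proof eventually_elim
        case (elim t)
        have "exp (2 / 5 * t) * S t + CS / 3 * exp (- (6 / 5) * t) \<le> 4 / 3 * CS * exp (- (6 / 5) * t)"
          using eS[OF elim] by simp
        from mult_left_mono[OF this M] show ?case by (simp add: N_def mult.assoc)
      qed
      have "((\<lambda>t. M * (4 / 3 * CS) * exp (- (6 / 5) * t)) \<longlongrightarrow> M * (4 / 3 * CS) * 0) at_top"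
        by (intro tendsto_mult tendsto_const exp_neg_tendsto_0) simp
      then show "((\<lambda>t. M * (4 / 3 * CS) * exp (- (6 / 5) * t)) \<longlongrightarrow> 0) at_top" by simp
    qed
    show "A t \<le> 4 * pi * K\<^sup>2 * exp (2 / 5 * t)" if t: "T + 2 < t" for t
    proof -
      have tT: "T < t" using t by simp
      have "w\<theta> (t, \<theta>) * w\<theta> (t, \<theta>) \<le> 2 * K\<^sup>2 * exp (2 / 5 * t)" if "\<theta> \<in> {0..2 * pi}" for \<theta>
        using w\<theta>_sq_le[of "(t, \<theta>)"] pq[OF t that] by (simp add: power2_eq_square)
      then have "A t \<le> circ (\<lambda>z. 2 * K\<^sup>2 * exp (2 / 5 * t)) t"
        unfolding A_def circ_def
        by (intro integral_le circ_integrable[OF _ tT] cylfun_continuous cylfun_intros cylfun_w)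
      then show ?thesis by (simp add: circ_const)
    qed
  qed auto
qed

lemma polar_cases:
  assumes "norm x = exp t"
  obtains \<theta> where "\<theta> \<in> {0..2 * pi}" "x = (ec (t, \<theta>), es (t, \<theta>))"
proof -
  have "(fst x / exp t)\<^sup>2 + (snd x / exp t)\<^sup>2 = ((fst x)\<^sup>2 + (snd x)\<^sup>2) / (exp t)\<^sup>2"
    by (simp add: power_divide add_divide_distrib)
  also have "\<dots> = 1" unfolding norm_sq_coords[symmetric] assms by simp
  finally obtain \<theta> where \<theta>: "0 \<le> \<theta>" "\<theta> < 2 * pi" "fst x / exp t = cos \<theta>" "snd x / exp t = sin \<theta>"
    using sincos_total_2pi by metis
  then have "fst x = exp t * cos \<theta>" "snd x = exp t * sin \<theta>" by (simp_all add: field_simps)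
  then show ?thesis using \<theta> by (intro that[of \<theta>]) (auto simp: ec_def es_def prod_eq_iff)
qed

lemma oscillation_on_circles:
  assumes \<eta>: "0 < \<eta>"
  shows "\<exists>\<rho>. \<forall>x y. \<rho> < norm x \<longrightarrow> norm x = norm y \<longrightarrow> \<bar>D 0 0 x - D 0 0 y\<bar> \<le> \<eta>"
proof -
  define e where "e = \<eta> / (2 * pi)"
  have e: "e > 0" using \<eta> by (simp add: e_def)
  have "eventually (\<lambda>t. A t < \<eta> * e) at_top"
    using order_tendstoD(2)[OF oscillation_energy_tendsto_0, of "\<eta> * e"] \<eta> e by simp
  then obtain s where s: "\<And>t. s \<le> t \<Longrightarrow> A t < \<eta> * e" unfolding eventually_at_top_linorder by blast
  have "\<bar>D 0 0 x - D 0 0 y\<bar> \<le> \<eta>" if x: "exp (max s T) < norm x" and y: "norm x = norm y" for x y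
  proof -
    define t where "t = ln (norm x)"
    have n0: "norm x > 0" using x exp_gt_zero[of "max s T"] by linarith
    then have nx: "norm x = exp t" by (simp add: t_def)
    have t: "s \<le> t" "T < t" using x unfolding nx exp_less_cancel_iff by auto
    obtain \<alpha> where \<alpha>: "\<alpha> \<in> {0..2 * pi}" "x = (ec (t, \<alpha>), es (t, \<alpha>))" using polar_cases[OF nx] .
    obtain \<beta> where \<beta>: "\<beta> \<in> {0..2 * pi}" "y = (ec (t, \<beta>), es (t, \<beta>))" using polar_cases[of y t] nx y by metis
    have "\<bar>w (t, \<alpha>) - w (t, \<beta>)\<bar> \<le> pi * e + circ (\<lambda>z. (w\<theta> z)\<^sup>2) t / (2 * e)"
      by (rule circ_oscillation[OF partials_w cylfun_continuous[OF cylfun_w(2)] t(2) e \<alpha>(1) \<beta>(1)])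
    also have "circ (\<lambda>z. (w\<theta> z)\<^sup>2) t = A t" by (simp add: A_def power2_eq_square)
    also have "A t / (2 * e) \<le> \<eta> * e / (2 * e)" by (rule divide_right_mono) (use s[OF t(1)] e in auto)
    also have "pi * e + \<eta> * e / (2 * e) = \<eta>" using e by (simp add: e_def)
    finally show ?thesis by (simp add: E_def \<alpha>(2) \<beta>(2))
  qed
  then show ?thesis by blast
qed

end

section \<open>Stream functions of elliptic type\<close>

lemma eventually_at_infinity_real_prod:
  "eventually P (at_infinity :: (real \<times> real) filter) \<longleftrightarrow> (\<exists>b. \<forall>x. b < norm x \<longrightarrow> P x)"
  unfolding eventually_at_infinity by (meson less_imp_le gt_ex order_less_le_trans)

text \<open>A horizontal ray from a point of \<open>B\<close> leaves \<open>B\<close> and so meets the frontier at the same height.\<close>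

lemma body_within_line:
  fixes B :: "(real \<times> real) set"
  assumes B: "bounded B" and fr: "frontier B \<subseteq> {x. snd x = y0}"
  shows "B \<subseteq> {x. snd x = y0}"
proof
  fix x assume x: "x \<in> B"
  obtain b where b: "\<And>z. z \<in> B \<Longrightarrow> norm z \<le> b" using B by (auto simp: bounded_iff)
  define z where "z = (\<bar>b\<bar> + 1, snd x)"
  have "norm z \<ge> \<bar>fst z\<bar>" using norm_fst_le[of "fst z" "snd z"] by simp
  then have "z \<notin> B" using b[of z] by (auto simp: z_def)
  then have "closed_segment x z \<inter> frontier B \<noteq> {}"
    by (intro connected_Int_frontier) (use x in auto)
  then obtain w where w: "w \<in> closed_segment x z" "w \<in> frontier B" by blast
  then obtain t where "w = (1 - t) *\<^sub>R x + t *\<^sub>R z" by (auto simp: in_segment)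
  then have "snd w = (1 - t) * snd x + t * snd z" by simp
  then have "snd w = snd x" by (simp add: z_def algebra_simps)
  with w fr show "x \<in> {x. snd x = y0}" by auto
qed

text \<open>The common features of both kinds of flow. At infinity, \<open>\<beta>\<^sup>2 \<psi>\<^sub>x\<^sub>x + \<psi>\<^sub>y\<^sub>y = 0\<close> is the limit of the
equation, where \<open>\<beta>\<^sup>2\<close> is 1 minus the squared Mach number at infinity. The assumption \<open>asymptotic\<close>
expresses that the coefficients converge at least as fast as the gradient of \<open>\<psi>\<close>.\<close>

locale elliptic_stream = elliptic_operator "- B" lam a b c
  for B :: "(real \<times> real) set" and lam and a b c :: "real \<times> real \<Rightarrow> real" +
  fixes \<psi> :: "real \<times> real \<Rightarrow> real" and m M \<beta> C R :: real
  assumes body: "bounded B" "closed B" "connected (- B)"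
    and smooth: "smooth_in (- B) \<psi>"
    and pde: "\<And>x. x \<in> - B \<Longrightarrow> a x * partial_xy 2 0 \<psi> x + 2 * b x * partial_xy 1 1 \<psi> x + c x * partial_xy 0 2 \<psi> x = 0"
    and slip: "slip_condition B \<psi>"
    and bounded_gradient: "\<And>x. x \<in> - B \<Longrightarrow> \<bar>partial_xy 1 0 \<psi> x\<bar> \<le> M \<and> \<bar>partial_xy 0 1 \<psi> x\<bar> \<le> M"
    and m: "0 \<le> m"
    and limit: "(partial_xy 1 0 \<psi> \<longlongrightarrow> 0) at_infinity" "(partial_xy 0 1 \<psi> \<longlongrightarrow> m) at_infinity"
    and \<beta>: "0 < \<beta>" "\<beta> \<le> 1" and C: "0 \<le> C"
    and asymptotic: "\<And>x. R < norm x \<Longrightarrow> (\<beta>\<^sup>2 * partial_xy 2 0 \<psi> x + partial_xy 0 2 \<psi> x)\<^sup>2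
       \<le> C * ((partial_xy 1 0 \<psi> x)\<^sup>2 + (partial_xy 0 1 \<psi> x - m)\<^sup>2) * ((partial_xy 2 0 \<psi> x)\<^sup>2 + (partial_xy 1 1 \<psi> x)\<^sup>2)"
begin

text \<open>The Prandtl-Glauert transformation: it turns the limit of the equation at infinity into Laplace's
equation.\<close>

definition squeeze :: "real \<times> real \<Rightarrow> real \<times> real" where "squeeze z = (\<beta> * fst z, snd z)"
definition unsqueeze :: "real \<times> real \<Rightarrow> real \<times> real" where "unsqueeze x = (fst x / \<beta>, snd x)"

lemma squeeze_unsqueeze: "squeeze (unsqueeze x) = x"
  using \<beta> by (simp add: squeeze_def unsqueeze_def)

lemma norm_le_unsqueeze: "norm x \<le> norm (unsqueeze x)"
proof -
  have "\<bar>fst x\<bar> \<le> \<bar>fst x / \<beta>\<bar>" using \<beta> by (simp add: abs_divide pos_le_divide_eq mult_left_le)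
  then have "(fst x)\<^sup>2 \<le> (fst x / \<beta>)\<^sup>2" unfolding abs_le_square_iff .
  then have "(norm x)\<^sup>2 \<le> (norm (unsqueeze x))\<^sup>2" by (simp add: norm_sq_coords unsqueeze_def)
  then show ?thesis by (rule power2_le_imp_le) simp
qed

lemma norm_squeeze: "\<beta> * norm z \<le> norm (squeeze z)"
proof -
  have "\<beta>\<^sup>2 \<le> 1" using \<beta> by (simp add: power_le_one)
  then have "\<beta>\<^sup>2 * (snd z)\<^sup>2 \<le> 1 * (snd z)\<^sup>2" by (rule mult_right_mono) simp
  then have "(\<beta> * norm z)\<^sup>2 \<le> (norm (squeeze z))\<^sup>2"
    by (simp add: power_mult_distrib norm_sq_coords squeeze_def distrib_left)
  then show ?thesis by (rule power2_le_imp_le) simp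
qed

lemma squeeze_at_infinity: "filterlim squeeze at_infinity at_infinity"
  unfolding filterlim_at_infinity_conv_norm_at_top
proof (rule filterlim_at_top_mono)
  show "filterlim (\<lambda>z. \<beta> * norm z) at_top (at_infinity :: (real \<times> real) filter)"
    by (rule filterlim_tendsto_pos_mult_at_top[OF tendsto_const \<beta>(1) filterlim_norm_at_top])
qed (simp add: norm_squeeze)

text \<open>The perturbation of the uniform flow at infinity.\<close>

definition W where "W x = \<psi> x - m * snd x"

lemma partials_\<psi>: "has_partials (- B) (partial_xy i j \<psi>) (partial_xy (Suc i) j \<psi>) (partial_xy i (Suc j) \<psi>)"
  by (rule smooth_in_has_partials[OF open_domain smooth])

lemma hessian_\<psi>: "has_hessian (- B) \<psi> (partial_xy 1 0 \<psi>) (partial_xy 0 1 \<psi>) (partial_xy 2 0 \<psi>) (partial_xy 1 1 \<psi>) (partial_xy 0 2 \<psi>)"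
  using partials_\<psi>[of 0 0] partials_\<psi>[of 1 0] partials_\<psi>[of 0 1]
  by (simp add: has_hessian_def numeral_2_eq_2) (simp add: partial_xy_def)

lemma hessian_affine_combination:
  "has_hessian (- B) (\<lambda>x. s * \<psi> x + (0 * fst x + k * snd x + l)) (\<lambda>x. s * partial_xy 1 0 \<psi> x + 0)
    (\<lambda>x. s * partial_xy 0 1 \<psi> x + k) (\<lambda>x. s * partial_xy 2 0 \<psi> x + 0) (\<lambda>x. s * partial_xy 1 1 \<psi> x + 0) (\<lambda>x. s * partial_xy 0 2 \<psi> x + 0)"
  by (rule has_hessian_add[OF has_hessian_cmult[OF hessian_\<psi>] has_hessian_affine])

lemma pde_affine_combination:
  "x \<in> - B \<Longrightarrow> a x * (s * partial_xy 2 0 \<psi> x + 0) + 2 * b x * (s * partial_xy 1 1 \<psi> x + 0)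
     + c x * (s * partial_xy 0 2 \<psi> x + 0) = 0"
proof -
  assume "x \<in> - B"
  then have "s * (a x * partial_xy 2 0 \<psi> x + 2 * b x * partial_xy 1 1 \<psi> x + c x * partial_xy 0 2 \<psi> x) = 0"
    using pde by simp
  then show ?thesis by (simp add: algebra_simps)
qed

text \<open>The derivatives of \<open>W \<circ> squeeze\<close>.\<close>

definition D :: "nat \<Rightarrow> nat \<Rightarrow> real \<times> real \<Rightarrow> real" where
  "D i j z = \<beta> ^ i * partial_xy i j \<psi> (\<beta> * fst z, snd z) -
     (if i = 0 \<and> j = 0 then m * snd z else if i = 0 \<and> j = 1 then m else 0)"

lemma partials_D:
  assumes U: "\<And>z. z \<in> U \<Longrightarrow> squeeze z \<in> - B"
  shows "has_partials U (D i j) (D (Suc i) j) (D i (Suc j))"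
proof -
  have 1: "has_partials U (\<lambda>z. \<beta> * fst z) (\<lambda>z. \<beta>) (\<lambda>z. 0)"
    by (rule has_partials_rhs[OF has_partials_cmult[OF has_partials_fst]]) auto
  have 2: "has_partials U (\<lambda>z. partial_xy i j \<psi> (\<beta> * fst z, snd z))
     (\<lambda>z. \<beta> * partial_xy (Suc i) j \<psi> (\<beta> * fst z, snd z)) (\<lambda>z. partial_xy i (Suc j) \<psi> (\<beta> * fst z, snd z))"
    by (rule has_partials_rhs[OF has_partials_compose[OF partials_\<psi> 1 has_partials_snd]])
       (use U in \<open>auto simp: squeeze_def\<close>)
  have 3: "has_partials U (\<lambda>z. if i = 0 \<and> j = 0 then m * snd z else if i = 0 \<and> j = 1 then m else 0)
     (\<lambda>z. 0) (\<lambda>z. if i = 0 \<and> j = 0 then m else 0)"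
  proof (cases "i = 0 \<and> j = 0")
    case True
    then show ?thesis
      by (simp, intro has_partials_rhs[OF has_partials_cmult[OF has_partials_snd]]) auto
  next
    case False
    then have "(\<lambda>z. if i = 0 \<and> j = 0 then m * snd z else if i = 0 \<and> j = 1 then m else 0)
        = (\<lambda>z :: real \<times> real. if i = 0 \<and> j = 1 then m else 0)"
      "(\<lambda>z :: real \<times> real. if i = 0 \<and> j = 0 then m else 0) = (\<lambda>z. 0)" by auto
    then show ?thesis by (simp only: has_partials_const)
  qed
  show ?thesis unfolding D_def[abs_def]
    by (rule has_partials_rhs[OF has_partials_diff[OF has_partials_cmult[OF 2] 3]]) auto
qed

lemma oscillation:
  assumes \<eta>: "0 < \<eta>"
  shows "\<exists>\<rho>. \<forall>x y. \<rho> < norm (unsqueeze x) \<longrightarrow> norm (unsqueeze x) = norm (unsqueeze y) \<longrightarrow> \<bar>W x - W y\<bar> \<le> \<eta>"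
proof -
  have D0: "D 0 0 (unsqueeze x) = W x" for x
    using \<beta> by (simp add: D_def W_def unsqueeze_def partial_xy_def)
  have D1: "D 1 0 z = \<beta> * partial_xy 1 0 \<psi> (squeeze z)" "D 0 1 z = partial_xy 0 1 \<psi> (squeeze z) - m"
    "D 2 0 z = \<beta>\<^sup>2 * partial_xy 2 0 \<psi> (squeeze z)" "D 1 1 z = \<beta> * partial_xy 1 1 \<psi> (squeeze z)"
    "D 0 2 z = partial_xy 0 2 \<psi> (squeeze z)" for z
    by (simp_all add: D_def squeeze_def)
  have De: "D 1 0 = (\<lambda>z. \<beta> * partial_xy 1 0 \<psi> (squeeze z))" "D 0 1 = (\<lambda>z. partial_xy 0 1 \<psi> (squeeze z) - m)"
    by (rule ext, rule D1(1)) (rule ext, rule D1(2))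
  have lim: "(D 1 0 \<longlongrightarrow> 0) at_infinity" "(D 0 1 \<longlongrightarrow> 0) at_infinity"
  proof -
    have "((\<lambda>z. \<beta> * partial_xy 1 0 \<psi> (squeeze z)) \<longlongrightarrow> \<beta> * 0) at_infinity"
      by (intro tendsto_mult tendsto_const filterlim_compose[OF limit(1) squeeze_at_infinity])
    then show "(D 1 0 \<longlongrightarrow> 0) at_infinity" unfolding De mult_zero_right .
    have "((\<lambda>z. partial_xy 0 1 \<psi> (squeeze z) - m) \<longlongrightarrow> m - m) at_infinity"
      by (intro tendsto_diff tendsto_const filterlim_compose[OF limit(2) squeeze_at_infinity])
    then show "(D 0 1 \<longlongrightarrow> 0) at_infinity" unfolding De diff_self .
  qed
  \<comment> \<open>the sixth power collects the factors \<open>\<beta>\<close> lost by the squared gradient (2) and by the squared Hessian (4)\<close>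
  define C' where "C' = C / \<beta> ^ 6"
  have C': "0 \<le> C'" using C \<beta> by (simp add: C'_def)
  have glim: "((\<lambda>z. (D 1 0 z)\<^sup>2 + (D 0 1 z)\<^sup>2) \<longlongrightarrow> 0\<^sup>2 + 0\<^sup>2) at_infinity"
    by (intro tendsto_intros lim)
  then have "eventually (\<lambda>z. (D 1 0 z)\<^sup>2 + (D 0 1 z)\<^sup>2 < 1 / (400 * (C' + 1))) at_infinity"
    by (rule order_tendstoD(2)) (use C' in simp)
  then obtain R1 where R1: "\<And>z. R1 < norm z \<Longrightarrow> (D 1 0 z)\<^sup>2 + (D 0 1 z)\<^sup>2 < 1 / (400 * (C' + 1))"
    unfolding eventually_at_infinity_real_prod by blast
  obtain R2 where R2: "\<And>x. x \<in> B \<Longrightarrow> norm x \<le> R2" using body(1) by (auto simp: bounded_iff)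
  define R' where "R' = Max {1, R1, R / \<beta>, R2 / \<beta>}"
  have R': "0 < R'" "R1 \<le> R'" "R / \<beta> \<le> R'" "R2 / \<beta> \<le> R'" by (auto simp: R'_def)
  have far: "R < norm (squeeze z)" "squeeze z \<in> - B" if z: "R' < norm z" for z
  proof -
    have "R / \<beta> < norm z" "R2 / \<beta> < norm z" using z R' by linarith+
    then have "R < \<beta> * norm z" "R2 < \<beta> * norm z" using \<beta> by (simp_all add: pos_divide_less_eq mult.commute)
    then have *: "R < norm (squeeze z)" "R2 < norm (squeeze z)" using norm_squeeze[of z] by linarith+
    then show "R < norm (squeeze z)" "squeeze z \<in> - B" using R2[of "squeeze z"] by auto
  qed
  interpret exterior_solution D R' C'
  proof
    show "0 < R'" by (rule R')
    show "0 \<le> C'" by (rule C')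
    show "has_partials {p. R' < norm p} (D i j) (D (Suc i) j) (D i (Suc j))" for i j
      by (rule partials_D) (use far in auto)
    show "(D 1 0 \<longlongrightarrow> 0) at_infinity" "(D 0 1 \<longlongrightarrow> 0) at_infinity" by (rule lim)+
    fix z :: "real \<times> real" assume z: "R' < norm z"
    let ?g = "(D 1 0 z)\<^sup>2 + (D 0 1 z)\<^sup>2"
    have g: "?g < 1 / (400 * (C' + 1))" using R1 z R' by simp
    have g0: "0 \<le> ?g" by simp
    have "0 < 400 * (C' + 1)" using C' by simp
    from g[unfolded pos_less_divide_eq[OF this]] have "400 * ((C' + 1) * ?g) \<le> 1"
      by (simp only: mult_ac less_imp_le)
    then have g1: "400 * (C' * ?g) + 400 * ?g \<le> 1" by (simp only: distrib_right mult_1 distrib_left)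
    have "0 \<le> C' * ?g" using C' by simp
    moreover define G where "G = ?g"
    ultimately have "G \<le> 1" "C' * G \<le> 1 / 400" using g1 g0 unfolding G_def[symmetric] by linarith+
    then show "?g \<le> 1" "C' * ?g \<le> 1 / 400" by (simp_all only: G_def)
    let ?x = "squeeze z"
    let ?xx = "partial_xy 2 0 \<psi> ?x" and ?xy = "partial_xy 1 1 \<psi> ?x" and ?yy = "partial_xy 0 2 \<psi> ?x"
    let ?x1 = "partial_xy 1 0 \<psi> ?x" and ?y1 = "partial_xy 0 1 \<psi> ?x - m"
    have b1: "\<beta>\<^sup>2 \<le> 1" using \<beta> by (simp add: power_le_one)
    have "\<beta>\<^sup>2 * ?y1\<^sup>2 \<le> 1 * ?y1\<^sup>2" by (rule mult_right_mono[OF b1]) simp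
    then have i1: "\<beta>\<^sup>2 * (?x1\<^sup>2 + ?y1\<^sup>2) \<le> ?g" unfolding D1 power_mult_distrib distrib_left by linarith
    have "\<beta>\<^sup>2 * (\<beta>\<^sup>2 * ?xy\<^sup>2) \<le> 1 * (\<beta>\<^sup>2 * ?xy\<^sup>2)" by (rule mult_right_mono[OF b1]) simp
    then have i3: "\<beta>\<^sup>2 * (\<beta>\<^sup>2 * ?xy\<^sup>2) \<le> \<beta>\<^sup>2 * ?xy\<^sup>2" by simp
    have i4: "0 \<le> \<beta>\<^sup>2 * ?xy\<^sup>2" "0 \<le> ?yy\<^sup>2" by simp_all
    have i2: "\<beta>\<^sup>2 * \<beta>\<^sup>2 * (?xx\<^sup>2 + ?xy\<^sup>2) \<le> (D 2 0 z)\<^sup>2 + 2 * (D 1 1 z)\<^sup>2 + (D 0 2 z)\<^sup>2"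
    proof -
      have "\<beta>\<^sup>2 * \<beta>\<^sup>2 * (?xx\<^sup>2 + ?xy\<^sup>2) = (\<beta>\<^sup>2 * ?xx)\<^sup>2 + \<beta>\<^sup>2 * (\<beta>\<^sup>2 * ?xy\<^sup>2)"
        "(\<beta> * ?xy)\<^sup>2 = \<beta>\<^sup>2 * ?xy\<^sup>2" by algebra+
      then show ?thesis unfolding D1 using i3 i4 by linarith
    qed
    have "(D 2 0 z + D 0 2 z)\<^sup>2 \<le> C * (?x1\<^sup>2 + ?y1\<^sup>2) * (?xx\<^sup>2 + ?xy\<^sup>2)"
      using asymptotic[OF far(1)[OF z]] unfolding D1 .
    also have "\<dots> = C' * (\<beta>\<^sup>2 * (?x1\<^sup>2 + ?y1\<^sup>2)) * (\<beta>\<^sup>2 * \<beta>\<^sup>2 * (?xx\<^sup>2 + ?xy\<^sup>2))"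
    proof -
      have "C = C' * (\<beta>\<^sup>2 * (\<beta>\<^sup>2 * \<beta>\<^sup>2))" using \<beta> by (simp add: C'_def eval_nat_numeral)
      then show ?thesis by (simp only: mult_ac)
    qed
    also have "\<dots> \<le> C' * ?g * ((D 2 0 z)\<^sup>2 + 2 * (D 1 1 z)\<^sup>2 + (D 0 2 z)\<^sup>2)"
      by (intro mult_mono i2 mult_left_mono[OF i1 C']) (use C' in simp_all)
    finally show "(D 2 0 z + D 0 2 z)\<^sup>2 \<le> C' * ?g * ((D 2 0 z)\<^sup>2 + 2 * (D 1 1 z)\<^sup>2 + (D 0 2 z)\<^sup>2)" .
  qed
  from oscillation_on_circles[OF \<eta>] obtain \<rho> where
    \<rho>: "\<And>x y. \<rho> < norm x \<Longrightarrow> norm x = norm y \<Longrightarrow> \<bar>D 0 0 x - D 0 0 y\<bar> \<le> \<eta>" by blast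
  have "\<bar>W x - W y\<bar> \<le> \<eta>" if "\<rho> < norm (unsqueeze x)" "norm (unsqueeze x) = norm (unsqueeze y)" for x y
    using \<rho>[OF that] by (simp add: D0)
  then show ?thesis by blast
qed

text \<open>Otherwise there are circles, in the squeezed coordinates, on which \<open>W\<close> is below \<open>k\<close>, then above \<open>l\<close>,
then below \<open>k\<close> again, as its oscillation over each of them is small. This contradicts the maximum
principle on the annulus between the first and the last.\<close>

lemma one_sided_at_infinity:
  assumes kl: "k \<le> l"
  shows "(\<forall>\<eta>>0. \<exists>\<rho>. \<forall>x. \<rho> < norm x \<longrightarrow> k - \<eta> < W x) \<or> (\<forall>\<eta>>0. \<exists>\<rho>. \<forall>x. \<rho> < norm x \<longrightarrow> W x < l + \<eta>)"
proof (rule ccontr)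
  assume "\<not> ?thesis"
  then obtain \<eta>1 \<eta>2 where \<eta>1: "\<eta>1 > 0" "\<And>\<rho>. \<exists>x. \<rho> < norm x \<and> W x \<le> k - \<eta>1"
    and \<eta>2: "\<eta>2 > 0" "\<And>\<rho>. \<exists>x. \<rho> < norm x \<and> l + \<eta>2 \<le> W x" by (meson not_less)
  define \<eta> where "\<eta> = \<eta>1 / 2"
  have \<eta>: "\<eta> > 0" using \<eta>1 by (simp add: \<eta>_def)
  obtain \<rho> where \<rho>: "\<And>x y. \<rho> < norm (unsqueeze x) \<Longrightarrow> norm (unsqueeze x) = norm (unsqueeze y) \<Longrightarrow> \<bar>W x - W y\<bar> \<le> \<eta>"
    using oscillation[OF \<eta>] by blast
  obtain R2 where R2: "\<And>x. x \<in> B \<Longrightarrow> norm (unsqueeze x) \<le> R2"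
  proof -
    obtain r where r: "\<And>x. x \<in> B \<Longrightarrow> norm x \<le> r" using body(1) by (auto simp: bounded_iff)
    have "\<beta> * norm (unsqueeze x) \<le> r" if "x \<in> B" for x
      using norm_squeeze[of "unsqueeze x"] r[OF that] by (simp add: squeeze_unsqueeze)
    then have "norm (unsqueeze x) \<le> r / \<beta>" if "x \<in> B" for x using \<beta> that by (simp add: pos_le_divide_eq mult.commute)
    then show ?thesis by (rule that)
  qed
  let ?N = "\<lambda>x. norm (unsqueeze x)"
  have pick: "\<exists>x. r < ?N x \<and> W x \<le> k - \<eta>1" "\<exists>x. r < ?N x \<and> l + \<eta>2 \<le> W x" for r
    using \<eta>1(2)[of r] \<eta>2(2)[of r] norm_le_unsqueeze order_less_le_trans by blast+
  obtain x1 where x1: "max \<rho> R2 < ?N x1" "W x1 \<le> k - \<eta>1" using pick(1) by blast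
  obtain x2 where x2: "?N x1 < ?N x2" "l + \<eta>2 \<le> W x2" using pick(2) by blast
  obtain x3 where x3: "?N x2 < ?N x3" "W x3 \<le> k - \<eta>1" using pick(1) by blast
  define S where "S = {x. ?N x1 \<le> ?N x \<and> ?N x \<le> ?N x3}"
  have Nc: "continuous_on X ?N" for X
    unfolding unsqueeze_def divide_inverse by (intro continuous_intros)
  have "closed S" unfolding S_def by (intro closed_Collect_conj closed_Collect_le continuous_intros Nc)
  moreover have "bounded S" unfolding bounded_iff S_def
    by (rule exI[of _ "?N x3"]) (use norm_le_unsqueeze order_trans in blast)
  ultimately have cS: "compact S" by (simp add: compact_eq_bounded_closed)
  have SB: "S \<subseteq> - B" using R2 x1 by (force simp: S_def)
  then have iS: "interior S \<subseteq> - B" using interior_subset by blast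
  have frS: "?N x = ?N x1 \<or> ?N x = ?N x3" if "x \<in> frontier S" for x
  proof (rule ccontr)
    assume ne: "\<not> ?thesis"
    have pS: "x \<in> S" using that cS compact_imp_closed frontier_subset_closed by blast
    define O1 where "O1 = {x. ?N x1 < ?N x \<and> ?N x < ?N x3}"
    have "open O1" unfolding O1_def by (intro open_Collect_conj open_Collect_less continuous_intros Nc)
    moreover have "O1 \<subseteq> S" by (auto simp: O1_def S_def)
    moreover have "x \<in> O1" using ne pS by (auto simp: O1_def S_def)
    ultimately have "x \<in> interior S" by (meson interiorI)
    with that show False by (simp add: frontier_def)
  qed
  have "0 \<le> (- 1) * \<psi> x2 + (0 * fst x2 + m * snd x2 + (k - \<eta>))"
  proof (rule minimum_principle[OF cS iS _ has_hessian_subset[OF hessian_affine_combination iS]])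
    show "continuous_on S (\<lambda>x. (- 1) * \<psi> x + (0 * fst x + m * snd x + (k - \<eta>)))"
      using has_hessian_continuous_on[OF hessian_affine_combination] SB by (rule continuous_on_subset)
    show "x2 \<in> S" using x2 x3 by (simp add: S_def)
    show "0 \<le> (- 1) * \<psi> x + (0 * fst x + m * snd x + (k - \<eta>))" if "x \<in> frontier S" for x
    proof -
      have "W x \<le> k - \<eta>1 + \<eta>"
        using frS[OF that] \<rho>[of x1 x] \<rho>[of x3 x] x1 x2 x3 by (smt (verit))
      then show ?thesis by (simp add: W_def \<eta>_def)
    qed
    show "a x * ((- 1) * partial_xy 2 0 \<psi> x + 0) + 2 * b x * ((- 1) * partial_xy 1 1 \<psi> x + 0) + c x * ((- 1) * partial_xy 0 2 \<psi> x + 0) \<le> 0"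
      if "x \<in> interior S" for x
      using pde_affine_combination[of x "- 1"] that iS by auto
  qed
  then have "W x2 \<le> k - \<eta>" by (simp add: W_def)
  with x2(2) kl \<eta> \<eta>2(1) show False by linarith
qed

text \<open>Applied with \<open>s = 1\<close> at the highest corner and with \<open>s = -1\<close> at the lowest one.\<close>

lemma vanishes_if_signed_at_infinity:
  assumes corner: "protruding_corner B y"
    and bd: "\<And>x. x \<in> B \<Longrightarrow> 0 \<le> s * (m * (snd y - snd x))"
    and inf: "\<And>\<eta>. \<eta> > 0 \<Longrightarrow> \<exists>\<rho>. \<forall>x. \<rho> < norm x \<longrightarrow> - \<eta> < s * (W x + m * snd y)"
    and x: "x \<in> - B"
  shows "s * (W x + m * snd y) = 0"
proof -
  define u where "u = (\<lambda>x. s * \<psi> x + (0 * fst x + (- s * m) * snd x + s * m * snd y))"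
  have ueq: "u x = s * (W x + m * snd y)" for x by (simp add: u_def W_def algebra_simps)
  note H = hessian_affine_combination[of s "- s * m" "s * m * snd y", folded u_def]
  have frsub: "frontier B \<subseteq> B" by (rule frontier_subset_closed[OF body(2)])
  have blim: "(u \<longlongrightarrow> s * (m * (snd y - snd q))) (at q within - B)" if "q \<in> frontier B" for q
  proof -
    have "(\<psi> \<longlongrightarrow> 0) (at q within - B)" using slip that by (simp add: slip_condition_def)
    then have "(u \<longlongrightarrow> s * 0 + (0 * fst q + (- s * m) * snd q + s * m * snd y)) (at q within - B)"
      unfolding u_def by (intro tendsto_intros tendsto_fst tendsto_snd)
    then show ?thesis by (simp add: algebra_simps)
  qed
  have nonneg: "0 \<le> u x" if "x \<in> - B" for x
  proof (rule exterior_minimum_principle[OF H pde_affine_combination _ _ that])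
    show "eventually (\<lambda>x. - e < u x) (at q within - B)" if "q \<in> frontier (- B)" "e > 0" for q e
    proof (rule order_tendstoD(1)[OF blim])
      show "q \<in> frontier B" using that by simp
      then have "0 \<le> s * (m * (snd y - snd q))" using bd frsub by blast
      then show "- e < s * (m * (snd y - snd q))" using that(2) by linarith
    qed
    show "\<exists>R. \<forall>x\<in>- B. norm x > R \<longrightarrow> - e < u x" if "e > 0" for e
      using inf[OF that] unfolding ueq by blast
  qed
  obtain e \<kappa> r where cone: "(fst e)\<^sup>2 + (snd e)\<^sup>2 = 1" "0 < \<kappa>" "0 < r"
    "\<And>z. z \<noteq> 0 \<Longrightarrow> norm z < r \<Longrightarrow> - \<kappa> * norm z < fst e * fst z + snd e * snd z \<Longrightarrow> y + z \<in> - B"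
    using protruding_corner_cone[OF corner] by blast
  have yfr: "y \<in> frontier B" using corner by (simp add: protruding_corner_def)
  then have yB: "y \<in> B" using frsub by blast
  have "u x = 0"
  proof (rule nonneg_solution_at_corner_vanishes[OF H body(3) pde_affine_combination nonneg _ cone])
    show "\<bar>s * partial_xy 1 0 \<psi> x + 0\<bar> \<le> \<bar>s\<bar> * M + \<bar>s * m\<bar> \<and> \<bar>s * partial_xy 0 1 \<psi> x + - s * m\<bar> \<le> \<bar>s\<bar> * M + \<bar>s * m\<bar>"
      if "x \<in> - B" for x
    proof -
      have "\<bar>s\<bar> * \<bar>partial_xy 1 0 \<psi> x\<bar> \<le> \<bar>s\<bar> * M" "\<bar>s\<bar> * \<bar>partial_xy 0 1 \<psi> x\<bar> \<le> \<bar>s\<bar> * M"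
        using bounded_gradient[OF that] by (auto intro!: mult_left_mono)
      then have "\<bar>s * partial_xy 1 0 \<psi> x\<bar> \<le> \<bar>s\<bar> * M" "\<bar>s * partial_xy 0 1 \<psi> x\<bar> \<le> \<bar>s\<bar> * M"
        by (simp_all add: abs_mult)
      then show ?thesis unfolding mult_minus_left by linarith
    qed
    show "y \<notin> - B" using yB by simp
    show "(u \<longlongrightarrow> 0) (at y within - B)" using blim[OF yfr] by simp
  qed (use x in auto)
  then show ?thesis by (simp add: ueq)
qed

text \<open>One of the two functions \<open>W + m y\<^sub>h\<close> and \<open>W + m y\<^sub>l\<close> vanishes, so \<open>\<psi> = m (y - y0)\<close> with \<open>y0\<close> the height of
one of the corners. If \<open>m \<noteq> 0\<close>, the slip condition puts the whole frontier at height \<open>y0\<close>.\<close>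

lemma gradient_vanishes:
  assumes line: "\<nexists>y0. B \<subseteq> {x. snd x = y0}"
    and low: "protruding_corner B pl" "\<forall>x\<in>B. snd pl \<le> snd x"
    and high: "protruding_corner B ph" "\<forall>x\<in>B. snd x \<le> snd ph"
    and x: "x \<in> - B"
  shows "partial_xy 1 0 \<psi> x = 0 \<and> partial_xy 0 1 \<psi> x = 0"
proof -
  have "\<exists>y0. \<forall>x\<in>- B. W x + m * y0 = 0"
  proof -
    have "ph \<in> B" using high(1) frontier_subset_closed[OF body(2)] by (auto simp: protruding_corner_def)
    then have "m * snd pl \<le> m * snd ph" using low(2) m by (intro mult_left_mono) auto
    then have "- (m * snd ph) \<le> - (m * snd pl)" by simp
    from one_sided_at_infinity[OF this] show ?thesis
    proof
      assume *: "\<forall>\<eta>>0. \<exists>\<rho>. \<forall>x. \<rho> < norm x \<longrightarrow> - (m * snd ph) - \<eta> < W x"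
      have "1 * (W x + m * snd ph) = 0" if "x \<in> - B" for x
      proof (rule vanishes_if_signed_at_infinity[OF high(1) _ _ that])
        show "0 \<le> 1 * (m * (snd ph - snd x))" if "x \<in> B" for x using high(2) m that by simp
        show "\<exists>\<rho>. \<forall>x. \<rho> < norm x \<longrightarrow> - \<eta> < 1 * (W x + m * snd ph)" if "\<eta> > 0" for \<eta>
        proof -
          obtain \<rho> where \<rho>: "\<And>x. \<rho> < norm x \<Longrightarrow> - (m * snd ph) - \<eta> < W x" using * \<open>\<eta> > 0\<close> by blast
          have "- \<eta> < 1 * (W x + m * snd ph)" if "\<rho> < norm x" for x using \<rho>[OF that] by simp
          then show ?thesis by blast
        qed
      qed
      then show ?thesis by (intro exI[of _ "snd ph"]) auto
    next
      assume *: "\<forall>\<eta>>0. \<exists>\<rho>. \<forall>x. \<rho> < norm x \<longrightarrow> W x < - (m * snd pl) + \<eta>"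
      have "(- 1) * (W x + m * snd pl) = 0" if "x \<in> - B" for x
      proof (rule vanishes_if_signed_at_infinity[OF low(1) _ _ that])
        show "0 \<le> - 1 * (m * (snd pl - snd x))" if "x \<in> B" for x
          using mult_left_mono[OF low(2)[rule_format, OF that] m] by (simp add: algebra_simps)
        show "\<exists>\<rho>. \<forall>x. \<rho> < norm x \<longrightarrow> - \<eta> < - 1 * (W x + m * snd pl)" if "\<eta> > 0" for \<eta>
        proof -
          obtain \<rho> where \<rho>: "\<And>x. \<rho> < norm x \<Longrightarrow> W x < - (m * snd pl) + \<eta>" using * \<open>\<eta> > 0\<close> by blast
          have "- \<eta> < - 1 * (W x + m * snd pl)" if "\<rho> < norm x" for x using \<rho>[OF that] by simp
          then show ?thesis by blast
        qed
      qed
      then have "W x + m * snd pl = 0" if "x \<in> - B" for x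
        using that by (simp only: mult_minus_left mult_1 neg_equal_0_iff_equal)
      then show ?thesis by blast
    qed
  qed
  then obtain y0 where y0: "\<And>x. x \<in> - B \<Longrightarrow> \<psi> x = m * (snd x - y0)" by (auto simp: W_def algebra_simps)
  have "m = 0"
  proof (rule ccontr)
    assume "m \<noteq> 0"
    have "snd q = y0" if q: "q \<in> frontier B" for q
    proof -
      have qB: "q \<notin> - B" using q frontier_subset_closed[OF body(2)] by auto
      have "q \<in> closure (- B)" using q by (simp add: frontier_closures)
      then have "q islimpt (- B)" using qB by (simp add: closure_def)
      then have nb: "at q within - B \<noteq> bot" by (simp add: trivial_limit_within)
      have "(\<psi> \<longlongrightarrow> 0) (at q within - B)" using slip q by (simp add: slip_condition_def)
      moreover have "(\<psi> \<longlongrightarrow> m * (snd q - y0)) (at q within - B)"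
      proof (rule Lim_transform_eventually)
        show "((\<lambda>x. m * (snd x - y0)) \<longlongrightarrow> m * (snd q - y0)) (at q within - B)" by (intro tendsto_intros)
        show "eventually (\<lambda>x. m * (snd x - y0) = \<psi> x) (at q within - B)"
          by (simp add: eventually_at_filter y0)
      qed
      ultimately have "m * (snd q - y0) = 0" using tendsto_unique[OF nb] by metis
      with \<open>m \<noteq> 0\<close> show ?thesis by simp
    qed
    then have "B \<subseteq> {x. snd x = y0}" by (intro body_within_line[OF body(1)]) auto
    with line show False by blast
  qed
  then have "\<psi> x = 0" if "x \<in> - B" for x using y0 that by simp
  then have z: "has_partials (- B) \<psi> (\<lambda>x. 0) (\<lambda>x. 0)"
    by (intro has_partials_cong[OF open_domain has_partials_const[of _ 0]]) auto
  show ?thesis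
    using has_partials_unique[OF z x] by (simp add: partial_xy_def)
qed

end

section \<open>Incompressible and isentropic flows\<close>

lemma partial_xy_simps:
  "partial_xy 1 0 f = partial_x f" "partial_xy 0 1 f = partial_y f" "partial_xy 2 0 f = partial_x (partial_x f)"
  "partial_xy 1 1 f = partial_x (partial_y f)" "partial_xy 0 2 f = partial_y (partial_y f)"
  by (simp_all add: partial_xy_def numeral_2_eq_2)

lemma eventually_outside_body:
  fixes B :: "(real \<times> real) set"
  assumes "bounded B"
  shows "eventually (\<lambda>x. x \<in> - B) at_infinity"
proof -
  obtain r where "\<And>x. x \<in> B \<Longrightarrow> norm x \<le> r" using assms by (auto simp: bounded_iff)
  then show ?thesis unfolding eventually_at_infinity_real_prod by (meson ComplI not_less)
qed

lemma no_incompressible_flow: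
  assumes body: "solid_body B" and line: "\<nexists>y0. B \<subseteq> {x. snd x = y0}"
    and low: "protruding_corner B pl" "\<forall>x\<in>B. snd pl \<le> snd x"
    and high: "protruding_corner B ph" "\<forall>x\<in>B. snd x \<le> snd ph"
    and flow: "incompressible_flow B \<psi> v" and bd: "bounded (v ` (- B))" and inf: "horizontal_at_infinity v"
    and x: "x \<in> - B"
  shows "v x = 0"
proof -
  have B: "bounded B" "closed B" "connected (- B)" using body by (auto simp: solid_body_def)
  have v: "v x = (partial_y \<psi> x, - partial_x \<psi> x)" if "x \<in> - B" for x
    using flow that by (simp add: incompressible_flow_def)
  obtain M where M: "\<And>x. x \<in> - B \<Longrightarrow> norm (v x) \<le> M" using bd by (auto simp: bounded_iff)
  obtain u where u: "u \<ge> 0" "(v \<longlongrightarrow> (u, 0)) at_infinity" using inf by (auto simp: horizontal_at_infinity_def)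
  have ev: "eventually (\<lambda>x. x \<in> - B) at_infinity" by (rule eventually_outside_body[OF B(1)])
  interpret elliptic_stream B 1 "\<lambda>x. 1" "\<lambda>x. 0" "\<lambda>x. 1" \<psi> u M 1 0 "SOME r. \<forall>x. r < norm x \<longrightarrow> x \<in> - B"
  proof
    show "open (- B)" using B by auto
    show "smooth_in (- B) \<psi>" "slip_condition B \<psi>" using flow by (auto simp: incompressible_flow_def harmonic_in_def)
    have harm: "partial_x (partial_x \<psi>) x + partial_y (partial_y \<psi>) x = 0" if "x \<in> - B" for x
      using flow that by (simp add: incompressible_flow_def harmonic_in_def)
    then show "1 * partial_xy 2 0 \<psi> x + 2 * 0 * partial_xy 1 1 \<psi> x + 1 * partial_xy 0 2 \<psi> x = 0" if "x \<in> - B" for x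
      using that unfolding partial_xy_simps by simp
    show "\<bar>partial_xy 1 0 \<psi> x\<bar> \<le> M \<and> \<bar>partial_xy 0 1 \<psi> x\<bar> \<le> M" if "x \<in> - B" for x
      using M[OF that] norm_fst_le[of "fst (v x)" "snd (v x)"] norm_snd_le[of "snd (v x)" "fst (v x)"]
      unfolding partial_xy_simps by (simp add: v[OF that])
    have "((\<lambda>x. - snd (v x)) \<longlongrightarrow> - snd (u, 0)) at_infinity" "((\<lambda>x. fst (v x)) \<longlongrightarrow> fst (u, 0 :: real)) at_infinity"
      by (rule tendsto_minus[OF tendsto_snd[OF u(2)]]) (rule tendsto_fst[OF u(2)])
    then have l: "((\<lambda>x. - snd (v x)) \<longlongrightarrow> 0) at_infinity" "((\<lambda>x. fst (v x)) \<longlongrightarrow> u) at_infinity" by simp_all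
    show "(partial_xy 1 0 \<psi> \<longlongrightarrow> 0) at_infinity"
      by (rule Lim_transform_eventually[OF l(1)], rule eventually_mono[OF ev]) (simp add: v partial_xy_simps del: One_nat_def)
    show "(partial_xy 0 1 \<psi> \<longlongrightarrow> u) at_infinity"
      by (rule Lim_transform_eventually[OF l(2)], rule eventually_mono[OF ev]) (simp add: v partial_xy_simps del: One_nat_def)
    have "\<exists>r. \<forall>x. r < norm x \<longrightarrow> x \<in> - B" using ev unfolding eventually_at_infinity_real_prod .
    then have r: "\<forall>x. (SOME r. \<forall>x. r < norm x \<longrightarrow> x \<in> - B) < norm x \<longrightarrow> x \<in> - B" by (rule someI_ex)
    show "(1\<^sup>2 * partial_xy 2 0 \<psi> x + partial_xy 0 2 \<psi> x)\<^sup>2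
       \<le> 0 * ((partial_xy 1 0 \<psi> x)\<^sup>2 + (partial_xy 0 1 \<psi> x - u)\<^sup>2) * ((partial_xy 2 0 \<psi> x)\<^sup>2 + (partial_xy 1 1 \<psi> x)\<^sup>2)"
      if "(SOME r. \<forall>x. r < norm x \<longrightarrow> x \<in> - B) < norm x" for x
    proof -
      have "x \<in> - B" using r that by blast
      from harm[OF this] show ?thesis unfolding partial_xy_simps by simp
    qed
  qed (use B u in auto)
  show ?thesis
    using gradient_vanishes[OF line low high x] unfolding partial_xy_simps by (simp add: v[OF x] zero_prod_def)
qed

lemma differentiable_Lipschitz_at:
  fixes F :: "real \<times> real \<Rightarrow> real"
  assumes "has_partials {p} F Fx Fy"
  shows "\<exists>L\<ge>0. eventually (\<lambda>x. \<bar>F x - F p\<bar> \<le> L * norm (x - p)) (nhds p)"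
proof -
  have F: "(F has_derivative (\<lambda>h. Fx p * fst h + Fy p * snd h)) (at p)" using assms by (simp add: has_partials_def)
  obtain d where d: "d > 0" "\<And>x. norm (x - p) < d \<Longrightarrow> norm (F x - F p - (Fx p * fst (x - p) + Fy p * snd (x - p))) \<le> 1 * norm (x - p)"
    using F zero_less_one unfolding has_derivative_at_alt by blast
  have "\<bar>F x - F p\<bar> \<le> (1 + \<bar>Fx p\<bar> + \<bar>Fy p\<bar>) * norm (x - p)" if "norm (x - p) < d" for x
  proof -
    let ?h = "x - p"
    have "\<bar>fst h\<bar> \<le> norm h" "\<bar>snd h\<bar> \<le> norm h" for h :: "real \<times> real"
      using norm_fst_le[of "fst h" "snd h"] norm_snd_le[of "snd h" "fst h"] by simp_all
    note n = this[of ?h]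
    have "\<bar>Fx p * fst ?h\<bar> \<le> \<bar>Fx p\<bar> * norm ?h" "\<bar>Fy p * snd ?h\<bar> \<le> \<bar>Fy p\<bar> * norm ?h"
      unfolding abs_mult by (intro mult_left_mono n; simp)+
    then show ?thesis using d(2)[OF that] unfolding real_norm_def distrib_right mult_1 by linarith
  qed
  moreover have "eventually (\<lambda>x. norm (x - p) < d) (nhds p)"
    unfolding eventually_nhds_metric using d(1) by (auto simp: dist_norm)
  ultimately show ?thesis
    by (intro exI[of _ "1 + \<bar>Fx p\<bar> + \<bar>Fy p\<bar>"] conjI) (auto elim: eventually_mono)
qed

text \<open>Bernoulli's relation determines the squared sound speed \<open>csq w\<close> and the density \<open>density w\<close> from
the velocity \<open>w\<close>.\<close>

locale isentropic_gas =
  fixes \<gamma> K :: real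
  assumes \<gamma>: "1 < \<gamma>" and K: "0 < K"
begin

definition csq :: "real \<times> real \<Rightarrow> real" where
  "csq w = (\<gamma> - 1) * (K - ((fst w)\<^sup>2 + (snd w)\<^sup>2) / 2)"

definition density :: "real \<times> real \<Rightarrow> real" where
  "density w = (csq w / \<gamma>) powr (1 / (\<gamma> - 1))"

lemma bernoulli:
  assumes \<rho>: "0 < \<rho>" and b: "(norm w)\<^sup>2 / 2 + enthalpy \<gamma> \<rho> = K"
  shows "csq w = \<gamma> * \<rho> powr (\<gamma> - 1)" "\<rho> = density w" "0 < csq w" "(sound_speed \<gamma> \<rho>)\<^sup>2 = csq w"
proof -
  have e0: "\<gamma> / (\<gamma> - 1) * \<rho> powr (\<gamma> - 1) = K - ((fst w)\<^sup>2 + (snd w)\<^sup>2) / 2"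
    using b by (simp add: enthalpy_def norm_sq_coords)
  then show 1: "csq w = \<gamma> * \<rho> powr (\<gamma> - 1)" using \<gamma> unfolding csq_def e0[symmetric] by simp
  then show "0 < csq w" using \<gamma> \<rho> by simp
  show "(sound_speed \<gamma> \<rho>)\<^sup>2 = csq w" using \<gamma> \<rho> by (simp add: 1 sound_speed_def)
  have "csq w / \<gamma> = \<rho> powr (\<gamma> - 1)" using 1 \<gamma> by simp
  then have "density w = (\<rho> powr (\<gamma> - 1)) powr (1 / (\<gamma> - 1))" by (simp only: density_def)
  also have "\<dots> = \<rho>" unfolding powr_powr using \<gamma> \<rho> by simp
  finally show "\<rho> = density w" ..
qed

lemma density_pos: "0 < csq w \<Longrightarrow> 0 < density w"
  using \<gamma> by (simp add: density_def)

lemma has_partials_density: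
  assumes f: "has_partials U f fx fy" and g: "has_partials U g gx gy" and pos: "\<And>x. x \<in> U \<Longrightarrow> 0 < csq (f x, g x)"
  shows "has_partials U (\<lambda>x. density (f x, g x))
    (\<lambda>x. - (density (f x, g x) / csq (f x, g x)) * (f x * fx x + g x * gx x))
    (\<lambda>x. - (density (f x, g x) / csq (f x, g x)) * (f x * fy x + g x * gy x))"
proof -
  define k where "k = (\<gamma> - 1) / \<gamma>"
  have "has_partials U (\<lambda>x. K - 1/2 * (f x * f x + g x * g x))
     (\<lambda>x. 0 - 1/2 * (fx x * f x + f x * fx x + (gx x * g x + g x * gx x)))
     (\<lambda>x. 0 - 1/2 * (fy x * f x + f x * fy x + (gy x * g x + g x * gy x)))"
    by (intro has_partials_diff has_partials_const has_partials_cmult has_partials_add has_partials_mult f g)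
  from has_partials_cmult[OF this, of k]
  have c: "has_partials U (\<lambda>x. csq (f x, g x) / \<gamma>) (\<lambda>x. - k * (f x * fx x + g x * gx x)) (\<lambda>x. - k * (f x * fy x + g x * gy x))"
  proof -
    have "(\<lambda>x. csq (f x, g x) / \<gamma>) = (\<lambda>x. k * (K - 1/2 * (f x * f x + g x * g x)))"
      by (rule ext) (simp add: csq_def k_def power2_eq_square)
    then show ?thesis
      by (simp only:) (rule has_partials_rhs[OF \<open>has_partials U (\<lambda>x. k * (K - 1/2 * (f x * f x + g x * g x))) _ _\<close>]; simp add: algebra_simps)
  qed
  have "((\<lambda>X. X powr (1 / (\<gamma> - 1))) has_real_derivative 1 / (\<gamma> - 1) * (csq (f x, g x) / \<gamma>) powr (1 / (\<gamma> - 1) - 1)) (at (csq (f x, g x) / \<gamma>))"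
    if "x \<in> U" for x
    by (rule has_real_derivative_powr) (use pos[OF that] \<gamma> in simp)
  from has_partials_chain[OF c this]
  have d: "has_partials U (\<lambda>x. density (f x, g x))
    (\<lambda>x. 1 / (\<gamma> - 1) * (csq (f x, g x) / \<gamma>) powr (1 / (\<gamma> - 1) - 1) * (- k * (f x * fx x + g x * gx x)))
    (\<lambda>x. 1 / (\<gamma> - 1) * (csq (f x, g x) / \<gamma>) powr (1 / (\<gamma> - 1) - 1) * (- k * (f x * fy x + g x * gy x)))"
    by (simp only: density_def)
  have coef: "1 / (\<gamma> - 1) * (csq w / \<gamma>) powr (1 / (\<gamma> - 1) - 1) * (- k * X) = - (density w / csq w) * X"
    if "0 < csq w" for w X
  proof -
    have "(csq w / \<gamma>) powr (1 / (\<gamma> - 1) - 1) = density w / (csq w / \<gamma>)"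
      using that \<gamma> by (simp add: powr_diff density_def)
    then show ?thesis using \<gamma> that by (simp add: k_def)
  qed
  show ?thesis by (rule has_partials_rhs[OF d]) (simp_all only: coef[OF pos])
qed

text \<open>The mass flux \<open>density w * w\<close> has the derivative \<open>diag (r b, r)\<close> at \<open>(u, 0)\<close>, where \<open>r\<close> is the density
and \<open>b = 1 - u\<^sup>2 / csq (u, 0)\<close>. It is invertible at subsonic speed, so near \<open>(u, 0)\<close> the velocity is
controlled by the mass flux, that is, by the gradient of the stream function.\<close>

lemma mass_flux_Lipschitz_below:
  assumes u: "0 < csq (u, 0)" "u\<^sup>2 < csq (u, 0)"
  shows "\<exists>L\<ge>0. eventually (\<lambda>w. norm (w - (u, 0)) \<le> L * (\<bar>density w * fst w - density (u, 0) * u\<bar> + \<bar>density w * snd w\<bar>)) (nhds (u, 0))"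
proof -
  define r where "r = density (u, 0)"
  have r: "r > 0" unfolding r_def by (rule density_pos[OF u(1)])
  define b where "b = 1 - u\<^sup>2 / csq (u, 0)"
  have b: "0 < b" "b \<le> 1" using u by (simp_all add: b_def)
  let ?p = "(u, 0) :: real \<times> real"
  have d: "has_partials {?p} density (\<lambda>x. - (density x / csq x) * fst x) (\<lambda>x. - (density x / csq x) * snd x)"
    using has_partials_density[OF has_partials_fst has_partials_snd, of "{?p}"] u by simp
  have G1: "has_partials {?p} (\<lambda>w. density w * fst w) (\<lambda>w. r * b) (\<lambda>w. 0)"
    by (rule has_partials_rhs[OF has_partials_mult[OF d has_partials_fst]])
       (auto simp: r_def b_def power2_eq_square algebra_simps)
  have G2: "has_partials {?p} (\<lambda>w. density w * snd w) (\<lambda>w. 0) (\<lambda>w. r)"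
    by (rule has_partials_rhs[OF has_partials_mult[OF d has_partials_snd]]) (auto simp: r_def)
  define e where "e = r * b / 4"
  have e: "e > 0" using r b by (simp add: e_def)
  obtain d1 where d1: "d1 > 0" "\<And>w. norm (w - ?p) < d1 \<Longrightarrow> norm (density w * fst w - density ?p * fst ?p - (r * b * fst (w - ?p) + 0 * snd (w - ?p))) \<le> e * norm (w - ?p)"
    using has_partialsD[OF G1 singletonI] e unfolding has_derivative_at_alt by blast
  obtain d2 where d2: "d2 > 0" "\<And>w. norm (w - ?p) < d2 \<Longrightarrow> norm (density w * snd w - density ?p * snd ?p - (0 * fst (w - ?p) + r * snd (w - ?p))) \<le> e * norm (w - ?p)"
    using has_partialsD[OF G2 singletonI] e unfolding has_derivative_at_alt by blast
  have main: "norm (w - ?p) \<le> 2 / (r * b) * (\<bar>density w * fst w - density (u, 0) * u\<bar> + \<bar>density w * snd w\<bar>)"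
    if w: "norm (w - ?p) < min d1 d2" for w
  proof -
    define h where "h = w - ?p"
    define X where "X = density w * fst w - density (u, 0) * u"
    define Y where "Y = density w * snd w"
    define n where "n = norm h"
    have 1: "\<bar>X - r * b * fst h\<bar> \<le> e * n" using d1(2)[of w] w by (simp add: h_def X_def n_def)
    have 2: "\<bar>Y - r * snd h\<bar> \<le> e * n" using d2(2)[of w] w by (simp add: h_def Y_def n_def)
    have "r * b * \<bar>fst h\<bar> = \<bar>r * b * fst h\<bar>" using r b by (simp add: abs_mult)
    then have 3: "r * b * \<bar>fst h\<bar> \<le> \<bar>X\<bar> + e * n" using 1 by linarith
    have "r * \<bar>snd h\<bar> = \<bar>r * snd h\<bar>" using r by (simp add: abs_mult)
    then have 4: "r * \<bar>snd h\<bar> \<le> \<bar>Y\<bar> + e * n" using 2 by linarith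
    have "r * b * \<bar>snd h\<bar> \<le> r * 1 * \<bar>snd h\<bar>" using r b by (intro mult_right_mono mult_left_mono) auto
    with 4 have 5: "r * b * \<bar>snd h\<bar> \<le> \<bar>Y\<bar> + e * n" by simp
    have "n \<le> \<bar>fst h\<bar> + \<bar>snd h\<bar>" using norm_Pair_le[of "fst h" "snd h"] by (simp add: n_def)
    then have "r * b * n \<le> r * b * (\<bar>fst h\<bar> + \<bar>snd h\<bar>)" using r b by (intro mult_left_mono) auto
    also have "\<dots> \<le> \<bar>X\<bar> + \<bar>Y\<bar> + r * b * n / 2" using 3 5 by (simp add: distrib_left e_def)
    finally have "r * b * n \<le> 2 * (\<bar>X\<bar> + \<bar>Y\<bar>)" by simp
    then have "n \<le> 2 * (\<bar>X\<bar> + \<bar>Y\<bar>) / (r * b)" using r b by (simp add: pos_le_divide_eq mult_ac)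
    then show ?thesis by (simp add: n_def h_def X_def Y_def)
  qed
  have "eventually (\<lambda>w. norm (w - ?p) < min d1 d2) (nhds ?p)"
    unfolding eventually_nhds_metric using d1(1) d2(1) by (intro exI[of _ "min d1 d2"]) (auto simp: dist_norm)
  then show ?thesis using main r b
    by (intro exI[of _ "2 / (r * b)"] conjI) (auto elim: eventually_mono)
qed

text \<open>The two functions are the coefficients of \<open>\<psi>\<^sub>x\<^sub>x\<close> and \<open>\<psi>\<^sub>x\<^sub>y\<close> that remain when the equation is used to
eliminate \<open>\<psi>\<^sub>y\<^sub>y\<close> from \<open>\<beta>\<^sup>2 \<psi>\<^sub>x\<^sub>x + \<psi>\<^sub>y\<^sub>y\<close>, with \<open>\<beta>\<^sup>2 = 1 - u\<^sup>2 / csq (u, 0)\<close>. Both are differentiable and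
vanish at \<open>w = (u, 0)\<close>.\<close>

lemma coefficient_Lipschitz:
  assumes u: "0 < csq (u, 0)"
  shows "\<exists>L\<ge>0. eventually (\<lambda>w. 0 < csq w - (snd w)\<^sup>2 \<and>
      \<bar>(1 - u\<^sup>2 / csq (u, 0)) - (csq w - (fst w)\<^sup>2) / (csq w - (snd w)\<^sup>2)\<bar> \<le> L * norm (w - (u, 0)) \<and>
      \<bar>2 * fst w * snd w / (csq w - (snd w)\<^sup>2)\<bar> \<le> L * norm (w - (u, 0))) (nhds (u, 0))"
proof -
  let ?p = "(u, 0) :: real \<times> real"
  let ?N = "\<lambda>w. csq w - snd w * snd w" and ?M = "\<lambda>w. csq w - fst w * fst w"
  have "csq = (\<lambda>w. (\<gamma> - 1) * (K - 1 / 2 * (fst w * fst w + snd w * snd w)))"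
    by (rule ext) (simp add: csq_def power2_eq_square)
  then have "\<exists>cx cy. has_partials UNIV csq cx cy"
    using has_partials_cmult[OF has_partials_diff[OF has_partials_const[of UNIV K] has_partials_cmult[OF has_partials_add[OF
       has_partials_mult[OF has_partials_fst has_partials_fst] has_partials_mult[OF has_partials_snd has_partials_snd]], where c = "1 / 2"]], where c = "\<gamma> - 1"]
    by auto
  then obtain cx cy where c: "has_partials UNIV csq cx cy" by blast
  have N: "has_partials UNIV ?N (\<lambda>w. cx w - (0 * snd w + snd w * 0)) (\<lambda>w. cy w - (1 * snd w + snd w * 1))"
    by (intro has_partials_diff c has_partials_mult has_partials_snd)
  have M: "has_partials UNIV ?M (\<lambda>w. cx w - (1 * fst w + fst w * 1)) (\<lambda>w. cy w - (0 * fst w + fst w * 0))"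
    by (intro has_partials_diff c has_partials_mult has_partials_fst)
  have Np: "?N ?p \<noteq> 0" using u by simp
  have inv: "has_partials {?p} (\<lambda>w. inverse (?N w)) (\<lambda>w. - (inverse (?N w) ^ Suc (Suc 0)) * (cx w - (0 * snd w + snd w * 0)))
      (\<lambda>w. - (inverse (?N w) ^ Suc (Suc 0)) * (cy w - (1 * snd w + snd w * 1)))"
    by (rule has_partials_chain[OF has_partials_subset[OF N subset_UNIV] DERIV_inverse]) (use u in auto)
  obtain L1 where L1: "L1 \<ge> 0" "eventually (\<lambda>w. \<bar>?M w * inverse (?N w) - ?M ?p * inverse (?N ?p)\<bar> \<le> L1 * norm (w - ?p)) (nhds ?p)"
    using differentiable_Lipschitz_at[OF has_partials_mult[OF has_partials_subset[OF M subset_UNIV] inv]] by blast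
  obtain L2 where L2: "L2 \<ge> 0" "eventually (\<lambda>w. \<bar>fst w * snd w * inverse (?N w) - fst ?p * snd ?p * inverse (?N ?p)\<bar> \<le> L2 * norm (w - ?p)) (nhds ?p)"
    using differentiable_Lipschitz_at[OF has_partials_mult[OF has_partials_mult[OF has_partials_fst has_partials_snd] inv]] by blast
  have "isCont ?N ?p" using has_partials_continuous_on[OF N] by (simp add: continuous_on_eq_continuous_at)
  then have "(?N \<longlongrightarrow> ?N ?p) (nhds ?p)"
    unfolding continuous_at by (rule tendsto_at_iff_tendsto_nhds[where g = ?N, THEN iffD1])
  then have evN: "eventually (\<lambda>w. 0 < ?N w) (nhds ?p)" by (rule order_tendstoD(1)) (use u in simp)
  have Mp: "?M ?p * inverse (?N ?p) = 1 - u\<^sup>2 / csq ?p" using u by (simp add: field_simps power2_eq_square)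
  show ?thesis
  proof (intro exI[of _ "max L1 (2 * L2)"] conjI)
    show "0 \<le> max L1 (2 * L2)" using L1 by simp
    show "eventually (\<lambda>w. 0 < csq w - (snd w)\<^sup>2 \<and>
      \<bar>(1 - u\<^sup>2 / csq (u, 0)) - (csq w - (fst w)\<^sup>2) / (csq w - (snd w)\<^sup>2)\<bar> \<le> max L1 (2 * L2) * norm (w - (u, 0)) \<and>
      \<bar>2 * fst w * snd w / (csq w - (snd w)\<^sup>2)\<bar> \<le> max L1 (2 * L2) * norm (w - (u, 0))) (nhds (u, 0))"
      using evN L1(2) L2(2)
    proof eventually_elim
      case (elim w)
      let ?n = "norm (w - ?p)"
      have mx: "L1 * ?n \<le> max L1 (2 * L2) * ?n" "2 * L2 * ?n \<le> max L1 (2 * L2) * ?n" by (intro mult_right_mono; simp)+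
      have "\<bar>(1 - u\<^sup>2 / csq ?p) - ?M w * inverse (?N w)\<bar> \<le> max L1 (2 * L2) * ?n"
        using elim(2) mx(1) unfolding Mp abs_minus_commute[of "1 - u\<^sup>2 / csq ?p"] by linarith
      moreover have "\<bar>fst w * snd w * inverse (?N w)\<bar> \<le> L2 * ?n" using elim(3) by simp
      then have "\<bar>2 * (fst w * snd w * inverse (?N w))\<bar> \<le> max L1 (2 * L2) * ?n" using mx(2) by (simp add: abs_mult)
      ultimately show ?case using elim(1) by (simp add: power2_eq_square divide_inverse mult.assoc)
    qed
  qed
qed

end

context isentropic_gas
begin

text \<open>Differentiating \<open>\<psi>\<^sub>y = \<rho> v\<^sup>x\<close> and \<open>\<psi>\<^sub>x = - \<rho> v\<^sup>y\<close> with the density given by Bernoulli's relation, and using that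
the flow is irrotational, leaves a polynomial identity. The mixed derivative of \<open>\<psi>\<close> is expressed in
both possible ways.\<close>

lemma stream_function_pde:
  assumes U: "open U" and \<psi>: "smooth_in U \<psi>" and v: "v differentiable_on U"
    and pos: "\<And>x. x \<in> U \<Longrightarrow> 0 < csq (v x)"
    and flux: "\<And>x. x \<in> U \<Longrightarrow> density (v x) *\<^sub>R v x = (partial_y \<psi> x, - partial_x \<psi> x)"
    and irrotational: "\<And>x. x \<in> U \<Longrightarrow> partial_x (\<lambda>q. snd (v q)) x - partial_y (\<lambda>q. fst (v q)) x = 0"
    and x: "x \<in> U"
  shows "(csq (v x) - (fst (v x))\<^sup>2) * partial_xy 2 0 \<psi> x - 2 * fst (v x) * snd (v x) * partial_xy 1 1 \<psi> x
     + (csq (v x) - (snd (v x))\<^sup>2) * partial_xy 0 2 \<psi> x = 0"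
proof -
  define f g where "f = (\<lambda>x. fst (v x))" and "g = (\<lambda>x. snd (v x))"
  have vfg: "v x = (f x, g x)" for x by (simp add: f_def g_def)
  have fd: "f differentiable_on U" and gd: "g differentiable_on U"
    using v unfolding f_def g_def differentiable_on_def differentiable_def
    by (blast intro: has_derivative_fst has_derivative_snd)+
  define f1 f2 g2 where "f1 = partial_x f" and "f2 = partial_y f" and "g2 = partial_y g"
  have f: "has_partials U f f1 f2" unfolding f1_def f2_def by (rule differentiable_has_partials[OF U fd])
  have g: "has_partials U g f2 g2" unfolding f2_def g2_def
    by (rule has_partials_rhs[OF differentiable_has_partials[OF U gd]]) (use irrotational in \<open>auto simp: f_def g_def\<close>)
  define r where "r = (\<lambda>x. density (f x, g x))"
  define s where "s = (\<lambda>x. r x / csq (f x, g x))"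
  define r1 r2 where "r1 = (\<lambda>x. - s x * (f x * f1 x + g x * f2 x))" and "r2 = (\<lambda>x. - s x * (f x * f2 x + g x * g2 x))"
  have r: "has_partials U r r1 r2" unfolding r_def r1_def r2_def s_def
    by (rule has_partials_density[OF f g]) (use pos vfg in simp)
  have y: "has_partials U (partial_xy 0 1 \<psi>) (\<lambda>x. r1 x * f x + r x * f1 x) (\<lambda>x. r2 x * f x + r x * f2 x)"
  proof (rule has_partials_cong[OF U has_partials_mult[OF r f]])
    show "r x * f x = partial_xy 0 1 \<psi> x" if "x \<in> U" for x
      using flux[OF that] unfolding partial_xy_simps by (simp add: r_def vfg)
  qed
  have x': "has_partials U (partial_xy 1 0 \<psi>) (\<lambda>x. - (r1 x * g x + r x * f2 x)) (\<lambda>x. - (r2 x * g x + r x * g2 x))"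
  proof (rule has_partials_cong[OF U has_partials_minus[OF has_partials_mult[OF r g]]])
    show "- (r x * g x) = partial_xy 1 0 \<psi> x" if "x \<in> U" for x
      using flux[OF that] unfolding partial_xy_simps by (simp add: r_def vfg)
  qed
  have S: "has_partials U (partial_xy 0 1 \<psi>) (partial_xy 1 1 \<psi>) (partial_xy 0 2 \<psi>)"
    "has_partials U (partial_xy 1 0 \<psi>) (partial_xy 2 0 \<psi>) (partial_xy 1 1 \<psi>)"
    using smooth_in_has_partials[OF U \<psi>, of 0 1] smooth_in_has_partials[OF U \<psi>, of 1 0]
    by (simp_all add: numeral_2_eq_2)
  have e: "partial_xy 1 1 \<psi> x = r1 x * f x + r x * f1 x" "partial_xy 0 2 \<psi> x = r2 x * f x + r x * f2 x"
    "partial_xy 2 0 \<psi> x = - (r1 x * g x + r x * f2 x)" "partial_xy 1 1 \<psi> x = - (r2 x * g x + r x * g2 x)"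
    using has_partials_unique[OF y x] has_partials_unique[OF x' x] has_partials_unique[OF S(1) x] has_partials_unique[OF S(2) x]
    by simp_all
  define c2 where "c2 = csq (f x, g x)"
  have c2: "r x = s x * c2" using pos[OF x] by (simp add: s_def c2_def vfg)
  have "2 * f x * g x * partial_xy 1 1 \<psi> x = f x * g x * (r1 x * f x + r x * f1 x) + f x * g x * (- (r2 x * g x + r x * g2 x))"
    unfolding e(1)[symmetric] e(4)[symmetric] by simp
  moreover have "(c2 - (f x)\<^sup>2) * (- (r1 x * g x + r x * f2 x))
     - (f x * g x * (r1 x * f x + r x * f1 x) + f x * g x * (- (r2 x * g x + r x * g2 x)))
     + (c2 - (g x)\<^sup>2) * (r2 x * f x + r x * f2 x) = 0"
    unfolding c2 r1_def r2_def by algebra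
  ultimately have "(c2 - (f x)\<^sup>2) * partial_xy 2 0 \<psi> x - 2 * f x * g x * partial_xy 1 1 \<psi> x + (c2 - (g x)\<^sup>2) * partial_xy 0 2 \<psi> x = 0"
    unfolding e(2,3) by (simp only:)
  then show ?thesis by (simp only: vfg fst_conv snd_conv c2_def)
qed

text \<open>The form is \<open>|\<xi>|\<^sup>2 - (w \<bullet> \<xi>)\<^sup>2 / csq w\<close> with \<open>\<xi> = (s, t)\<close>, and \<open>k\<close> bounds the squared Mach number.\<close>

lemma subsonic_form_bounds:
  assumes c: "0 < csq w" and M: "(fst w)\<^sup>2 + (snd w)\<^sup>2 \<le> k * csq w"
  shows "(1 - k) * (s\<^sup>2 + t\<^sup>2) \<le> (1 - (fst w)\<^sup>2 / csq w) * s\<^sup>2 + 2 * (- (fst w * snd w / csq w)) * s * t + (1 - (snd w)\<^sup>2 / csq w) * t\<^sup>2"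
    "(1 - (fst w)\<^sup>2 / csq w) * s\<^sup>2 + 2 * (- (fst w * snd w / csq w)) * s * t + (1 - (snd w)\<^sup>2 / csq w) * t\<^sup>2 \<le> s\<^sup>2 + t\<^sup>2"
proof -
  define X where "X = (fst w * s + snd w * t)\<^sup>2 / csq w"
  have eq: "(1 - (fst w)\<^sup>2 / csq w) * s\<^sup>2 + 2 * (- (fst w * snd w / csq w)) * s * t + (1 - (snd w)\<^sup>2 / csq w) * t\<^sup>2
     = s\<^sup>2 + t\<^sup>2 - X"
    by (simp add: X_def power2_eq_square algebra_simps add_divide_distrib)
  have "0 \<le> X" using c by (simp add: X_def)
  then show "(1 - (fst w)\<^sup>2 / csq w) * s\<^sup>2 + 2 * (- (fst w * snd w / csq w)) * s * t + (1 - (snd w)\<^sup>2 / csq w) * t\<^sup>2 \<le> s\<^sup>2 + t\<^sup>2"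
    unfolding eq by simp
  have "(fst w * s + snd w * t)\<^sup>2 + (fst w * t - snd w * s)\<^sup>2 = ((fst w)\<^sup>2 + (snd w)\<^sup>2) * (s\<^sup>2 + t\<^sup>2)" by algebra
  then have "(fst w * s + snd w * t)\<^sup>2 \<le> ((fst w)\<^sup>2 + (snd w)\<^sup>2) * (s\<^sup>2 + t\<^sup>2)"
    using zero_le_power2[of "fst w * t - snd w * s"] by linarith
  also have "\<dots> \<le> (k * csq w) * (s\<^sup>2 + t\<^sup>2)" by (rule mult_right_mono[OF M]) simp
  finally have "X \<le> k * (s\<^sup>2 + t\<^sup>2)" using c by (simp add: X_def pos_divide_le_eq mult_ac)
  then show "(1 - k) * (s\<^sup>2 + t\<^sup>2) \<le> (1 - (fst w)\<^sup>2 / csq w) * s\<^sup>2 + 2 * (- (fst w * snd w / csq w)) * s * t + (1 - (snd w)\<^sup>2 / csq w) * t\<^sup>2"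
    unfolding eq by (simp add: left_diff_distrib)
qed

lemma asymptotic_coefficient_bound:
  fixes c2 f g xx xy yy b L L' n X Y :: real
  assumes N: "0 < c2 - g\<^sup>2" and pde: "(c2 - f\<^sup>2) * xx - 2 * f * g * xy + (c2 - g\<^sup>2) * yy = 0"
    and A: "\<bar>b - (c2 - f\<^sup>2) / (c2 - g\<^sup>2)\<bar> \<le> L * n" "\<bar>2 * f * g / (c2 - g\<^sup>2)\<bar> \<le> L * n"
    and n: "0 \<le> n" "n \<le> L' * (\<bar>Y\<bar> + \<bar>X\<bar>)" and L: "0 \<le> L" "0 \<le> L'"
  shows "(b * xx + yy)\<^sup>2 \<le> 4 * L\<^sup>2 * L'\<^sup>2 * (X\<^sup>2 + Y\<^sup>2) * (xx\<^sup>2 + xy\<^sup>2)"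
proof -
  define A1 A2 where "A1 = b - (c2 - f\<^sup>2) / (c2 - g\<^sup>2)" and "A2 = 2 * f * g / (c2 - g\<^sup>2)"
  have "yy = A2 * xy - (c2 - f\<^sup>2) / (c2 - g\<^sup>2) * xx"
  proof -
    have "yy * (c2 - g\<^sup>2) = 2 * f * g * xy - (c2 - f\<^sup>2) * xx" using pde by (simp add: algebra_simps)
    then have "yy = (2 * f * g * xy - (c2 - f\<^sup>2) * xx) / (c2 - g\<^sup>2)" using N by (simp add: eq_divide_eq)
    also have "\<dots> = A2 * xy - (c2 - f\<^sup>2) / (c2 - g\<^sup>2) * xx"
      unfolding A2_def times_divide_eq_left by (rule diff_divide_distrib)
    finally show ?thesis .
  qed
  then have "b * xx + yy = A1 * xx + A2 * xy" by (simp add: A1_def algebra_simps)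
  moreover have "(A1 * xx + A2 * xy)\<^sup>2 + (A1 * xy - A2 * xx)\<^sup>2 = (A1\<^sup>2 + A2\<^sup>2) * (xx\<^sup>2 + xy\<^sup>2)" by algebra
  ultimately have 1: "(b * xx + yy)\<^sup>2 \<le> (A1\<^sup>2 + A2\<^sup>2) * (xx\<^sup>2 + xy\<^sup>2)"
    using zero_le_power2[of "A1 * xy - A2 * xx"] by (simp only:)
  have "\<bar>A1\<bar>\<^sup>2 \<le> (L * n)\<^sup>2" "\<bar>A2\<bar>\<^sup>2 \<le> (L * n)\<^sup>2" using A unfolding A1_def A2_def by (intro power_mono; simp)+
  then have 2: "A1\<^sup>2 + A2\<^sup>2 \<le> 2 * L\<^sup>2 * n\<^sup>2" by (simp add: power_mult_distrib)
  have "n\<^sup>2 \<le> (L' * (\<bar>Y\<bar> + \<bar>X\<bar>))\<^sup>2" by (rule power_mono[OF n(2,1)])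
  also have "\<dots> = L'\<^sup>2 * (\<bar>Y\<bar> + \<bar>X\<bar>)\<^sup>2" by (simp add: power_mult_distrib)
  also have "\<dots> \<le> L'\<^sup>2 * (2 * (X\<^sup>2 + Y\<^sup>2))"
  proof (rule mult_left_mono)
    have "0 \<le> (\<bar>Y\<bar> - \<bar>X\<bar>)\<^sup>2" by simp
    then show "(\<bar>Y\<bar> + \<bar>X\<bar>)\<^sup>2 \<le> 2 * (X\<^sup>2 + Y\<^sup>2)" by (simp add: power2_diff power2_sum)
  qed simp
  finally have 3: "n\<^sup>2 \<le> L'\<^sup>2 * (2 * (X\<^sup>2 + Y\<^sup>2))" .
  have "2 * L\<^sup>2 * n\<^sup>2 \<le> 2 * L\<^sup>2 * (L'\<^sup>2 * (2 * (X\<^sup>2 + Y\<^sup>2)))" by (rule mult_left_mono[OF 3]) simp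
  also have "\<dots> = 4 * L\<^sup>2 * L'\<^sup>2 * (X\<^sup>2 + Y\<^sup>2)" by simp
  finally have "A1\<^sup>2 + A2\<^sup>2 \<le> 4 * L\<^sup>2 * L'\<^sup>2 * (X\<^sup>2 + Y\<^sup>2)" using 2 by (rule order_trans[rotated])
  from mult_right_mono[OF this, of "xx\<^sup>2 + xy\<^sup>2"] 1 show ?thesis by simp
qed

text \<open>The uniform bound on the Mach number passes to the limit at infinity; together with \<open>K > 0\<close> this
excludes a vacuum there, so the coefficients of the equation are smooth functions of the velocity near
its limit.\<close>

lemma no_subsonic_flow:
  assumes body: "solid_body B" and line: "\<nexists>y0. B \<subseteq> {x. snd x = y0}"
    and low: "protruding_corner B pl" "\<forall>x\<in>B. snd pl \<le> snd x"
    and high: "protruding_corner B ph" "\<forall>x\<in>B. snd x \<le> snd ph"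
    and flow: "uniformly_subsonic_flow \<gamma> K B \<psi> v \<rho>" and inf: "horizontal_at_infinity v"
    and x: "x \<in> - B"
  shows "v x = 0"
proof -
  have B: "bounded B" "closed B" "connected (- B)" using body by (auto simp: solid_body_def)
  note F = flow[unfolded uniformly_subsonic_flow_def]
  have \<psi>: "smooth_in (- B) \<psi>" and slip: "slip_condition B \<psi>" and vd: "v differentiable_on (- B)"
    using F by (auto simp: smooth_up_to_boundary_def)
  have \<rho>: "\<And>x. x \<in> - B \<Longrightarrow> 0 < \<rho> x" and flux0: "\<And>x. x \<in> - B \<Longrightarrow> \<rho> x *\<^sub>R v x = (partial_y \<psi> x, - partial_x \<psi> x)"
    and bern: "\<And>x. x \<in> - B \<Longrightarrow> (norm (v x))\<^sup>2 / 2 + enthalpy \<gamma> (\<rho> x) = K"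
    and irr: "\<And>x. x \<in> - B \<Longrightarrow> partial_x (\<lambda>q. snd (v q)) x - partial_y (\<lambda>q. fst (v q)) x = 0" using F by blast+
  have \<rho>v: "\<rho> x = density (v x)" and pos: "0 < csq (v x)" and ss: "(sound_speed \<gamma> (\<rho> x))\<^sup>2 = csq (v x)" if "x \<in> - B" for x
    using bernoulli[OF \<rho>[OF that] bern[OF that]] by auto
  have flux: "density (v x) *\<^sub>R v x = (partial_y \<psi> x, - partial_x \<psi> x)" if "x \<in> - B" for x
    using flux0[OF that] \<rho>v[OF that] by simp
  have flux': "partial_xy 0 1 \<psi> x = density (v x) * fst (v x)" "partial_xy 1 0 \<psi> x = - (density (v x) * snd (v x))" if "x \<in> - B" for x
    using flux[OF that] unfolding partial_xy_simps by (simp_all add: prod_eq_iff)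
  obtain \<delta> where \<delta>: "\<delta> > 0" "\<And>x. x \<in> - B \<Longrightarrow> norm (v x) / sound_speed \<gamma> (\<rho> x) \<le> 1 - \<delta>" using F by blast
  define k where "k = (1 - \<delta>)\<^sup>2"
  have sspos: "0 < sound_speed \<gamma> (\<rho> x)" if "x \<in> - B" for x using \<rho>[OF that] \<gamma> by (simp add: sound_speed_def)
  have d1: "0 \<le> 1 - \<delta>"
  proof -
    have "0 \<le> norm (v x) / sound_speed \<gamma> (\<rho> x)" using sspos[OF x] by simp
    with \<delta>(2)[OF x] show ?thesis by linarith
  qed
  have k: "k < 1"
  proof -
    have "k \<le> (1 - \<delta>) * 1" unfolding k_def power2_eq_square using d1 \<delta>(1) by (intro mult_left_mono) auto
    then show ?thesis using \<delta>(1) by simp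
  qed
  have mach: "(fst (v x))\<^sup>2 + (snd (v x))\<^sup>2 \<le> k * csq (v x)" if "x \<in> - B" for x
  proof -
    have "norm (v x) \<le> (1 - \<delta>) * sound_speed \<gamma> (\<rho> x)" using \<delta>(2)[OF that] sspos[OF that] by (simp add: pos_divide_le_eq)
    then have "(norm (v x))\<^sup>2 \<le> ((1 - \<delta>) * sound_speed \<gamma> (\<rho> x))\<^sup>2" by (intro power_mono) auto
    then show ?thesis by (simp add: norm_sq_coords power_mult_distrib ss[OF that] k_def)
  qed
  obtain u where u: "u \<ge> 0" "(v \<longlongrightarrow> (u, 0)) at_infinity" using inf by (auto simp: horizontal_at_infinity_def)
  have ev: "eventually (\<lambda>x. x \<in> - B) at_infinity" by (rule eventually_outside_body[OF B(1)])
  have lv: "((\<lambda>x. fst (v x)) \<longlongrightarrow> u) at_infinity" "((\<lambda>x. snd (v x)) \<longlongrightarrow> 0) at_infinity"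
    using tendsto_fst[OF u(2)] tendsto_snd[OF u(2)] by simp_all
  have "((\<lambda>x. csq (v x)) \<longlongrightarrow> csq (u, 0)) at_infinity"
    unfolding csq_def fst_conv snd_conv by (intro tendsto_intros lv) simp_all
  then have "((\<lambda>x. k * csq (v x)) \<longlongrightarrow> k * csq (u, 0)) at_infinity" by (intro tendsto_intros)
  moreover have "((\<lambda>x. (fst (v x))\<^sup>2 + (snd (v x))\<^sup>2) \<longlongrightarrow> u\<^sup>2 + 0\<^sup>2) at_infinity" by (intro tendsto_intros lv)
  ultimately have uk: "u\<^sup>2 + 0\<^sup>2 \<le> k * csq (u, 0)"
    by (rule tendsto_le[OF trivial_limit_at_infinity]) (rule eventually_mono[OF ev mach])
  have c0: "0 < csq (u, 0)"
  proof (rule ccontr)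
    assume neg: "\<not> 0 < csq (u, 0)"
    have "0 \<le> k" by (simp add: k_def)
    then have "k * csq (u, 0) \<le> 0" using neg by (simp add: mult_nonneg_nonpos)
    with uk have "u\<^sup>2 + 0\<^sup>2 \<le> 0" by (rule order_trans)
    then have "u = 0" by simp
    then show False using neg \<gamma> K by (simp add: csq_def)
  qed
  have uc: "u\<^sup>2 < csq (u, 0)"
  proof -
    have "k * csq (u, 0) < 1 * csq (u, 0)" using k c0 by (intro mult_strict_right_mono)
    then show ?thesis using uk by simp
  qed
  define b where "b = 1 - u\<^sup>2 / csq (u, 0)"
  have b: "0 < b" "b \<le> 1" using uc c0 by (simp_all add: b_def)
  have evn: "eventually (\<lambda>x. P (v x)) at_infinity" if "eventually P (nhds (u, 0))" for P
    using u(2) that unfolding filterlim_iff by blast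
  obtain L1 where L1: "L1 \<ge> 0" "eventually (\<lambda>w. norm (w - (u, 0)) \<le> L1 * (\<bar>density w * fst w - density (u, 0) * u\<bar> + \<bar>density w * snd w\<bar>)) (nhds (u, 0))"
    using mass_flux_Lipschitz_below[OF c0 uc] by blast
  obtain L2 where L2: "L2 \<ge> 0" "eventually (\<lambda>w. 0 < csq w - (snd w)\<^sup>2 \<and>
      \<bar>(1 - u\<^sup>2 / csq (u, 0)) - (csq w - (fst w)\<^sup>2) / (csq w - (snd w)\<^sup>2)\<bar> \<le> L2 * norm (w - (u, 0)) \<and>
      \<bar>2 * fst w * snd w / (csq w - (snd w)\<^sup>2)\<bar> \<le> L2 * norm (w - (u, 0))) (nhds (u, 0))"
    using coefficient_Lipschitz[OF c0] by blast
  let ?m = "density (u, 0) * u"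
  define C where "C = 4 * L2\<^sup>2 * L1\<^sup>2"
  have pde: "(csq (v x) - (fst (v x))\<^sup>2) * partial_xy 2 0 \<psi> x - 2 * fst (v x) * snd (v x) * partial_xy 1 1 \<psi> x
     + (csq (v x) - (snd (v x))\<^sup>2) * partial_xy 0 2 \<psi> x = 0" if "x \<in> - B" for x
    by (rule stream_function_pde[OF _ \<psi> vd pos flux irr that]) (use B in auto)
  have "eventually (\<lambda>x. (b * partial_xy 2 0 \<psi> x + partial_xy 0 2 \<psi> x)\<^sup>2
       \<le> C * ((partial_xy 1 0 \<psi> x)\<^sup>2 + (partial_xy 0 1 \<psi> x - ?m)\<^sup>2) * ((partial_xy 2 0 \<psi> x)\<^sup>2 + (partial_xy 1 1 \<psi> x)\<^sup>2)) at_infinity"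
    using ev evn[OF L1(2)] evn[OF L2(2)]
  proof eventually_elim
    case (elim x)
    have n: "norm (v x - (u, 0)) \<le> L1 * (\<bar>partial_xy 0 1 \<psi> x - ?m\<bar> + \<bar>partial_xy 1 0 \<psi> x\<bar>)"
      using elim(2) unfolding flux'[OF elim(1)] by simp
    show ?case unfolding C_def b_def
      using elim(3) by (intro asymptotic_coefficient_bound[OF _ pde[OF elim(1)] _ _ norm_ge_zero n L2(1) L1(1)]) blast+
  qed
  then obtain R where R: "\<And>x. R < norm x \<Longrightarrow> (b * partial_xy 2 0 \<psi> x + partial_xy 0 2 \<psi> x)\<^sup>2
       \<le> C * ((partial_xy 1 0 \<psi> x)\<^sup>2 + (partial_xy 0 1 \<psi> x - ?m)\<^sup>2) * ((partial_xy 2 0 \<psi> x)\<^sup>2 + (partial_xy 1 1 \<psi> x)\<^sup>2)"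
    unfolding eventually_at_infinity_real_prod by blast
  obtain M where M: "\<And>x. x \<in> - B \<Longrightarrow> norm (partial_x \<psi> x, partial_y \<psi> x) \<le> M"
    using F by (auto simp: bounded_iff)
  interpret elliptic_stream B "1 - k" "\<lambda>x. 1 - (fst (v x))\<^sup>2 / csq (v x)" "\<lambda>x. - (fst (v x) * snd (v x) / csq (v x))"
     "\<lambda>x. 1 - (snd (v x))\<^sup>2 / csq (v x)" \<psi> ?m M "sqrt b" C R
  proof
    show "open (- B)" using B by auto
    show "0 < 1 - k" using k by simp
    show "(1 - k) * (s\<^sup>2 + t\<^sup>2) \<le> (1 - (fst (v x))\<^sup>2 / csq (v x)) * s\<^sup>2 + 2 * (- (fst (v x) * snd (v x) / csq (v x))) * s * t + (1 - (snd (v x))\<^sup>2 / csq (v x)) * t\<^sup>2"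
      "(1 - (fst (v x))\<^sup>2 / csq (v x)) * s\<^sup>2 + 2 * (- (fst (v x) * snd (v x) / csq (v x))) * s * t + (1 - (snd (v x))\<^sup>2 / csq (v x)) * t\<^sup>2 \<le> s\<^sup>2 + t\<^sup>2"
      if "x \<in> - B" for x s t
      by (rule subsonic_form_bounds[OF pos[OF that] mach[OF that]])+
    show "(1 - (fst (v x))\<^sup>2 / csq (v x)) * partial_xy 2 0 \<psi> x + 2 * (- (fst (v x) * snd (v x) / csq (v x))) * partial_xy 1 1 \<psi> x
       + (1 - (snd (v x))\<^sup>2 / csq (v x)) * partial_xy 0 2 \<psi> x = 0" if "x \<in> - B" for x
    proof -
      define c2 where "c2 = csq (v x)"
      have c2: "c2 \<noteq> 0" using pos[OF that] by (simp add: c2_def)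
      have "c2 * ((1 - (fst (v x))\<^sup>2 / c2) * partial_xy 2 0 \<psi> x + 2 * (- (fst (v x) * snd (v x) / c2)) * partial_xy 1 1 \<psi> x
       + (1 - (snd (v x))\<^sup>2 / c2) * partial_xy 0 2 \<psi> x)
       = (c2 - (fst (v x))\<^sup>2) * partial_xy 2 0 \<psi> x - 2 * fst (v x) * snd (v x) * partial_xy 1 1 \<psi> x
         + (c2 - (snd (v x))\<^sup>2) * partial_xy 0 2 \<psi> x"
        using c2 by (simp add: field_simps)
      then show ?thesis using pde[OF that] c2 unfolding c2_def by (metis mult_eq_0_iff)
    qed
    show "\<bar>partial_xy 1 0 \<psi> x\<bar> \<le> M \<and> \<bar>partial_xy 0 1 \<psi> x\<bar> \<le> M" if "x \<in> - B" for x
      using M[OF that] norm_fst_le[of "partial_x \<psi> x" "partial_y \<psi> x"] norm_snd_le[of "partial_y \<psi> x" "partial_x \<psi> x"]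
      unfolding partial_xy_simps by simp
    show "0 \<le> ?m" using density_pos[OF c0] u(1) by simp
    have "has_partials {(u, 0)} density (\<lambda>x. - (density x / csq x) * fst x) (\<lambda>x. - (density x / csq x) * snd x)"
      using has_partials_density[OF has_partials_fst has_partials_snd, of "{(u, 0)}"] c0 by simp
    then have "isCont density (u, 0)"
      unfolding has_partials_def using has_derivative_continuous by blast
    then have dl: "((\<lambda>x. density (v x)) \<longlongrightarrow> density (u, 0)) at_infinity" using u(2) by (rule isCont_tendsto_compose)
    have "((\<lambda>x. density (v x) * fst (v x)) \<longlongrightarrow> ?m) at_infinity" by (intro tendsto_intros dl lv)
    then show "(partial_xy 0 1 \<psi> \<longlongrightarrow> ?m) at_infinity"
      by (rule Lim_transform_eventually) (rule eventually_mono[OF ev], simp add: flux' del: One_nat_def)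
    have "((\<lambda>x. - (density (v x) * snd (v x))) \<longlongrightarrow> - (density (u, 0) * 0)) at_infinity" by (intro tendsto_intros dl lv)
    then have "((\<lambda>x. - (density (v x) * snd (v x))) \<longlongrightarrow> 0) at_infinity" by simp
    then show "(partial_xy 1 0 \<psi> \<longlongrightarrow> 0) at_infinity"
      by (rule Lim_transform_eventually) (rule eventually_mono[OF ev], simp add: flux' del: One_nat_def)
    show "0 < sqrt b" "sqrt b \<le> 1" using b by simp_all
    show "0 \<le> C" by (simp add: C_def)
    have sb: "(sqrt b)\<^sup>2 = b" using b by simp
    show "((sqrt b)\<^sup>2 * partial_xy 2 0 \<psi> x + partial_xy 0 2 \<psi> x)\<^sup>2
       \<le> C * ((partial_xy 1 0 \<psi> x)\<^sup>2 + (partial_xy 0 1 \<psi> x - ?m)\<^sup>2) * ((partial_xy 2 0 \<psi> x)\<^sup>2 + (partial_xy 1 1 \<psi> x)\<^sup>2)"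
      if "R < norm x" for x
      using R[OF that] unfolding sb .
  qed (use B \<psi> slip in auto)
  have "partial_x \<psi> x = 0" "partial_y \<psi> x = 0"
    using gradient_vanishes[OF line low high x] unfolding partial_xy_simps by auto
  then have "\<rho> x *\<^sub>R v x = 0" using flux0[OF x] by (simp add: zero_prod_def)
  then show ?thesis using \<rho>[OF x] by simp
qed

end

theorem theorem2:
  fixes B :: "(real \<times> real) set" and \<gamma> K :: real and p\<^sub>l p\<^sub>h :: "real \<times> real"
  assumes "1 < \<gamma>" and "0 < K"
    and "solid_body B"
    and "\<nexists>y\<^sub>0. B \<subseteq> {q. snd q = y\<^sub>0}"
    and "protruding_corner B p\<^sub>l" and "\<forall>q\<in>B. snd p\<^sub>l \<le> snd q"
    and "protruding_corner B p\<^sub>h" and "\<forall>q\<in>B. snd q \<le> snd p\<^sub>h"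
  shows "(\<nexists>\<psi> v \<rho>. uniformly_subsonic_flow \<gamma> K B \<psi> v \<rho> \<and>
              horizontal_at_infinity v \<and> nontrivial_flow B v) \<and>
         (\<nexists>\<psi> v. incompressible_flow B \<psi> v \<and> bounded (v ` (- B)) \<and>
              horizontal_at_infinity v \<and> nontrivial_flow B v)"
proof -
  interpret isentropic_gas \<gamma> K by standard (rule assms)+
  show ?thesis
    using no_subsonic_flow[OF assms(3-8)] no_incompressible_flow[OF assms(3-8)]
    unfolding nontrivial_flow_def by blast
qed

end
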